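(* Let $G$ be a cubic essentially $4$-edge-connected graph. Then $f(G)\leq 3$.
   Context: Graphs are finite and undirected; parallel edges are allowed. For a graph $G=(V,E)$ and $X\subseteq V$, $\delta_G(X)$ is the set of edges with exactly one endvertex in $X$; $G$ is $k$-edge-connected if $|\delta_G(X)|\ge k$ for every nonempty proper subset $X$ of $V$; $G$ is cubic if every vertex has degree $3$. $G$ is essentially $4$-edge-connected if it is $3$-edge-connected and for every $X$ with $|\delta_G(X)|=3$ one has $|X|=1$ or $|V-X|=1$. An orientation of $G$ replaces each edge $uv$ by exactly one of the arcs $uv$ or $vu$; for $e\in E$, $\vec e$ denotes the corresponding arc. A digraph is strongly connected if for every nonempty proper vertex subset $X$ some arc leaves $X$. For a $3$-edge-connected graph $G$, the Frank number $f(G)$ is the minimum integer $k$ such that there exist $k$ orientations $D_1,\dots,D_k$ of $G$ with the property that for every edge $e$ of $G$ there is an $i$ with $D_i-\vec e$ strongly connected. *)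

theory Defs
  imports "Graph_Theory.Digraph_Component" "HOL-Library.Extended_Nat"
begin

text \<open>
  Undirected multigraphs: edges have an identity of their own, so distinct edges may have the same
  set of endvertices. As \<^term>\<open>card (ends G e) = 2\<close>, there are no loops.
\<close>

record ('v, 'e) multigraph =
  vertices :: "'v set"
  edges :: "'e set"
  ends :: "'e \<Rightarrow> 'v set"

locale fin_multigraph =
  fixes G :: "('v, 'e) multigraph"
  assumes finite_vertices: "finite (vertices G)"
    and finite_edges: "finite (edges G)"
    and ends_subset: "e \<in> edges G \<Longrightarrow> ends G e \<subseteq> vertices G"
    and card_ends: "e \<in> edges G \<Longrightarrow> card (ends G e) = 2"

definition cut :: "('v, 'e) multigraph \<Rightarrow> 'v set \<Rightarrow> 'e set" where
  "cut G X = {e \<in> edges G. card (ends G e \<inter> X) = 1}"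

definition degree :: "('v, 'e) multigraph \<Rightarrow> 'v \<Rightarrow> nat" where
  "degree G v = card {e \<in> edges G. v \<in> ends G e}"

definition cubic :: "('v, 'e) multigraph \<Rightarrow> bool" where
  "cubic G \<longleftrightarrow> (\<forall>v \<in> vertices G. degree G v = 3)"

definition k_edge_connected :: "nat \<Rightarrow> ('v, 'e) multigraph \<Rightarrow> bool" where
  "k_edge_connected k G \<longleftrightarrow> (\<forall>X. X \<noteq> {} \<and> X \<subset> vertices G \<longrightarrow> k \<le> card (cut G X))"

definition essentially_4_edge_connected :: "('v, 'e) multigraph \<Rightarrow> bool" where
  "essentially_4_edge_connected G \<longleftrightarrow>
     k_edge_connected 3 G \<and>
     (\<forall>X \<subseteq> vertices G. card (cut G X) = 3 \<longrightarrow> card X = 1 \<or> card (vertices G - X) = 1)"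

text \<open>
  An orientation keeps the edge names, so that the arc corresponding to an edge \<open>e\<close> is \<open>e\<close> itself
  and deleting that arc leaves all arcs parallel to it in place.
\<close>

definition orientation :: "('v, 'e) pre_digraph \<Rightarrow> ('v, 'e) multigraph \<Rightarrow> bool" where
  "orientation D G \<longleftrightarrow>
     verts D = vertices G \<and> arcs D = edges G \<and>
     (\<forall>e \<in> edges G. {tail D e, head D e} = ends G e)"

definition frank_cover :: "('v, 'e) multigraph \<Rightarrow> nat \<Rightarrow> bool" where
  "frank_cover G k \<longleftrightarrow>
     (\<exists>D :: nat \<Rightarrow> ('v, 'e) pre_digraph.
        (\<forall>i < k. orientation (D i) G) \<and>
        (\<forall>e \<in> edges G. \<exists>i < k. strongly_connected (pre_digraph.del_arc (D i) e)))"

text \<open>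
  The infimum is taken in \<^typ>\<open>enat\<close>: it is the minimum if some number of orientations
  suffices, and \<open>\<infinity>\<close> otherwise.
\<close>

definition frank_number :: "('v, 'e) multigraph \<Rightarrow> enat" where
  "frank_number G = (INF k \<in> {k. frank_cover G k}. enat k)"

lemma frank_number_le_iff:
  "frank_number G \<le> enat n \<longleftrightarrow> (\<exists>k \<le> n. frank_cover G k)"
proof
  assume le: "frank_number G \<le> enat n"
  have ne: "enat ` {k. frank_cover G k} \<noteq> {}"
    using le by (auto simp: frank_number_def Inf_enat_def split: if_splits)
  then have "frank_number G \<in> enat ` {k. frank_cover G k}"
    unfolding frank_number_def Inf_enat_def by (auto intro: LeastI)
  with le show "\<exists>k \<le> n. frank_cover G k" by auto
next
  assume "\<exists>k \<le> n. frank_cover G k"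
  then obtain k where "k \<le> n" "frank_cover G k" by blast
  then show "frank_number G \<le> enat n"
    unfolding frank_number_def by (auto intro: INF_lower2)
qed

text \<open>
  Strong connectivity of digraphs in the library is defined by reachability; it agrees with the
  characterization by arcs leaving vertex sets.
\<close>

lemma (in wf_digraph) strongly_connected_iff_cuts:
  "strongly_connected G \<longleftrightarrow>
     verts G \<noteq> {} \<and>
     (\<forall>X. X \<noteq> {} \<and> X \<subset> verts G \<longrightarrow> (\<exists>a \<in> arcs G. tail G a \<in> X \<and> head G a \<notin> X))"
proof (intro iffI conjI allI impI)
  assume sc: "strongly_connected G"
  then show "verts G \<noteq> {}" by (simp add: strongly_connected_def)
  fix X assume X: "X \<noteq> {} \<and> X \<subset> verts G"
  then obtain u v where u: "u \<in> X" and v: "v \<in> verts G" "v \<notin> X" by blast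
  with X sc have "u \<rightarrow>\<^sup>* v" by (auto simp: strongly_connected_def)
  then show "\<exists>a \<in> arcs G. tail G a \<in> X \<and> head G a \<notin> X"
    using u v(2)
  proof (induct rule: converse_reachable_induct)
    case base
    then show ?case by simp
  next
    case (step x y)
    then show ?case by (cases "y \<in> X") (auto simp: arcs_ends_conv)
  qed
next
  assume *: "verts G \<noteq> {} \<and>
    (\<forall>X. X \<noteq> {} \<and> X \<subset> verts G \<longrightarrow> (\<exists>a \<in> arcs G. tail G a \<in> X \<and> head G a \<notin> X))"
  have "u \<rightarrow>\<^sup>* v" if u: "u \<in> verts G" and v: "v \<in> verts G" for u v
  proof (rule ccontr)
    assume nr: "\<not> u \<rightarrow>\<^sup>* v"
    define X where "X = {w. u \<rightarrow>\<^sup>* w}"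
    have "u \<in> X" using u by (simp add: X_def reachable_def)
    moreover have "X \<subset> verts G" using nr v by (auto simp: X_def dest: reachable_in_verts)
    ultimately obtain a where a: "a \<in> arcs G" "tail G a \<in> X" "head G a \<notin> X"
      using * by blast
    then have "tail G a \<rightarrow> head G a" by (auto simp: arcs_ends_conv)
    with a show False by (auto simp: X_def dest: reachable_adj_trans)
  qed
  with * show "strongly_connected G" by (simp add: strongly_connected_def)
qed

end

theory Submission
  imports Defs "HOL-Combinatorics.Orbits" "HOL-Library.Disjoint_Sets"
begin

text \<open>
  By Petersen's theorem \<open>E\<close> is the union of a perfect matching \<open>M\<close> and a \<open>2\<close>-factor. Choosing one
  edge from every odd cycle of the \<open>2\<close>-factor gives a matching \<open>\<Delta>\<close>, and the remaining edges of the
  \<open>2\<close>-factor split into two matchings \<open>A\<close> and \<open>B\<close>. There is an orientation in which all edges of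
  \<open>M \<union> \<Delta>\<close> can be deleted one at a time, and for every matching \<open>F\<close> there is one in which all edges of
  \<open>F\<close> can be deleted.

  Both orientations come from the same source, a variant of Nash-Williams' odd-vertex pairing: if \<open>w\<close>
  is an edge weighting in which every cut separating a set \<open>N\<close> of terminals has weight at least \<open>4\<close>,
  then the vertices of odd degree can be paired such that each of these cuts separates at least \<open>4\<close>
  pairs fewer than its weight. Such a pairing \<open>p\<close>, together with a second fixpoint-free involution,
  forms even alternating cycles, so there is a sign that is reversed by both; this sign prescribes the
  orientation, and the pairing bounds the difference of the numbers of edges entering and leaving a cut.

  For \<open>M \<union> \<Delta>\<close>, the weights are \<open>1\<close> on \<open>M \<union> \<Delta>\<close> and \<open>2\<close> elsewhere, every vertex is a terminal, and the
  cycles of the \<open>2\<close>-factor are directed cyclically. For a matching \<open>F\<close>, take a maximum set \<open>A\<close> of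
  edges outside \<open>F\<close> that has a totally cyclic orientation of the kind \<open>balanced_arcs\<close>, give it
  weight \<open>4\<close>, and let the terminals be the vertices on \<open>A\<close>; a cut left by a single edge of \<open>F\<close> that
  does not separate the terminals would yield a directed cycle that extends \<open>A\<close>.
\<close>

section \<open>Pairing the vertices of odd degree\<close>

text \<open>The 4 is twice 2: with unit weights, a pairing that bounds the difference of entering
  and leaving edges by the weight minus 4 forces at least 2 leaving edges, and one of them can be
  spared. The obstacle is that a cubic graph violates the hypothesis at the stars of its vertices;
  by essential 4-edge-connectivity these are its only cuts of size 3. The two weightings get around
  the stars differently. Doubling the edges of the 2-factor outside \<open>\<Delta>\<close> raises
  every star to 4 or 5, at the price that the doubled edges take no part in the signs and have to be
  balanced by directing the cycles. The direction of an edge of \<open>\<Delta>\<close> is dictated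
  by the sign and is met by reversing its whole cycle, so a cycle can afford only one such edge. For
  a matching \<open>F\<close>, a star either contains an edge of weight 4 or does not separate the
  terminals, which is why the pairing theorem is stated with terminals; the maximality of the
  totally cyclic set takes care of the cuts that the bound does not reach.\<close>

definition btw :: "('a \<Rightarrow> 'a \<Rightarrow> nat) \<Rightarrow> 'a set \<Rightarrow> 'a set \<Rightarrow> nat" where
  "btw w A B = (\<Sum>a\<in>A. \<Sum>b\<in>B. w a b)"

definition ecut :: "('a \<Rightarrow> 'a \<Rightarrow> nat) \<Rightarrow> 'a set \<Rightarrow> 'a set \<Rightarrow> nat" where
  "ecut w V X = btw w X (V - X)"

definition symw :: "('a \<Rightarrow> 'a \<Rightarrow> nat) \<Rightarrow> bool" where
  "symw w \<longleftrightarrow> (\<forall>x y. w x y = w y x)"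

definition separates :: "'a set \<Rightarrow> 'a set \<Rightarrow> bool" where
  "separates N X \<longleftrightarrow> X \<inter> N \<noteq> {} \<and> N - X \<noteq> {}"

text \<open>For \<open>u = v\<close> this is the zero weight, so a loop that arises from splitting
  off two parallel edges disappears.\<close>

definition edgew :: "'a \<Rightarrow> 'a \<Rightarrow> 'a \<Rightarrow> 'a \<Rightarrow> nat" where
  "edgew u v x y = of_bool (u \<noteq> v \<and> {x, y} = {u, v})"

lemma btw_empty [simp]: "btw w {} B = 0" "btw w A {} = 0"
  by (simp_all add: btw_def)

lemma btw_sym: "symw w \<Longrightarrow> btw w A B = btw w B A"
  unfolding btw_def symw_def by (subst sum.swap) simp

lemma btw_Un_left:
  "finite A \<Longrightarrow> finite B \<Longrightarrow> A \<inter> B = {} \<Longrightarrow> btw w (A \<union> B) C = btw w A C + btw w B C"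
  by (simp add: btw_def sum.union_disjoint)

lemma btw_Un_right:
  "finite A \<Longrightarrow> finite B \<Longrightarrow> A \<inter> B = {} \<Longrightarrow> btw w C (A \<union> B) = btw w C A + btw w C B"
  by (simp add: btw_def sum.union_disjoint sum.distrib)

lemma btw_plus: "btw (\<lambda>x y. w x y + w' x y) A B = btw w A B + btw w' A B"
  by (simp add: btw_def sum.distrib)

lemma btw_cong: "(\<And>x y. x \<in> A \<Longrightarrow> y \<in> B \<Longrightarrow> w x y = w' x y) \<Longrightarrow> btw w A B = btw w' A B"
  by (simp add: btw_def)

lemma btw_mono:
  assumes "finite A'" "finite B'" "A \<subseteq> A'" "B \<subseteq> B'"
  shows "btw w A B \<le> btw w A' B'"
proof -
  have "btw w A B \<le> (\<Sum>a\<in>A. \<Sum>b\<in>B'. w a b)"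
    unfolding btw_def using assms by (intro sum_mono sum_mono2) auto
  also have "\<dots> \<le> btw w A' B'"
    unfolding btw_def using assms by (intro sum_mono2) auto
  finally show ?thesis .
qed

lemma ecut_plus: "ecut (\<lambda>x y. w x y + w' x y) V X = ecut w V X + ecut w' V X"
  by (simp add: ecut_def btw_plus)

section \<open>Complements, submodularity and posimodularity of cuts\<close>

lemma ecut_compl: "symw w \<Longrightarrow> X \<subseteq> V \<Longrightarrow> ecut w V (V - X) = ecut w V X"
  by (simp add: ecut_def btw_sym double_diff)

text \<open>An edge between \<open>X\<close> and \<open>Y\<close> lies in both cuts on the right and
  not in that of the union. The other cut identities combine instances of this one.\<close>

lemma ecut_disjoint_Un:
  assumes "finite V" "symw w" "X \<subseteq> V" "Y \<subseteq> V" "X \<inter> Y = {}"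
  shows "ecut w V (X \<union> Y) + 2 * btw w X Y = ecut w V X + ecut w V Y"
proof -
  let ?Z = "V - (X \<union> Y)"
  have fin: "finite X" "finite Y" "finite ?Z"
    using assms by (auto intro: finite_subset)
  have 1: "V - X = ?Z \<union> Y" "V - Y = ?Z \<union> X" using assms by auto
  have "ecut w V X = btw w X ?Z + btw w X Y"
    unfolding ecut_def 1 using fin assms by (intro btw_Un_right) auto
  moreover have "ecut w V Y = btw w Y ?Z + btw w Y X"
    unfolding ecut_def 1 using fin assms by (intro btw_Un_right) auto
  moreover have "ecut w V (X \<union> Y) = btw w X ?Z + btw w Y ?Z"
    unfolding ecut_def using fin assms by (intro btw_Un_left) auto
  ultimately show ?thesis using btw_sym[OF assms(2), of X Y] by simp
qed

text \<open>The sets are cut into the disjoint pieces \<open>X \<inter> Y\<close>,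
  \<open>X - Y\<close> and \<open>Y - X\<close>. The term that the usual inequality drops is kept:
  for tight sets it shows that opposite corners are not joined.\<close>

lemma ecut_submodular:
  assumes "finite V" "symw w" "X \<subseteq> V" "Y \<subseteq> V"
  shows "ecut w V X + ecut w V Y =
    ecut w V (X \<inter> Y) + ecut w V (X \<union> Y) + 2 * btw w (X - Y) (Y - X)"
proof -
  note d = ecut_disjoint_Un[OF assms(1,2)]
  have e: "X \<inter> Y \<union> (X - Y) = X" "X \<inter> Y \<union> (Y - X) = Y" "X \<union> (Y - X) = X \<union> Y" by auto
  have fin: "finite X" "finite Y" using assms by (auto intro: finite_subset)
  have "btw w X (Y - X) = btw w (X \<inter> Y) (Y - X) + btw w (X - Y) (Y - X)"
    using btw_Un_left[of "X \<inter> Y" "X - Y" w "Y - X"] fin e by auto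
  moreover have "ecut w V X + 2 * btw w (X \<inter> Y) (X - Y) = ecut w V (X \<inter> Y) + ecut w V (X - Y)"
    using d[of "X \<inter> Y" "X - Y"] assms e by auto
  moreover have "ecut w V Y + 2 * btw w (X \<inter> Y) (Y - X) = ecut w V (X \<inter> Y) + ecut w V (Y - X)"
    using d[of "X \<inter> Y" "Y - X"] assms e by auto
  moreover have "ecut w V (X \<union> Y) + 2 * btw w X (Y - X) = ecut w V X + ecut w V (Y - X)"
    using d[of X "Y - X"] assms e by auto
  ultimately show ?thesis by simp
qed

text \<open>Submodularity for \<open>X\<close> and the complement of \<open>Y\<close>.\<close>

lemma ecut_posimodular:
  assumes "finite V" "symw w" "X \<subseteq> V" "Y \<subseteq> V"
  shows "ecut w V X + ecut w V Y =
    ecut w V (X - Y) + ecut w V (Y - X) + 2 * btw w (X \<inter> Y) (V - (X \<union> Y))"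
proof -
  have "X \<inter> (V - Y) = X - Y" "V - (X \<union> (V - Y)) = Y - X" "X - (V - Y) = X \<inter> Y"
    "V - Y - X = V - (X \<union> Y)"
    using assms by auto
  moreover have "ecut w V (X \<union> (V - Y)) = ecut w V (V - (X \<union> (V - Y)))"
    using assms by (subst ecut_compl) auto
  ultimately show ?thesis
    using ecut_submodular[OF assms(1-3), of "V - Y"] ecut_compl[OF assms(2,4)] assms by simp
qed

lemma ecut_le_sum:
  assumes "finite V" "symw w" "X \<subseteq> V"
  shows "ecut w V X \<le> (\<Sum>x\<in>X. ecut w V {x})"
proof -
  have "finite X" using assms finite_subset by blast
  then show ?thesis using assms(3)
  proof (induct X)
    case empty
    then show ?case by (simp add: ecut_def)
  next
    case (insert x F)
    then have "ecut w V ({x} \<union> F) \<le> ecut w V {x} + ecut w V F"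
      using ecut_disjoint_Un[OF assms(1,2), of "{x}" F] by simp
    with insert show ?case by simp
  qed
qed

section \<open>Single edges, normalization and contraction of weights\<close>

lemma symw_edgew [simp]: "symw (edgew u v)"
  by (auto simp: symw_def edgew_def insert_commute)

lemma symw_plus [simp]: "symw w \<Longrightarrow> symw w' \<Longrightarrow> symw (\<lambda>x y. w x y + w' x y)"
  by (simp add: symw_def)

lemma ecut_edgew:
  assumes "finite V" "u \<in> V" "v \<in> V" "X \<subseteq> V"
  shows "ecut (edgew u v) V X = of_bool ((u \<in> X) \<noteq> (v \<in> X))"
proof -
  have fin: "finite X" using assms finite_subset by blast
  have e: "edgew u v x y = (if x = u then if y = v then of_bool (u \<noteq> v) else 0 else 0) +
      (if x = v then if y = u then of_bool (u \<noteq> v) else 0 else 0)" for x y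
    by (auto simp: edgew_def doubleton_eq_iff)
  have s: "(\<Sum>x\<in>X. \<Sum>y\<in>V - X. (if x = a then if y = b then c else 0 else 0)) =
      (if a \<in> X \<and> b \<in> V - X then c else (0::nat))" for a b c
  proof -
    have "(\<Sum>y\<in>V - X. (if x = a then if y = b then c else 0 else 0)) =
       (if x = a then if b \<in> V - X then c else 0 else (0::nat))" for x
      using assms by (simp add: sum.delta')
    then show ?thesis using fin by (simp add: sum.delta')
  qed
  show ?thesis
    unfolding ecut_def btw_def e sum.distrib s using assms by auto
qed

text \<open>Replacing two edges \<open>va\<close>, \<open>vb\<close> by \<open>ab\<close> keeps all degree parities and increases no cut.\<close>

lemma normalize_weights:
  assumes "finite V" "symw q"
  shows "\<exists>q'. symw q' \<and> (\<forall>v\<in>V. ecut q' V {v} \<le> 1 \<and> even (ecut q' V {v} + ecut q V {v})) \<and>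
    (\<forall>X\<subseteq>V. ecut q' V X \<le> ecut q V X)"
  using assms(2)
proof (induct "\<Sum>v\<in>V. ecut q V {v}" arbitrary: q rule: less_induct)
  case less
  show ?case
  proof (cases "\<forall>v\<in>V. ecut q V {v} \<le> 1")
    case True
    then show ?thesis using less.prems by auto
  next
    case False
    then obtain v where v: "v \<in> V" "ecut q V {v} \<ge> 2" by force
    have dv: "ecut q V {v} = (\<Sum>x\<in>V - {v}. q v x)" by (simp add: ecut_def btw_def)
    have "\<exists>a\<in>V-{v}. q v a > 0" using v dv by (metis sum.neutral not_gr_zero not_numeral_le_zero)
    then obtain a where a: "a \<in> V" "a \<noteq> v" "q v a > 0" by auto
    \<comment> \<open>The two edges at \<open>v\<close> may be parallel. Then \<open>a = b\<close>,
      the weight \<open>q v a\<close> has to be at least 2, and the new edge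
      \<open>edgew a b\<close> is zero.\<close>
    have "\<exists>b\<in>V-{v}. q v b > of_bool (a = b)"
    proof (rule ccontr)
      assume "\<not> ?thesis"
      then have "\<forall>b\<in>V-{v}. q v b \<le> of_bool (a = b)" by force
      then have "ecut q V {v} \<le> (\<Sum>b\<in>V-{v}. of_bool (a = b))"
        unfolding dv by (intro sum_mono) auto
      also have "\<dots> \<le> 1" using assms by (simp add: of_bool_def)
      finally show False using v by simp
    qed
    then obtain b where b: "b \<in> V" "b \<noteq> v" "q v b > of_bool (a = b)" by auto
    define q1 where "q1 x y = q x y - edgew v a x y - edgew v b x y" for x y
    have sub: "q1 x y + edgew v a x y + edgew v b x y = q x y" for x y
      using a b less.prems unfolding q1_def edgew_def symw_def
      by (auto simp: doubleton_eq_iff split: if_splits)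
    have sq: "symw q1" using less.prems symw_edgew[of v a] symw_edgew[of v b]
      by (simp add: symw_def q1_def)
    define q2 where "q2 x y = q1 x y + edgew a b x y" for x y
    have s2: "symw q2" unfolding q2_def using sq by simp
    have e1: "ecut q1 V X + ecut (edgew v a) V X + ecut (edgew v b) V X = ecut q V X" for X
    proof -
      have "ecut q V X = ecut (\<lambda>x y. q1 x y + edgew v a x y + edgew v b x y) V X"
        using sub by simp
      then show ?thesis by (simp add: ecut_plus)
    qed
    have e2: "ecut q2 V X = ecut q1 V X + ecut (edgew a b) V X" for X
      unfolding q2_def by (rule ecut_plus)
    have le: "ecut q2 V X \<le> ecut q V X" if "X \<subseteq> V" for X
      using e1[of X] e2[of X] that a b v assms by (auto simp: ecut_edgew of_bool_def split: if_splits)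
    have par: "even (ecut q2 V {x} + ecut q V {x})" if "x \<in> V" for x
      unfolding e1[of "{x}", symmetric] e2[of "{x}"] using that a b v assms
      by (auto simp: ecut_edgew of_bool_def split: if_splits)
    have lt: "ecut q2 V {v} < ecut q V {v}"
      using e1[of "{v}"] e2[of "{v}"] a b v assms by (auto simp: ecut_edgew)
    have "(\<Sum>v\<in>V. ecut q2 V {v}) < (\<Sum>v\<in>V. ecut q V {v})"
      using lt le v assms by (intro sum_strict_mono_ex1) auto
    from less.hyps[OF this s2] obtain q' where q': "symw q'"
      "\<forall>v\<in>V. ecut q' V {v} \<le> 1 \<and> even (ecut q' V {v} + ecut q2 V {v})"
      "\<forall>X\<subseteq>V. ecut q' V X \<le> ecut q2 V X" by blast
    have "even (ecut q' V {x} + ecut q V {x})" if "x \<in> V" for x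
      using q'(2) par[OF that] that by (meson dvd_add_right_iff even_add)
    moreover have "\<forall>X\<subseteq>V. ecut q' V X \<le> ecut q V X" using q'(3) le by (meson order_trans)
    ultimately show ?thesis using q' by blast
  qed
qed

text \<open>\<open>f\<close> contracts each of its fibres to a vertex. Edges inside a fibre end up
  on the diagonal of the new weight, which no cut sees.\<close>

lemma ecut_contract:
  assumes "finite V" "f ` V \<subseteq> V'" "finite V'" "X \<subseteq> V'"
  shows "ecut (\<lambda>x y. btw w {v \<in> V. f v = x} {v \<in> V. f v = y}) V' X = ecut w V {v \<in> V. f v \<in> X}"
proof -
  have fin: "finite X" using assms finite_subset by blast
  have g: "(\<Sum>x\<in>X. \<Sum>a\<in>{v \<in> V. f v = x}. h a) = (\<Sum>a\<in>{v \<in> V. f v \<in> X}. h a)"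
    if "finite X" for X and h :: "_ \<Rightarrow> nat"
  proof -
    have "(\<Sum>a\<in>{v \<in> V. f v \<in> X}. h a) = (\<Sum>x\<in>X. sum h {a \<in> {v \<in> V. f v \<in> X}. f a = x})"
      using assms that by (subst sum.group[where g=f and T=X, symmetric]) auto
    also have "\<dots> = (\<Sum>x\<in>X. \<Sum>a\<in>{v \<in> V. f v = x}. h a)"
      by (intro sum.cong) auto
    finally show ?thesis by simp
  qed
  have V: "{v \<in> V. f v \<in> V' - X} = V - {v \<in> V. f v \<in> X}" using assms by auto
  have "ecut (\<lambda>x y. btw w {v \<in> V. f v = x} {v \<in> V. f v = y}) V' X =
    (\<Sum>x\<in>X. \<Sum>a\<in>{v \<in> V. f v = x}. \<Sum>y\<in>V' - X. \<Sum>b\<in>{v \<in> V. f v = y}. w a b)"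
    unfolding ecut_def btw_def by (subst sum.swap) simp
  also have "\<dots> = (\<Sum>x\<in>X. \<Sum>a\<in>{v \<in> V. f v = x}. \<Sum>b\<in>V - {v \<in> V. f v \<in> X}. w a b)"
    using g[of "V' - X"] assms(3) V by simp
  also have "\<dots> = ecut w V {v \<in> V. f v \<in> X}"
    using g[OF fin] by (simp add: ecut_def btw_def)
  finally show ?thesis .
qed

text \<open>
  A vertex \<open>t\<close> of degree \<open>4\<close> with neighbours \<open>a1, a2, a3, a4\<close> has been removed; \<open>ecut w V\<close> refers to the
  remaining graph and \<open>s X\<close> counts the edges from \<open>t\<close> to \<open>X\<close>. A bad set is an obstacle to replacing the
  four edges at \<open>t\<close> by \<open>a1a2\<close> and \<open>a3a4\<close>. Uncrossing shows that one of the three splittings has no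
  obstacle.
\<close>

definition bad_split where
  "bad_split w V N a1 a2 a3 a4 X \<longleftrightarrow> X \<subseteq> V \<and> separates N X \<and> ecut w V X \<le> 3 \<and>
     a1 \<in> X \<and> a2 \<in> X \<and> a3 \<notin> X \<and> a4 \<notin> X"

locale splitting =
  fixes w :: "'a \<Rightarrow> 'a \<Rightarrow> nat" and V N :: "'a set" and s :: "'a set \<Rightarrow> nat"
  assumes fin: "finite V" and sym: "symw w" and NV: "N \<subseteq> V"
    and ge4: "\<And>X. X \<subseteq> V \<Longrightarrow> X \<inter> N \<noteq> {} \<Longrightarrow> 4 \<le> ecut w V X + s X"
    and tight: "\<And>X. X \<subset> V \<Longrightarrow> X \<inter> N \<noteq> {} \<Longrightarrow> ecut w V X + s X = 4 \<Longrightarrow> \<exists>x. X = {x}"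
begin

text \<open>The neighbours are not parameters of the locale, because the corner lemmas are used with
  their roles permuted; only the counting function \<open>s\<close> is fixed. They need not be
  distinct.\<close>

definition labelling where
  "labelling a1 a2 a3 a4 \<longleftrightarrow> {a1, a2, a3, a4} \<subseteq> V \<and>
    (\<forall>X. s X = of_bool (a1 \<in> X) + of_bool (a2 \<in> X) + of_bool (a3 \<in> X) + of_bool (a4 \<in> X))"

text \<open>Of the four neighbours, \<open>X \<inter> Y\<close> contains only \<open>a1\<close> and
  the outer corner only \<open>a4\<close>, so each has \<open>s\<close> equal to 1 and cut weight at
  least 3. The cuts of \<open>X\<close> and \<open>Y\<close> have weight at most 3, so equality
  holds throughout in the submodular identity, and \<open>tight\<close> shrinks the corners to
  singletons.\<close>

lemma corners_diag:
  assumes lab: "labelling a1 a2 a3 a4"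
    and X: "bad_split w V N a1 a2 a3 a4 X" and Y: "bad_split w V N a1 a3 a2 a4 Y"
    and AN: "X \<inter> Y \<inter> N \<noteq> {}" and DN: "N - (X \<union> Y) \<noteq> {}"
  shows "X \<inter> Y = {a1}" "V - (X \<union> Y) = {a4}" "ecut w V X = 3" "ecut w V Y = 3"
    "ecut w V {a1} = 3" "ecut w V {a4} = 3" "btw w (X - Y) (Y - X) = 0"
proof -
  note x = X[unfolded bad_split_def] and y = Y[unfolded bad_split_def]
  note l = lab[unfolded labelling_def]
  have sub: "X \<subseteq> V" "Y \<subseteq> V" using x y by auto
  let ?A = "X \<inter> Y" and ?D = "V - (X \<union> Y)"
  have sA: "s ?A = 1" and sD: "s ?D = 1" using x y l by auto
  have A: "3 \<le> ecut w V ?A" using ge4[of ?A] AN sub sA by fastforce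
  have D: "3 \<le> ecut w V ?D" using ge4[of ?D] DN NV sub sD by fastforce
  have e: "ecut w V (X \<union> Y) = ecut w V ?D"
    using ecut_compl[OF sym, of "X \<union> Y" V] sub by auto
  have sm: "ecut w V X + ecut w V Y = ecut w V ?A + ecut w V ?D + 2 * btw w (X - Y) (Y - X)"
    using ecut_submodular[OF fin sym sub] e by simp
  then show "ecut w V X = 3" "ecut w V Y = 3" "btw w (X - Y) (Y - X) = 0"
    using A D x y by linarith+
  have A3: "ecut w V ?A = 3" and D3: "ecut w V ?D = 3"
    using A D x y sm by linarith+
  have a: "a1 \<in> ?A" "a4 \<in> ?D" "?A \<subset> V" "?D \<subset> V" using x y l by auto
  obtain b where "?A = {b}" using tight[of ?A] A3 sA AN a(3) by fastforce
  with a(1) show "?A = {a1}" by (metis singletonD)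
  have "?D \<inter> N \<noteq> {}" using DN NV by auto
  then obtain c where "?D = {c}" using tight[of ?D] D3 sD a(4) by fastforce
  with a(2) show "?D = {a4}" by (metis singletonD)
  with \<open>?A = {a1}\<close> show "ecut w V {a1} = 3" "ecut w V {a4} = 3" using A3 D3 by simp_all
qed

lemma bad_split_compl:
  assumes "bad_split w V N a1 a2 a3 a4 X" "labelling a1 a2 a3 a4"
  shows "bad_split w V N a3 a4 a1 a2 (V - X)"
  using assms NV ecut_compl[OF sym, of X V]
  unfolding bad_split_def labelling_def separates_def by auto

text \<open>This is \<open>corners_diag\<close> for \<open>X\<close> and \<open>V - Y\<close>, with
  \<open>a2\<close>, \<open>a1\<close>, \<open>a4\<close>, \<open>a3\<close> in the roles of
  \<open>a1\<close>, \<open>a2\<close>, \<open>a3\<close>, \<open>a4\<close>.\<close>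

lemma corners_anti:
  assumes lab: "labelling a1 a2 a3 a4"
    and X: "bad_split w V N a1 a2 a3 a4 X" and Y: "bad_split w V N a1 a3 a2 a4 Y"
    and BN: "(X - Y) \<inter> N \<noteq> {}" and CN: "(Y - X) \<inter> N \<noteq> {}"
  shows "X - Y = {a2}" "Y - X = {a3}" "ecut w V X = 3" "ecut w V Y = 3"
    "ecut w V {a2} = 3" "ecut w V {a3} = 3" "btw w (X \<inter> Y) (V - (X \<union> Y)) = 0"
proof -
  have sub: "X \<subseteq> V" "Y \<subseteq> V" using X Y by (auto simp: bad_split_def)
  have lab': "labelling a2 a1 a4 a3" using lab unfolding labelling_def by (auto simp: add_ac)
  have Y': "bad_split w V N a2 a4 a1 a3 (V - Y)"
    using bad_split_compl[OF Y] lab by (auto simp: labelling_def bad_split_def)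
  have X': "bad_split w V N a2 a1 a4 a3 X" using X by (auto simp: bad_split_def)
  have e: "X \<inter> (V - Y) = X - Y" "V - (X \<union> (V - Y)) = Y - X" "X - (V - Y) = X \<inter> Y"
    "V - Y - X = V - (X \<union> Y)" "N - (X \<union> (V - Y)) = (Y - X) \<inter> N"
    using sub NV by auto
  note c = corners_diag[OF lab' X' Y', unfolded e, OF BN CN]
  from c show "X - Y = {a2}" "Y - X = {a3}" "ecut w V X = 3" "ecut w V Y = 3"
    "ecut w V {a2} = 3" "ecut w V {a3} = 3" "btw w (X \<inter> Y) (V - (X \<union> Y)) = 0"
    using ecut_compl[OF sym sub(2)] by simp_all
qed

text \<open>Parity: \<open>X\<close> is \<open>{a1, a2}\<close> and both vertices have degree 3, so
  the cut of \<open>X\<close> has even weight, yet it has weight 3.\<close>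

lemma not_both:
  assumes lab: "labelling a1 a2 a3 a4"
    and X: "bad_split w V N a1 a2 a3 a4 X" and Y: "bad_split w V N a1 a3 a2 a4 Y"
    and "X \<inter> Y \<inter> N \<noteq> {}" "N - (X \<union> Y) \<noteq> {}"
    and "(X - Y) \<inter> N \<noteq> {}" "(Y - X) \<inter> N \<noteq> {}"
  shows False
proof -
  note d = corners_diag[OF assms(1-5)]
  note a = corners_anti[OF assms(1-3) assms(6,7)]
  have X2: "X = {a1} \<union> {a2}" using d(1) a(1) by blast
  have "ecut w V X + 2 * btw w {a1} {a2} = 6"
    using ecut_disjoint_Un[OF fin sym, of "{a1}" "{a2}"] d(5) a(5) X2 a(1) d(1) X
    by (auto simp: bad_split_def)
  with d(3) show False by presburger
qed

text \<open>The only vertex outside \<open>X \<union> Y\<close> is the terminal \<open>a4\<close>,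
  which lies in \<open>Z\<close>; as \<open>Y - X\<close> has no terminal, a terminal missing from
  \<open>Z\<close> lies in \<open>X\<close>. Hence \<open>X\<close> and \<open>Z\<close> can be
  uncrossed in the other direction, and no edge joins \<open>X \<inter> Z\<close>, which contains
  \<open>a1\<close>, to \<open>Y - X\<close>. As \<open>Y\<close> and \<open>{a1}\<close> both have
  cut weight 3, nothing is left for the cut of \<open>Y - X\<close>.\<close>

lemma diag_C_empty:
  assumes lab: "labelling a1 a2 a3 a4"
    and X: "bad_split w V N a1 a2 a3 a4 X" and Y: "bad_split w V N a1 a3 a2 a4 Y"
    and Z: "bad_split w V N a1 a4 a2 a3 Z"
    and AN: "X \<inter> Y \<inter> N \<noteq> {}" and DN: "N - (X \<union> Y) \<noteq> {}"
    and CN: "(Y - X) \<inter> N = {}"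
  shows False
proof -
  note d = corners_diag[OF lab X Y AN DN]
  have sub: "X \<subseteq> V" "Y \<subseteq> V" "Z \<subseteq> V" using X Y Z by (auto simp: bad_split_def)
  have lab': "labelling a1 a2 a4 a3" using lab unfolding labelling_def by (auto simp: add_ac)
  have X': "bad_split w V N a1 a2 a4 a3 X" and Z': "bad_split w V N a1 a4 a2 a3 Z"
    using X Z by (auto simp: bad_split_def)
  have a14: "a1 \<in> Z" "a4 \<in> Z" "a4 \<notin> X" "a4 \<in> V" "a1 \<in> Y"
    using X Y Z lab by (auto simp: bad_split_def labelling_def)
  have aN: "a4 \<in> N" using d(2) DN NV by auto
  have "N - Z \<noteq> {}" using Z by (auto simp: bad_split_def separates_def)
  then have B: "(X - Z) \<inter> N \<noteq> {}"
  proof -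
    obtain n where n: "n \<in> N" "n \<notin> Z" using \<open>N - Z \<noteq> {}\<close> by auto
    have "n \<in> X"
    proof (rule ccontr)
      assume "n \<notin> X"
      then have "n \<notin> Y" using CN n by auto
      with \<open>n \<notin> X\<close> n NV have "n \<in> V - (X \<union> Y)" by auto
      then show False using d(2) a14 n by auto
    qed
    then show ?thesis using n by auto
  qed
  have C: "(Z - X) \<inter> N \<noteq> {}" using a14 aN by auto
  note b = corners_anti[OF lab' X' Z' B C]
  have CZ: "Y - X \<subseteq> V - (X \<union> Z)" using b(2) Y a14 sub by (auto simp: bad_split_def)
  have fY: "finite Y" using sub fin finite_subset by blast
  have "btw w {a1} (Y - X) \<le> btw w (X \<inter> Z) (V - (X \<union> Z))"
    using CZ a14 d(1) fin sub finite_subset[OF _ fin] by (intro btw_mono) auto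
  then have 0: "btw w {a1} (Y - X) = 0" using b(7) by simp
  have a1X: "a1 \<in> X" using d(1) by auto
  have YA: "{a1} \<union> (Y - X) = Y" using d(1) by auto
  have "ecut w V Y + 2 * btw w {a1} (Y - X) = ecut w V {a1} + ecut w V (Y - X)"
    using ecut_disjoint_Un[OF fin sym, of "{a1}" "Y - X"] YA sub a1X a14(5) by auto
  then have C0: "ecut w V (Y - X) = 0" using 0 d by simp
  \<comment> \<open>Of the four neighbours only \<open>a3\<close> lies in \<open>Y - X\<close>. With
    an empty cut, the complement reaches a total of 3, less than \<open>ge4\<close> demands.\<close>
  have s3: "s (V - (Y - X)) = 3"
    using lab X Y by (auto simp: labelling_def bad_split_def)
  have "(V - (Y - X)) \<inter> N \<noteq> {}" using DN NV by auto
  then have "4 \<le> ecut w V (V - (Y - X)) + 3" using ge4[of "V - (Y - X)"] s3 by auto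
  then show False using C0 ecut_compl[OF sym, of "Y - X" V] sub by auto
qed

lemma not_diag:
  assumes lab: "labelling a1 a2 a3 a4"
    and X: "bad_split w V N a1 a2 a3 a4 X" and Y: "bad_split w V N a1 a3 a2 a4 Y"
    and Z: "bad_split w V N a1 a4 a2 a3 Z"
    and AN: "X \<inter> Y \<inter> N \<noteq> {}" and DN: "N - (X \<union> Y) \<noteq> {}"
  shows False
proof -
  consider "(Y - X) \<inter> N = {}" | "(X - Y) \<inter> N = {}"
    using not_both[OF assms(1-3) AN DN] by auto
  then show False
  proof cases
    case 1
    then show ?thesis using diag_C_empty[OF assms] by simp
  next
    case 2
    have lab': "labelling a1 a3 a2 a4" using lab unfolding labelling_def by (auto simp: add_ac)
    have "bad_split w V N a1 a4 a3 a2 Z" using Z by (auto simp: bad_split_def)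
    from diag_C_empty[OF lab' Y X this _ _ 2] AN DN show ?thesis
      by (simp only: Int_commute[of Y] Un_commute[of Y]) simp
  qed
qed

text \<open>\<open>X\<close> and \<open>Y\<close> separate \<open>N\<close>, so there is a pair of
  opposite corners both of which contain terminals. The pair \<open>X - Y\<close>,
  \<open>Y - X\<close> turns into the other one when \<open>X\<close> and \<open>Z\<close> are
  replaced by their complements and the labels are permuted.\<close>

lemma not_all_bad:
  assumes lab: "labelling a1 a2 a3 a4"
    and X: "bad_split w V N a1 a2 a3 a4 X" and Y: "bad_split w V N a1 a3 a2 a4 Y"
    and Z: "bad_split w V N a1 a4 a2 a3 Z"
  shows False
proof (cases "X \<inter> Y \<inter> N \<noteq> {} \<and> N - (X \<union> Y) \<noteq> {}")
  case True
  then show ?thesis using not_diag[OF assms] by auto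
next
  case False
  then have bc: "(Y - X) \<inter> N \<noteq> {}" "(X - Y) \<inter> N \<noteq> {}"
    using X Y unfolding bad_split_def separates_def by blast+
  have lab': "labelling a3 a4 a1 a2" using lab unfolding labelling_def by (auto simp: add_ac)
  have X': "bad_split w V N a3 a4 a1 a2 (V - X)" by (rule bad_split_compl[OF X lab])
  have Y': "bad_split w V N a3 a1 a4 a2 Y" using Y by (auto simp: bad_split_def)
  have "labelling a1 a4 a2 a3" using lab unfolding labelling_def by (auto simp: add_ac)
  then have Z': "bad_split w V N a3 a2 a4 a1 (V - Z)"
    using bad_split_compl[OF Z] by (auto simp: bad_split_def)
  show ?thesis
    by (rule not_diag[OF lab' X' Y' Z']) (use bc NV X Y in \<open>auto simp: bad_split_def\<close>)
qed

end

section \<open>Reductions for the pairing: deletion, contraction and splitting off\<close>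

definition feasible where
  "feasible w V N \<longleftrightarrow> (\<forall>X\<subseteq>V. separates N X \<longrightarrow> 4 \<le> ecut w V X)"

text \<open>A pairing encoded as a weight: the degree condition makes it a perfect matching on the
  vertices of odd degree, and the pairs across a set are counted by \<open>ecut q\<close>. In this
  form the cut identities apply to pairings too, and pairings can be added and normalized.\<close>

definition pairing_weight where
  "pairing_weight w V N q \<longleftrightarrow> symw q \<and>
    (\<forall>v\<in>V. ecut q V {v} \<le> 1 \<and> even (ecut q V {v} + ecut w V {v})) \<and>
    (\<forall>X\<subseteq>V. separates N X \<longrightarrow> ecut q V X + 4 \<le> ecut w V X)"

lemma separates_compl: "X \<subseteq> V \<Longrightarrow> N \<subseteq> V \<Longrightarrow> separates N (V - X) \<longleftrightarrow> separates N X"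
  unfolding separates_def by auto

lemma edgew_le: "symw w \<Longrightarrow> w u v > 0 \<Longrightarrow> edgew u v x y \<le> w x y"
  unfolding edgew_def symw_def by (auto simp: doubleton_eq_iff Suc_le_eq)

text \<open>Adding \<open>uv\<close> to the pairing raises both sides of the inequality equally.
  Degrees may become 2; \<open>normalize_weights\<close> repairs this without increasing a cut or
  changing a parity.\<close>

lemma pairing_weight_delete:
  assumes "finite V" "symw w" "u \<in> V" "v \<in> V" "w u v > 0"
    and q: "pairing_weight (\<lambda>x y. w x y - edgew u v x y) V N q"
  shows "\<exists>q. pairing_weight w V N q"
proof -
  let ?w = "\<lambda>x y. w x y - edgew u v x y"
  let ?q = "\<lambda>x y. q x y + edgew u v x y"
  have w: "ecut w V X = ecut ?w V X + ecut (edgew u v) V X" for X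
    unfolding ecut_plus[symmetric] using edgew_le[OF assms(2,5)]
    by (simp add: ecut_def btw_def)
  have sq: "symw ?q" using q by (simp add: pairing_weight_def)
  obtain q' where q': "symw q'"
    "\<forall>v\<in>V. ecut q' V {v} \<le> 1 \<and> even (ecut q' V {v} + ecut ?q V {v})"
    "\<forall>X\<subseteq>V. ecut q' V X \<le> ecut ?q V X"
    using normalize_weights[OF assms(1) sq] by blast
  have qe: "ecut ?q V X = ecut q V X + ecut (edgew u v) V X" for X by (rule ecut_plus)
  have "even (ecut q' V {x} + ecut w V {x})" if "x \<in> V" for x
  proof -
    have "even (ecut q' V {x} + ecut q V {x} + ecut (edgew u v) V {x})"
      using q'(2) that qe by (simp add: add.assoc)
    moreover have "even (ecut q V {x} + ecut ?w V {x})"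
      using q that by (simp add: pairing_weight_def)
    ultimately show ?thesis unfolding w by presburger
  qed
  moreover have "ecut q' V X + 4 \<le> ecut w V X" if "X \<subseteq> V" "separates N X" for X
  proof -
    have "ecut q' V X \<le> ecut q V X + ecut (edgew u v) V X" using q'(3) that qe by auto
    moreover have "ecut q V X + 4 \<le> ecut ?w V X" using q that by (simp add: pairing_weight_def)
    ultimately show ?thesis unfolding w by simp
  qed
  ultimately show ?thesis using q' unfolding pairing_weight_def by blast
qed

lemma ecut_restrict:
  assumes "finite V" "S \<subseteq> V" "X \<subseteq> V" "\<forall>x y. x \<notin> S \<or> y \<notin> S \<longrightarrow> q x y = 0"
  shows "ecut q V X = btw q (X \<inter> S) (S - X)"
proof -
  have z: "q x y = 0" if "x \<notin> S" for x y using assms(4) that by blast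
  have z': "q x y = 0" if "y \<notin> S" for x y using assms(4) that by blast
  have fX: "finite X" using assms finite_subset by blast
  have 1: "btw q X (V - X) = (\<Sum>x\<in>X. \<Sum>y\<in>S - X. q x y)"
    unfolding btw_def using assms(1-3) z'
    by (intro sum.cong[OF refl] sum.mono_neutral_right) (auto, metis z' less_numeral_extra(3))
  also have "\<dots> = btw q (X \<inter> S) (S - X)"
    unfolding btw_def using fX z
    by (intro sum.mono_neutral_right) (auto intro: sum.neutral)
  finally show ?thesis by (simp add: ecut_def)
qed

text \<open>The contracted side \<open>V - S\<close> is represented by one of its terminals
  \<open>z\<close>, which lies outside every \<open>X \<subseteq> S\<close>; this is why
  \<open>X \<inter> N \<noteq> {}\<close> suffices in the conclusion. The degree of \<open>z\<close>
  is the weight 4 of the cut of \<open>S\<close>, hence \<open>q\<close> does not join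
  \<open>z\<close> to \<open>S\<close> and can be extended by 0.\<close>

lemma pairing_weight_contract_side:
  fixes V :: "'a set"
  assumes fin: "finite V" and sym: "symw w" and S: "S \<subseteq> V" and NV: "N \<subseteq> V"
    and z: "z \<in> N - S" and S4: "ecut w V S = 4"
    and feas: "feasible w V N" and big: "2 \<le> card (V - S)"
    and IH: "\<forall>(V'::'a set) w' N'. card V' < card V \<and> finite V' \<and> symw w' \<and> N' \<subseteq> V' \<and>
      feasible w' V' N' \<longrightarrow> (\<exists>q. pairing_weight w' V' N' q)"
  shows "\<exists>q. symw q \<and> (\<forall>x y. x \<notin> S \<or> y \<notin> S \<longrightarrow> q x y = 0) \<and>
    (\<forall>v\<in>S. ecut q V {v} \<le> 1 \<and> even (ecut q V {v} + ecut w V {v})) \<and>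
    (\<forall>X\<subseteq>S. X \<inter> N \<noteq> {} \<longrightarrow> ecut q V X + 4 \<le> ecut w V X)"
proof -
  define f where "f v = (if v \<in> S then v else z)" for v
  let ?V = "insert z S" and ?N = "insert z (N \<inter> S)"
  let ?w = "\<lambda>x y. btw w {v \<in> V. f v = x} {v \<in> V. f v = y}"
  have finS: "finite S" using S fin finite_subset by blast
  have fV: "f ` V \<subseteq> ?V" by (auto simp: f_def)
  have cw: "ecut ?w ?V X = ecut w V {v \<in> V. f v \<in> X}" if "X \<subseteq> ?V" for X
    using ecut_contract[OF fin fV _ that] finS by simp
  have pre: "{v \<in> V. f v \<in> X} = (if z \<in> X then X \<inter> S \<union> (V - S) else X)" if "X \<subseteq> ?V" for X
    using that S z NV by (auto simp: f_def)
  have "card ?V < card V"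
  proof -
    have "card S + card (V - S) = card V" using S fin by (simp add: card_Diff_subset card_mono finS)
    then show ?thesis using big z finS by simp
  qed
  moreover have "symw ?w" using btw_sym[OF sym] by (auto simp: symw_def)
  moreover have "feasible ?w ?V ?N"
    unfolding feasible_def
  proof (intro allI impI)
    fix X assume X: "X \<subseteq> ?V" "separates ?N X"
    then have "separates N {v \<in> V. f v \<in> X}"
      using z S NV unfolding pre[OF X(1)] separates_def by auto
    then show "4 \<le> ecut ?w ?V X" using feas cw[OF X(1)] by (auto simp: feasible_def)
  qed
  ultimately obtain q where q: "pairing_weight ?w ?V ?N q"
    using IH[rule_format, of ?V ?w ?N] finS by auto
  have "ecut ?w ?V {z} = 4"
    using cw[of "{z}"] pre[of "{z}"] S4 ecut_compl[OF sym S] z by simp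
  then have qz: "ecut q ?V {z} = 0"
  proof -
    have "ecut q ?V {z} \<le> 1 \<and> even (ecut q ?V {z} + ecut ?w ?V {z})"
      using q unfolding pairing_weight_def by blast
    then show ?thesis unfolding \<open>ecut ?w ?V {z} = 4\<close> by (cases "ecut q ?V {z}") auto
  qed
  then have qz0: "q z x = 0" if "x \<in> S" for x
    using that z finS by (auto simp: ecut_def btw_def)
  have sq: "symw q" using q by (simp add: pairing_weight_def)
  define q' where "q' x y = (if x \<in> S \<and> y \<in> S then q x y else 0)" for x y
  have sq': "symw q'" using sq by (auto simp: symw_def q'_def)
  have e: "ecut q' V X = ecut q ?V X" if "X \<subseteq> S" for X
  proof -
    have "ecut q' V X = btw q' (X \<inter> S) (S - X)"
      by (rule ecut_restrict[OF fin S]) (use that S in \<open>auto simp: q'_def\<close>)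
    also have "\<dots> = btw q X (S - X)"
      unfolding btw_def using that by (intro sum.cong) (auto simp: q'_def)
    also have "\<dots> = ecut q ?V X"
    proof -
      have "?V - X = {z} \<union> (S - X)" using that z by auto
      moreover have "btw q X {z} = 0"
        using qz0 that sq by (auto simp: btw_def symw_def intro!: sum.neutral)
      ultimately show ?thesis unfolding ecut_def
        using btw_Un_right[of "{z}" "S - X" q X] finS z by auto
    qed
    finally show ?thesis .
  qed
  have w1: "ecut ?w ?V X = ecut w V X" if "X \<subseteq> S" for X
    using cw[of X] pre[of X] that z by (auto simp: subset_insertI2)
  have "ecut q' V {v} \<le> 1 \<and> even (ecut q' V {v} + ecut w V {v})" if "v \<in> S" for v
    using q that e[of "{v}"] w1[of "{v}"] unfolding pairing_weight_def by auto
  moreover have "ecut q' V X + 4 \<le> ecut w V X" if "X \<subseteq> S" "X \<inter> N \<noteq> {}" for X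
  proof -
    have "separates ?N X" using that z by (auto simp: separates_def)
    then show ?thesis using q that e[of X] w1[of X] unfolding pairing_weight_def by auto
  qed
  ultimately show ?thesis using sq' by (intro exI[of _ q']) (auto simp: q'_def)
qed

text \<open>
  A cut \<open>S\<close> of weight exactly \<open>4\<close>: both sides are contracted to a terminal of even degree, so the two
  pairings do not use the contracted vertices and their union can be taken.
\<close>

lemma pairing_weight_contract:
  fixes V :: "'a set"
  assumes fin: "finite V" and sym: "symw w" and S: "S \<subseteq> V" and NV: "N \<subseteq> V"
    and sep: "separates N S" and S4: "ecut w V S = 4"
    and feas: "feasible w V N" and big: "2 \<le> card S" "2 \<le> card (V - S)"
    and IH: "\<forall>(V'::'a set) w' N'. card V' < card V \<and> finite V' \<and> symw w' \<and> N' \<subseteq> V' \<and>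
      feasible w' V' N' \<longrightarrow> (\<exists>q. pairing_weight w' V' N' q)"
  shows "\<exists>q. pairing_weight w V N q"
proof -
  let ?R = "V - S"
  obtain z where z: "z \<in> N - S" using sep by (auto simp: separates_def)
  obtain y where y: "y \<in> N - ?R" using sep by (auto simp: separates_def)
  have RR: "V - ?R = S" using S by auto
  obtain q1 where q1: "symw q1" "\<forall>x y. x \<notin> S \<or> y \<notin> S \<longrightarrow> q1 x y = 0"
    "\<forall>v\<in>S. ecut q1 V {v} \<le> 1 \<and> even (ecut q1 V {v} + ecut w V {v})"
    "\<forall>X\<subseteq>S. X \<inter> N \<noteq> {} \<longrightarrow> ecut q1 V X + 4 \<le> ecut w V X"
    using pairing_weight_contract_side[OF fin sym S NV z S4 feas big(2) IH] by (elim exE conjE)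
  have R4: "ecut w V ?R = 4" using S4 ecut_compl[OF sym S] by simp
  have big2: "2 \<le> card (V - ?R)" using big RR by simp
  obtain q2 where q2: "symw q2" "\<forall>x y. x \<notin> ?R \<or> y \<notin> ?R \<longrightarrow> q2 x y = 0"
    "\<forall>v\<in>?R. ecut q2 V {v} \<le> 1 \<and> even (ecut q2 V {v} + ecut w V {v})"
    "\<forall>X\<subseteq>?R. X \<inter> N \<noteq> {} \<longrightarrow> ecut q2 V X + 4 \<le> ecut w V X"
    using pairing_weight_contract_side[OF fin sym Diff_subset NV y R4 feas big2 IH] by (elim exE conjE)
  let ?q = "\<lambda>x y. q1 x y + q2 x y"
  have e1: "ecut q1 V X = btw q1 (X \<inter> S) (S - X)" if "X \<subseteq> V" for X
    using ecut_restrict[OF fin S that q1(2)] .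
  have e2: "ecut q2 V X = btw q2 (X \<inter> ?R) (?R - X)" if "X \<subseteq> V" for X
    using ecut_restrict[OF fin _ that q2(2)] by simp
  have e: "ecut ?q V X = ecut q1 V X + ecut q2 V X" for X by (rule ecut_plus)
  have c1: "ecut q1 V X = ecut q1 V (X \<inter> S)" "ecut q1 V X = ecut q1 V (S - X)" if "X \<subseteq> V" for X
  proof -
    have i: "X \<inter> S \<inter> S = X \<inter> S" "S - X \<inter> S = S - X" "(S - X) \<inter> S = S - X" "S - (S - X) = X \<inter> S"
      by auto
    show "ecut q1 V X = ecut q1 V (X \<inter> S)" "ecut q1 V X = ecut q1 V (S - X)"
      using e1[OF that] e1[of "X \<inter> S"] e1[of "S - X"] i S
        btw_sym[OF q1(1), of "S - X" "X \<inter> S"] by (simp_all add: le_infI2 subset_eq)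
  qed
  have c2: "ecut q2 V X = ecut q2 V (X - S)" "ecut q2 V X = ecut q2 V (V - (S \<union> X))" if "X \<subseteq> V" for X
  proof -
    have i: "(X - S) \<inter> ?R = X \<inter> ?R" "?R - (X - S) = ?R - X" "(V - (S \<union> X)) \<inter> ?R = ?R - X"
      "?R - (V - (S \<union> X)) = X \<inter> ?R"
      using that by auto
    show "ecut q2 V X = ecut q2 V (X - S)" "ecut q2 V X = ecut q2 V (V - (S \<union> X))"
      using e2[OF that] e2[of "X - S"] e2[of "V - (S \<union> X)"] i that
        btw_sym[OF q2(1), of "X \<inter> ?R" "?R - X"] by (simp_all add: subset_eq)
  qed
  have "ecut ?q V {v} \<le> 1 \<and> even (ecut ?q V {v} + ecut w V {v})" if "v \<in> V" for v
  proof (cases "v \<in> S")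
    case True
    then have "ecut q2 V {v} = 0" using e2[of "{v}"] that by simp
    then show ?thesis using q1(3)[rule_format, OF True] e by simp
  next
    case False
    then have "ecut q1 V {v} = 0" using e1[of "{v}"] that by simp
    then show ?thesis using q2(3)[rule_format, of v] False that e by simp
  qed
  moreover have "ecut ?q V X + 4 \<le> ecut w V X" if X: "X \<subseteq> V" "separates N X" for X
  proof -
    \<comment> \<open>Terminals lie in two opposite corners, one on each side of \<open>S\<close>.
      The bounds for the two corners gain 4 each; uncrossing \<open>X\<close> with \<open>S\<close>
      costs the weight 4 of \<open>S\<close>, which leaves the required 4.\<close>
    have "(S \<inter> X \<inter> N \<noteq> {} \<and> (V - (S \<union> X)) \<inter> N \<noteq> {}) \<or> ((S - X) \<inter> N \<noteq> {} \<and> (X - S) \<inter> N \<noteq> {})"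
      using X(2) sep NV unfolding separates_def by blast
    then show ?thesis
    proof (elim disjE conjE)
      assume a: "S \<inter> X \<inter> N \<noteq> {}" "(V - (S \<union> X)) \<inter> N \<noteq> {}"
      have "ecut q1 V (S \<inter> X) + 4 \<le> ecut w V (S \<inter> X)" using q1(4)[rule_format, of "S \<inter> X"] a by auto
      moreover have "ecut q2 V (V - (S \<union> X)) + 4 \<le> ecut w V (V - (S \<union> X))"
        using q2(4)[rule_format, of "V - (S \<union> X)"] a by auto
      moreover have "ecut w V (V - (S \<union> X)) = ecut w V (S \<union> X)"
        using ecut_compl[OF sym, of "S \<union> X" V] S X by auto
      ultimately show ?thesis
        using ecut_submodular[OF fin sym S X(1)] S4 e[of X] c1(1)[OF X(1)] c2(2)[OF X(1)]
        by (simp add: Int_commute)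
    next
      assume a: "(S - X) \<inter> N \<noteq> {}" "(X - S) \<inter> N \<noteq> {}"
      have "ecut q1 V (S - X) + 4 \<le> ecut w V (S - X)" using q1(4)[rule_format, of "S - X"] a by auto
      moreover have "ecut q2 V (X - S) + 4 \<le> ecut w V (X - S)" using q2(4)[rule_format, of "X - S"] a X by auto
      ultimately show ?thesis
        using ecut_posimodular[OF fin sym S X(1)] S4 e[of X] c1(2)[OF X(1)] c2(1)[OF X(1)] by simp
    qed
  qed
  ultimately show ?thesis using q1(1) q2(1) unfolding pairing_weight_def
    by (intro exI[of _ ?q]) auto
qed

text \<open>Turns the weights at a vertex into a list of neighbours with repetition, so that the
  weight towards \<open>X\<close> becomes the number of entries in \<open>X\<close>.\<close>

lemma sum_eq_length_filter:
  "finite A \<Longrightarrow> sum f A = n \<Longrightarrow>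
    \<exists>xs. length xs = n \<and> set xs \<subseteq> A \<and> (\<forall>X\<subseteq>A. sum f X = length (filter (\<lambda>x. x \<in> X) xs))"
proof (induct n arbitrary: f)
  case 0
  then show ?case by (intro exI[of _ "[]"]) (auto intro: sum.neutral)
next
  case (Suc n)
  then obtain a where a: "a \<in> A" "f a > 0" by (metis sum.neutral neq0_conv nat.distinct(1))
  let ?g = "f(a := f a - 1)"
  have g: "sum f X = sum ?g X + of_bool (a \<in> X)" if "X \<subseteq> A" for X
  proof -
    have "finite X" using that Suc.prems finite_subset by blast
    then show ?thesis using a by (cases "a \<in> X") (auto simp: sum.remove[of X a] intro!: sum.cong)
  qed
  have "sum ?g A = n" using g[of A] a Suc.prems by simp
  from Suc.hyps[OF Suc.prems(1) this] obtain xs where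
    xs: "length xs = n" "set xs \<subseteq> A" "\<forall>X\<subseteq>A. sum ?g X = length (filter (\<lambda>x. x \<in> X) xs)" by blast
  show ?case
    by (rule exI[of _ "a # xs"]) (use xs a g in auto)
qed

text \<open>The pairing of the split graph is extended by 0, as \<open>t\<close> has even degree. It
  controls the cuts that separate \<open>N - {t}\<close>, since splitting off increases no cut. It
  says nothing about a cut that separates only \<open>t\<close> from the other terminals, and there
  the independence of the non-terminals is used.\<close>

lemma pairing_weight_split:
  fixes V :: "'a set"
  assumes fin: "finite V" and sym: "symw w" and NV: "N \<subseteq> V"
    and feas: "feasible w V N" and t: "t \<in> N" and t4: "ecut w V {t} = 4" and N2: "N - {t} \<noteq> {}"
    and triv: "\<And>S. S \<subseteq> V \<Longrightarrow> separates N S \<Longrightarrow> ecut w V S = 4 \<Longrightarrow> card S = 1 \<or> card (V - S) = 1"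
    and indep: "\<And>u v. u \<in> V - N \<Longrightarrow> v \<in> V - N \<Longrightarrow> u \<noteq> v \<Longrightarrow> w u v = 0"
    and IH: "\<forall>(V'::'a set) w' N'. card V' < card V \<and> finite V' \<and> symw w' \<and> N' \<subseteq> V' \<and>
      feasible w' V' N' \<longrightarrow> (\<exists>q. pairing_weight w' V' N' q)"
  shows "\<exists>q. pairing_weight w V N q"
proof -
  define V' where "V' = V - {t}"
  define N' where "N' = N - {t}"
  have fin': "finite V'" and tV: "t \<in> V" and V: "V = insert t V'" and tV': "t \<notin> V'"
    using fin t NV by (auto simp: V'_def)
  have NV': "N' \<subseteq> V'" using NV by (auto simp: V'_def N'_def)
  have "sum (w t) V' = 4" using t4 by (simp add: ecut_def btw_def V'_def)
  from sum_eq_length_filter[OF fin' this] obtain xs where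
    xs: "length xs = 4" "set xs \<subseteq> V'" "\<forall>X\<subseteq>V'. sum (w t) X = length (filter (\<lambda>x. x \<in> X) xs)" by blast
  obtain a1 a2 a3 a4 where a: "xs = [a1, a2, a3, a4]"
    using xs(1) by (auto simp: eval_nat_numeral length_Suc_conv)
  define s where "s X = length (filter (\<lambda>x. x \<in> X) xs)" for X
  have cutV: "ecut w V X = ecut w V' X + s X" if "X \<subseteq> V'" for X
  proof -
    have "V - X = {t} \<union> (V' - X)" using that V tV' by auto
    moreover have "btw w X {t} = s X"
      using xs(3) that sym by (simp add: btw_def s_def symw_def)
    ultimately show ?thesis unfolding ecut_def
      using btw_Un_right[of "{t}" "V' - X" w X] fin' tV' by auto
  qed
  have cutt: "ecut w V (insert t X) = ecut w V' X + s (V' - X)" if "X \<subseteq> V'" for X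
  proof -
    have "V - insert t X = V' - X" using V tV' by auto
    moreover have "insert t X \<subseteq> V" using that V by auto
    ultimately show ?thesis
      using ecut_compl[OF sym, of "insert t X" V] cutV[of "V' - X"] ecut_compl[OF sym that] by auto
  qed
  interpret sp: splitting w V' N' s
  proof
    fix X assume X: "X \<subseteq> V'" "X \<inter> N' \<noteq> {}"
    then have "separates N X" using t tV' by (auto simp: separates_def N'_def)
    then show "4 \<le> ecut w V' X + s X" using feas X cutV[OF X(1)] V unfolding feasible_def by auto
  next
    fix X assume X: "X \<subset> V'" "X \<inter> N' \<noteq> {}" "ecut w V' X + s X = 4"
    have "separates N X" using t tV' X by (auto simp: separates_def N'_def)
    moreover have "X \<subseteq> V" using X V by auto
    moreover have "ecut w V X = 4" using cutV X by auto
    moreover have "card (V - X) \<noteq> 1"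
    proof
      assume "card (V - X) = 1"
      then obtain y where y: "V - X = {y}" by (auto simp: card_1_singleton_iff)
      obtain x where "x \<in> V'" "x \<notin> X" using X by blast
      moreover have "t \<in> V - X" using X V tV' by blast
      ultimately show False using y V tV' by (metis Diff_iff insertCI singletonD)
    qed
    ultimately have "card X = 1" using triv by blast
    then show "\<exists>x. X = {x}" by (auto simp: card_1_singleton_iff)
  qed (use fin' sym NV' in auto)
  have lab: "sp.labelling a1 a2 a3 a4" using xs a by (auto simp: sp.labelling_def s_def)
  have "\<exists>b1 b2 b3 b4. sp.labelling b1 b2 b3 b4 \<and> (\<forall>X. \<not> bad_split w V' N' b1 b2 b3 b4 X)"
  proof -
    have "sp.labelling a1 a3 a2 a4" "sp.labelling a1 a4 a2 a3"
      using lab by (auto simp: sp.labelling_def)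
    then show ?thesis using lab sp.not_all_bad[OF lab] by meson
  qed
  then obtain b1 b2 b3 b4 where lb: "sp.labelling b1 b2 b3 b4"
    and nb: "\<And>X. \<not> bad_split w V' N' b1 b2 b3 b4 X" by blast
  have b: "b1 \<in> V'" "b2 \<in> V'" "b3 \<in> V'" "b4 \<in> V'" using lb by (auto simp: sp.labelling_def)
  have sb: "s X = of_bool (b1 \<in> X) + of_bool (b2 \<in> X) + of_bool (b3 \<in> X) + of_bool (b4 \<in> X)" for X
    using lb by (auto simp: sp.labelling_def)
  define w' where "w' x y = w x y + edgew b1 b2 x y + edgew b3 b4 x y" for x y
  have sw': "symw w'" using sym unfolding w'_def by (intro symw_plus symw_edgew)
  have cw': "ecut w' V' X = ecut w V' X + of_bool ((b1 \<in> X) \<noteq> (b2 \<in> X)) + of_bool ((b3 \<in> X) \<noteq> (b4 \<in> X))"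
    if "X \<subseteq> V'" for X
    unfolding w'_def ecut_plus using that b fin' by (simp add: ecut_edgew)
  have sc: "s (V' - X) = of_bool (b1 \<notin> X) + of_bool (b2 \<notin> X) + of_bool (b3 \<notin> X) + of_bool (b4 \<notin> X)" for X
    unfolding sb using b by simp
  have feas': "feasible w' V' N'"
    unfolding feasible_def
  proof (intro allI impI)
    fix X assume X: "X \<subseteq> V'" "separates N' X"
    have "(V' - X) \<inter> N' \<noteq> {}" using X(2) NV' by (auto simp: separates_def)
    then have 1: "4 \<le> ecut w V' X + s (V' - X)" using sp.ge4[of "V' - X"] ecut_compl[OF sym X(1)] by auto
    have 2: "4 \<le> ecut w V' X + s X" using sp.ge4[of X] X by (auto simp: separates_def)
    have sX: "separates N' (V' - X)" using X separates_compl NV' by blast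
    have 3: "4 \<le> ecut w V' X" if "b1 \<in> X" "b2 \<in> X" "b3 \<notin> X" "b4 \<notin> X"
      using nb[of X] X that unfolding bad_split_def by auto
    have 4: "4 \<le> ecut w V' X" if "b1 \<notin> X" "b2 \<notin> X" "b3 \<in> X" "b4 \<in> X"
      using nb[of "V' - X"] sX ecut_compl[OF sym X(1)] that b unfolding bad_split_def by auto
    show "4 \<le> ecut w' V' X"
      unfolding cw'[OF X(1)] using 1 2 3 4 unfolding sb[of X] sc[of X]
      by (cases "b1 \<in> X"; cases "b2 \<in> X"; cases "b3 \<in> X"; cases "b4 \<in> X") simp_all
  qed
  have "card V' < card V" unfolding V'_def using fin tV by (rule card_Diff1_less)
  then obtain q' where q': "pairing_weight w' V' N' q'" using IH fin' sw' NV' feas' by blast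
  have sq': "symw q'" using q' by (simp add: pairing_weight_def)
  define q where "q x y = (if x \<in> V' \<and> y \<in> V' then q' x y else 0)" for x y
  have sq: "symw q" using sq' by (auto simp: symw_def q_def)
  have eq: "ecut q V X = ecut q' V' (X - {t})" if "X \<subseteq> V" for X
  proof -
    have "ecut q V X = btw q (X \<inter> V') (V' - X)"
      by (rule ecut_restrict) (use fin V that in \<open>auto simp: q_def\<close>)
    also have "\<dots> = btw q' (X \<inter> V') (V' - X)"
      by (rule btw_cong) (auto simp: q_def)
    also have "X \<inter> V' = X - {t}" using that V tV' by auto
    also have "V' - X = V' - (X - {t})" using tV' by auto
    finally show ?thesis by (simp add: ecut_def)
  qed
  have deg: "ecut q V {v} \<le> 1 \<and> even (ecut q V {v} + ecut w V {v})" if "v \<in> V" for v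
  proof (cases "v = t")
    case True
    then show ?thesis using eq[of "{t}"] t4 tV by (simp add: ecut_def)
  next
    case False
    then have v: "v \<in> V'" "{v} \<subseteq> V'" using that V by auto
    have "ecut q V {v} = ecut q' V' {v}" using eq[of "{v}"] that False by simp
    moreover have "ecut q' V' {v} \<le> 1 \<and> even (ecut q' V' {v} + ecut w' V' {v})"
      using q' v by (simp add: pairing_weight_def)
    moreover have "even (ecut w' V' {v} + ecut w V {v})"
      unfolding cw'[OF v(2)] cutV[OF v(2)] sb by (auto simp: of_bool_def)
    ultimately show ?thesis by presburger
  qed
  \<comment> \<open>Non-terminals are independent, so adding one, \<open>x\<close>, to a set of
    \<open>t\<close> and non-terminals changes the cut by the degree of \<open>x\<close> minus twice
    \<open>w t x\<close>. This is not negative, because \<open>{t, x}\<close> separates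
    \<open>N\<close> whereas \<open>{t}\<close> has weight exactly 4, and by parity it pays for the
    pair at \<open>x\<close>.\<close>
  have away: "ecut q V S + 4 \<le> ecut w V (insert t S)" if S: "S \<subseteq> V'" "S \<inter> N = {}" for S
  proof -
    have arith: "a + 2 * m \<le> b" if "a \<le> 1 \<and> even (a + b)" "4 \<le> c" "c + 2 * m = 4 + b" for a b c m :: nat
      using that by presburger
    have "finite S" using S fin' finite_subset by blast
    then have "4 + (\<Sum>x\<in>S. ecut q V {x}) \<le> ecut w V (insert t S)" using S
    proof (induct S)
      case empty
      then show ?case using t4 by simp
    next
      case (insert x F)
      have x: "x \<in> V" "x \<noteq> t" "x \<notin> N" using insert V tV' by auto
      have F: "insert t F \<subseteq> V" "x \<notin> insert t F" using insert V x by auto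
      have "btw w F {x} = 0"
        unfolding btw_def using insert V by (auto intro!: sum.neutral indep)
      then have 0: "btw w (insert t F) {x} = w t x"
        using insert tV' by (subst insert_is_Un, subst btw_Un_left) (auto simp: btw_def)
      have "ecut w V (insert t F \<union> {x}) + 2 * btw w (insert t F) {x} = ecut w V (insert t F) + ecut w V {x}"
        using ecut_disjoint_Un[OF fin sym F(1), of "{x}"] x F by simp
      then have 1: "ecut w V (insert t (insert x F)) + 2 * w t x = ecut w V (insert t F) + ecut w V {x}"
        using 0 by (simp add: insert_commute)
      have "ecut w V ({t} \<union> {x}) + 2 * btw w {t} {x} = ecut w V {t} + ecut w V {x}"
        using ecut_disjoint_Un[OF fin sym, of "{t}" "{x}"] x tV by simp
      then have 2: "ecut w V {t, x} + 2 * w t x = 4 + ecut w V {x}"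
        using t4 by (simp add: btw_def insert_commute)
      have "separates N {t, x}" using t N2 x by (auto simp: separates_def)
      then have "4 \<le> ecut w V {t, x}" using feas x tV by (auto simp: feasible_def)
      then have "ecut q V {x} + 2 * w t x \<le> ecut w V {x}" using 2 deg[OF x(1)] arith by blast
      then show ?case using 1 insert by simp
    qed
    then show ?thesis using ecut_le_sum[OF fin sq, of S] S V by (simp add: subset_insertI2)
  qed
  have "ecut q V X + 4 \<le> ecut w V X" if X: "X \<subseteq> V" "separates N X" for X
  proof -
    let ?Y = "X - {t}"
    have Y: "?Y \<subseteq> V'" using X V by auto
    consider "separates N' ?Y" | "?Y \<inter> N = {}" | "N' \<subseteq> ?Y"
      by (auto simp: separates_def N'_def)
    then show ?thesis
    proof cases
      case 1
      have "ecut q' V' ?Y + 4 \<le> ecut w' V' ?Y" using q' 1 Y by (simp add: pairing_weight_def)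
      moreover have "ecut w' V' ?Y \<le> ecut w V X"
      proof (cases "t \<in> X")
        case True
        then have "X = insert t ?Y" by auto
        then show ?thesis using cutt[OF Y] unfolding cw'[OF Y] sc by (auto simp: of_bool_def)
      next
        case False
        then have "X = ?Y" by auto
        then show ?thesis using cutV[OF Y] unfolding cw'[OF Y] sb by (auto simp: of_bool_def)
      qed
      ultimately show ?thesis using eq[OF X(1)] by simp
    next
      case 2
      then have "t \<in> X" using X by (auto simp: separates_def)
      then have i: "insert t ?Y = X" by auto
      have "ecut q V X = ecut q V ?Y" using eq[OF X(1)] eq[of ?Y] X by (simp add: subset_iff)
      then show ?thesis using away[OF Y 2] i by simp
    next
      case 3
      let ?Z = "V' - ?Y"
      have tX: "t \<notin> X" using 3 X by (auto simp: separates_def N'_def)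
      then have i: "insert t ?Z = V - X" using V tV' by auto
      have "ecut q V X = ecut q V ?Z"
        using eq[OF X(1)] eq[of ?Z] ecut_compl[OF sq' Y] V tV' by (simp add: subset_iff)
      moreover have "?Z \<inter> N = {}" using 3 tV' by (auto simp: N'_def)
      ultimately show ?thesis using away[of ?Z] i ecut_compl[OF sym X(1)] by auto
    qed
  qed
  then show ?thesis using sq deg unfolding pairing_weight_def by blast
qed

text \<open>The inner induction is on the total weight. If no edge can be deleted, every edge lies
  in a cut of weight 4 that separates \<open>N\<close>; if no such cut has two vertices on both
  sides, it is the star of a terminal. Hence every edge has an end that is a terminal of degree 4,
  the non-terminals are independent, and splitting off applies.\<close>

lemma pairing_weight_exists:
  fixes V :: "'a set"
  assumes "finite V" "symw w" "N \<subseteq> V" "feasible w V N"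
  shows "\<exists>q. pairing_weight w V N q"
  using assms
proof (induct "card V" arbitrary: V w N rule: less_induct)
  case (less V w N)
  have IH: "\<forall>(V'::'a set) w' N'. card V' < card V \<and> finite V' \<and> symw w' \<and> N' \<subseteq> V' \<and>
      feasible w' V' N' \<longrightarrow> (\<exists>q. pairing_weight w' V' N' q)"
    using less.hyps by blast
  note fin = less.prems(1) and NV = less.prems(3)
  from less.prems(2,4) show ?case
  proof (induct "\<Sum>v\<in>V. ecut w V {v}" arbitrary: w rule: less_induct)
    case (less w)
    note sym = less.prems(1) and feas = less.prems(2)
    consider (base) "\<forall>X\<subseteq>V. \<not> separates N X"
      | (delete) u v where "u \<in> V" "v \<in> V" "u \<noteq> v" "w u v > 0"
          "feasible (\<lambda>x y. w x y - edgew u v x y) V N"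
      | (contract) S where "S \<subseteq> V" "separates N S" "ecut w V S = 4" "2 \<le> card S" "2 \<le> card (V - S)"
      | (split) X0 where "X0 \<subseteq> V" "separates N X0"
          "\<And>u v. u \<in> V \<Longrightarrow> v \<in> V \<Longrightarrow> u \<noteq> v \<Longrightarrow> w u v > 0 \<Longrightarrow>
            \<not> feasible (\<lambda>x y. w x y - edgew u v x y) V N"
          "\<And>S. S \<subseteq> V \<Longrightarrow> separates N S \<Longrightarrow> ecut w V S = 4 \<Longrightarrow> \<not> 2 \<le> card S \<or> \<not> 2 \<le> card (V - S)"
      by metis
    then show ?case
    proof cases
      case base
      then show ?thesis using normalize_weights[OF fin sym] unfolding pairing_weight_def by blast
    next
      case delete
      let ?w = "\<lambda>x y. w x y - edgew u v x y"
      have w: "ecut w V X = ecut ?w V X + ecut (edgew u v) V X" for X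
        unfolding ecut_plus[symmetric] using edgew_le[OF sym delete(4)] by (simp add: ecut_def btw_def)
      have "ecut ?w V {x} \<le> ecut w V {x}" for x unfolding w by simp
      moreover have "ecut ?w V {u} < ecut w V {u}"
        unfolding w using delete fin by (simp add: ecut_edgew)
      ultimately have "(\<Sum>v\<in>V. ecut ?w V {v}) < (\<Sum>v\<in>V. ecut w V {v})"
        using delete fin by (intro sum_strict_mono_ex1) auto
      moreover have "symw ?w" using sym symw_edgew[of u v] by (simp add: symw_def)
      ultimately obtain q where "pairing_weight ?w V N q" using less.hyps delete(5) by blast
      then show ?thesis using pairing_weight_delete[OF fin sym delete(1,2,4)] by blast
    next
      case contract
      then show ?thesis using pairing_weight_contract[OF fin sym _ NV _ _ feas _ _ IH] by blast
    next
      case split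
      have triv: "card S = 1 \<or> card (V - S) = 1" if S: "S \<subseteq> V" "separates N S" "ecut w V S = 4" for S
      proof -
        have "card S \<noteq> 0" "card (V - S) \<noteq> 0"
          using S fin NV by (auto simp: separates_def dest: finite_subset)
        then show ?thesis using split(4)[OF S] by linarith
      qed
      have edge: "\<exists>t\<in>N. (t = u \<or> t = v) \<and> ecut w V {t} = 4"
        if uv: "u \<in> V" "v \<in> V" "u \<noteq> v" "w u v > 0" for u v
      proof -
        let ?w = "\<lambda>x y. w x y - edgew u v x y"
        have w: "ecut w V X = ecut ?w V X + ecut (edgew u v) V X" for X
          unfolding ecut_plus[symmetric] using edgew_le[OF sym uv(4)] by (simp add: ecut_def btw_def)
        obtain X where X: "X \<subseteq> V" "separates N X" "ecut ?w V X < 4"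
          using split(3)[OF uv] unfolding feasible_def by auto
        have "4 \<le> ecut w V X" using feas X by (auto simp: feasible_def)
        then have X4: "ecut w V X = 4" "(u \<in> X) \<noteq> (v \<in> X)"
          using w[of X] X uv fin by (auto simp: ecut_edgew of_bool_def split: if_splits)
        from triv[OF X(1,2) X4(1)] show ?thesis
        proof
          assume "card X = 1"
          then obtain t where "X = {t}" by (auto simp: card_1_singleton_iff)
          then show ?thesis using X X4 by (auto simp: separates_def)
        next
          assume "card (V - X) = 1"
          then obtain t where t: "V - X = {t}" by (auto simp: card_1_singleton_iff)
          have "t \<in> N" using t X NV by (auto simp: separates_def)
          moreover have "t = u \<or> t = v" using t X4(2) uv(1,2) by (metis DiffI singletonD)
          moreover have "ecut w V {t} = 4" using ecut_compl[OF sym X(1)] t X4 by simp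
          ultimately show ?thesis by blast
        qed
      qed
      have "\<exists>u\<in>X0. \<exists>v\<in>V - X0. w u v > 0"
      proof (rule ccontr)
        assume "\<not> ?thesis"
        then have "ecut w V X0 = 0" by (auto simp: ecut_def btw_def)
        then show False using feas split by (auto simp: feasible_def)
      qed
      then obtain t where t: "t \<in> N" "ecut w V {t} = 4" using edge split(1) by blast
      have "N - {t} \<noteq> {}" using split(2) by (auto simp: separates_def)
      moreover have "w u v = 0" if "u \<in> V - N" "v \<in> V - N" "u \<noteq> v" for u v
        using edge[of u v] that by auto
      ultimately show ?thesis
        using pairing_weight_split[OF fin sym NV feas t _ triv _ IH] by blast
    qed
  qed
qed

theorem pairing_exists:
  assumes fin: "finite V" and sym: "symw w" and "N \<subseteq> V"
    and "\<And>X. X \<subseteq> V \<Longrightarrow> separates N X \<Longrightarrow> 4 \<le> ecut w V X"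
  shows "\<exists>p. (\<forall>v\<in>V. odd (ecut w V {v}) \<longrightarrow> p v \<in> V \<and> odd (ecut w V {p v}) \<and> p v \<noteq> v \<and> p (p v) = v) \<and>
    (\<forall>X\<subseteq>V. separates N X \<longrightarrow> card {v \<in> X. odd (ecut w V {v}) \<and> p v \<notin> X} + 4 \<le> ecut w V X)"
proof -
  obtain q where q: "pairing_weight w V N q"
    using pairing_weight_exists[of V w N] assms unfolding feasible_def by blast
  have sq: "q x y = q y x" for x y using q by (auto simp: pairing_weight_def symw_def)
  have par: "ecut q V {v} \<le> 1 \<and> even (ecut q V {v} + ecut w V {v})" if "v \<in> V" for v
    using q that by (simp add: pairing_weight_def)
  have dq: "ecut q V {v} = sum (q v) (V - {v})" for v by (simp add: ecut_def btw_def)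
  have one: "ecut q V {v} = 1 \<longleftrightarrow> odd (ecut w V {v})" if "v \<in> V" for v
    using par[OF that] by (cases "ecut q V {v}") auto
  have ex: "\<exists>u\<in>V - {v}. q v u = 1 \<and> (\<forall>y\<in>V - {v}. y \<noteq> u \<longrightarrow> q v y = 0)"
    if "v \<in> V" "ecut q V {v} = 1" for v
    using that fin sum_eq_1_iff[of "V - {v}" "q v"] unfolding dq by (metis finite_Diff)
  define p where "p v = (SOME u. u \<in> V - {v} \<and> q v u = 1)" for v
  have p: "p v \<in> V" "p v \<noteq> v" "q v (p v) = 1" if "v \<in> V" "ecut q V {v} = 1" for v
  proof -
    have "p v \<in> V - {v} \<and> q v (p v) = 1"
      unfolding p_def using ex[OF that] by (intro someI_ex[of "\<lambda>u. u \<in> V - {v} \<and> q v u = 1"]) blast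
    then show "p v \<in> V" "p v \<noteq> v" "q v (p v) = 1" by auto
  qed
  have p1: "ecut q V {p v} = 1" if v: "v \<in> V" "ecut q V {v} = 1" for v
  proof -
    have "q (p v) v \<le> ecut q V {p v}"
      unfolding dq using p[OF v] v fin by (intro member_le_sum) auto
    then show ?thesis using p[OF v] sq[of v "p v"] par[of "p v"] by simp
  qed
  have pp: "p (p v) = v" if v: "v \<in> V" "ecut q V {v} = 1" for v
  proof -
    note u = p(1)[OF v] p1[OF v]
    have "q (p v) v = 1" using p(3)[OF v] sq by simp
    moreover have "q (p v) (p (p v)) = 1" using p(3)[OF u] .
    ultimately show ?thesis using ex[OF u] p(1,2)[OF u] v p(2)[OF v]
      by (metis DiffI singletonD zero_neq_one)
  qed
  have "card {v \<in> X. odd (ecut w V {v}) \<and> p v \<notin> X} \<le> ecut q V X" if X: "X \<subseteq> V" for X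
  proof -
    have fX: "finite X" using X fin finite_subset by blast
    let ?K = "{v \<in> X. odd (ecut w V {v}) \<and> p v \<notin> X}"
    have "card ?K = (\<Sum>v\<in>?K. 1)" by simp
    also have "\<dots> \<le> (\<Sum>v\<in>?K. sum (q v) (V - X))"
    proof (rule sum_mono)
      fix v assume v: "v \<in> ?K"
      then have v': "v \<in> V" "ecut q V {v} = 1" using X one by auto
      have "q v (p v) \<le> sum (q v) (V - X)"
        using v p[OF v'] fin by (intro member_le_sum) auto
      then show "1 \<le> sum (q v) (V - X)" using p[OF v'] by simp
    qed
    also have "\<dots> \<le> ecut q V X"
      unfolding ecut_def btw_def using fX by (intro sum_mono2) auto
    finally show ?thesis .
  qed
  then have "\<forall>X\<subseteq>V. separates N X \<longrightarrow> card {v \<in> X. odd (ecut w V {v}) \<and> p v \<notin> X} + 4 \<le> ecut w V X"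
    using q unfolding pairing_weight_def by (meson add_le_mono1 order_trans)
  moreover have "\<forall>v\<in>V. odd (ecut w V {v}) \<longrightarrow>
      p v \<in> V \<and> odd (ecut w V {p v}) \<and> p v \<noteq> v \<and> p (p v) = v"
    using one p p1 pp by metis
  ultimately show ?thesis by blast
qed

section \<open>Signs reversed by two involutions\<close>

definition involution_on :: "'a set \<Rightarrow> ('a \<Rightarrow> 'a) \<Rightarrow> bool" where
  "involution_on D a \<longleftrightarrow> (\<forall>x\<in>D. a x \<in> D \<and> a x \<noteq> x \<and> a (a x) = x)"

text \<open>The induction removes \<open>x\<close> and \<open>y = a x\<close>. If \<open>b\<close>
  does not pair these two, their partners \<open>u\<close> and \<open>v\<close> are paired instead:
  the path \<open>u\<close>, \<open>x\<close>, \<open>y\<close>, \<open>v\<close> has three steps,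
  so opposite signs at its ends extend to its inner points.\<close>

lemma two_involutions:
  fixes D :: "'a set"
  assumes "finite D" "involution_on D a" "involution_on D b"
  shows "\<exists>s::'a \<Rightarrow> bool. \<forall>x\<in>D. s (a x) \<noteq> s x \<and> s (b x) \<noteq> s x"
  using assms
proof (induct "card D" arbitrary: D b rule: less_induct)
  case less
  show ?case
  proof (cases "D = {}")
    case True
    then show ?thesis by simp
  next
    case False
    then obtain x where x: "x \<in> D" by auto
    define y where "y = a x"
    have A: "a z \<in> D" "a z \<noteq> z" "a (a z) = z" if "z \<in> D" for z
      using less.prems(2) that by (auto simp: involution_on_def)
    have B: "b z \<in> D" "b z \<noteq> z" "b (b z) = z" if "z \<in> D" for z
      using less.prems(3) that by (auto simp: involution_on_def)
    have y: "y \<in> D" "y \<noteq> x" "a y = x" "a x = y" using A[OF x] by (auto simp: y_def)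
    let ?D = "D - {x, y}"
    have fin: "finite ?D" using less.prems by simp
    have c: "card ?D < card D" using less.prems x y by (intro psubset_card_mono) auto
    have a': "involution_on ?D a"
      unfolding involution_on_def using A y by (metis Diff_iff insert_iff empty_iff)
    show ?thesis
    proof (cases "b x = y")
      case True
      then have "involution_on ?D b"
        unfolding involution_on_def using B x y by (metis Diff_iff insert_iff empty_iff)
      from less.hyps[OF c fin a' this] obtain s :: "'a \<Rightarrow> bool" where
        s: "\<forall>z\<in>?D. s (a z) \<noteq> s z \<and> s (b z) \<noteq> s z" by blast
      have by': "b y = x" using True B x by blast
      let ?s = "s(x := True, y := False)"
      have "?s (a z) \<noteq> ?s z \<and> ?s (b z) \<noteq> ?s z" if z: "z \<in> D" for z
      proof (cases "z \<in> {x, y}")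
        case True
        then show ?thesis using y by' \<open>b x = y\<close> by auto
      next
        case zD: False
        then have "z \<in> ?D" "a z \<notin> {x, y}" "b z \<notin> {x, y}"
          using z A[OF z] B[OF z] y by' True by auto
        then show ?thesis using s zD by auto
      qed
      then show ?thesis by blast
    next
      case False
      define u v where "u = b x" and "v = b y"
      have by': "b y \<noteq> x" using False B y by metis
      have uv: "u \<in> D" "v \<in> D" "u \<noteq> v" "u \<notin> {x, y}" "v \<notin> {x, y}" "b u = x" "b v = y"
        using B[OF x] B[OF y(1)] False by' y by (auto simp: u_def v_def)
      let ?b = "b(u := v, v := u)"
      have b': "involution_on ?D ?b"
        unfolding involution_on_def
      proof
        fix z assume z: "z \<in> ?D"
        show "?b z \<in> ?D \<and> ?b z \<noteq> z \<and> ?b (?b z) = z"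
        proof (cases "z \<in> {u, v}")
          case True
          then show ?thesis using uv by auto
        next
          case zu: False
          have "b z \<in> D" "b z \<noteq> z" "b (b z) = z" using B z by auto
          moreover have "b z \<noteq> x" "b z \<noteq> y" using zu \<open>b (b z) = z\<close> by (auto simp: u_def v_def)
          moreover have "b z \<noteq> u" "b z \<noteq> v" using z \<open>b (b z) = z\<close> uv by auto
          ultimately show ?thesis using zu by auto
        qed
      qed
      from less.hyps[OF c fin a' b'] obtain s :: "'a \<Rightarrow> bool" where
        s: "\<forall>z\<in>?D. s (a z) \<noteq> s z \<and> s (?b z) \<noteq> s z" by blast
      have suv: "s v \<noteq> s u" using s uv by (metis Diff_iff fun_upd_apply)
      let ?s = "s(x := \<not> s u, y := \<not> s v)"
      have "?s (a z) \<noteq> ?s z \<and> ?s (b z) \<noteq> ?s z" if z: "z \<in> D" for z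
      proof -
        consider "z = x" | "z = y" | "z = u" | "z = v" | "z \<in> ?D" "z \<noteq> u" "z \<noteq> v" using z by auto
        then show ?thesis
        proof cases
          case 1
          then show ?thesis using y uv suv by (auto simp: u_def)
        next
          case 2
          then show ?thesis using y uv suv by (auto simp: v_def)
        next
          case 3
          have "a u \<notin> {x, y}" using uv A y by (metis insert_iff empty_iff)
          moreover have "s (a u) \<noteq> s u" using s uv by auto
          ultimately show ?thesis using 3 uv y by auto
        next
          case 4
          have "a v \<notin> {x, y}" using uv A y by (metis insert_iff empty_iff)
          moreover have "s (a v) \<noteq> s v" using s uv by auto
          ultimately show ?thesis using 4 uv y by auto
        next
          case 5
          have "a z \<notin> {x, y}" using 5 A y by (metis DiffE insertCI insertE emptyE)
          moreover have "b z \<notin> {x, y}" using 5 B[OF z] by (auto simp: u_def v_def)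
          moreover have "s (a z) \<noteq> s z \<and> s (?b z) \<noteq> s z" using s 5(1) by blast
          ultimately show ?thesis using 5 by simp
        qed
      qed
      then show ?thesis by blast
    qed
  qed
qed

section \<open>Counting with involutions that reverse a sign\<close>

lemma involution_card_eq:
  assumes "finite Y" "\<And>x. x \<in> Y \<Longrightarrow> a x \<in> Y \<and> a (a x) = x \<and> s (a x) \<noteq> s x"
  shows "card {x \<in> Y. s x} = card {x \<in> Y. \<not> s x}"
proof (rule bij_betw_same_card)
  show "bij_betw a {x \<in> Y. s x} {x \<in> Y. \<not> s x}"
    by (rule bij_betwI[where g = a]) (use assms in auto)
qed

text \<open>Pairs of \<open>a\<close> inside \<open>Y\<close> cancel, so the surplus of positive
  over negative elements of \<open>Y\<close> is the surplus among those that \<open>a\<close> takes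
  out of \<open>Y\<close>. The same surplus is computed with \<open>b\<close>; the equation is
  arranged to avoid subtraction.\<close>

lemma signed_balance:
  assumes D: "finite D" "involution_on D a" "involution_on D b"
    and s: "\<And>x. x \<in> D \<Longrightarrow> s (a x) \<noteq> s x \<and> s (b x) \<noteq> s x"
    and Y: "Y \<subseteq> D"
  shows "card {x \<in> Y. a x \<notin> Y \<and> s x} + card {x \<in> Y. b x \<notin> Y \<and> \<not> s x} =
    card {x \<in> Y. a x \<notin> Y \<and> \<not> s x} + card {x \<in> Y. b x \<notin> Y \<and> s x}"
proof -
  have fY: "finite Y" using finite_subset[OF Y D(1)] .
  have inner: "card {x \<in> {x \<in> Y. f x \<in> Y}. s x} = card {x \<in> {x \<in> Y. f x \<in> Y}. \<not> s x}"
    if "f = a \<or> f = b" for f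
    by (rule involution_card_eq[where a = f])
       (use that D(2,3) s fY Y in \<open>auto simp: involution_on_def subset_iff\<close>)
  have split: "card {x \<in> Y. P x} = card {x \<in> {x \<in> Y. f x \<in> Y}. P x} + card {x \<in> Y. f x \<notin> Y \<and> P x}"
    for P f
    by (subst card_Un_disjoint[symmetric]) (auto simp: fY intro: arg_cong[where f = card])
  show ?thesis
    using inner[OF disjI1[OF refl]] inner[OF disjI2[OF refl]] split[of s a] split[of "\<lambda>x. \<not> s x" a]
      split[of s b] split[of "\<lambda>x. \<not> s x" b] by linarith
qed

lemma card_remove2:
  assumes "finite D" "x \<in> D" "y \<in> D" "x \<noteq> y"
  shows "card D = card (D - {x, y}) + 2"
proof -
  have "card {x, y} \<le> card D" using assms by (intro card_mono) auto
  then show ?thesis using assms by (simp add: card_Diff_subset)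
qed

lemma even_card_involution:
  assumes "finite D" "even (card D)"
  shows "\<exists>b. involution_on D b"
  using assms
proof (induct "card D" arbitrary: D rule: less_induct)
  case less
  show ?case
  proof (cases "D = {}")
    case True
    then show ?thesis by (intro exI[of _ id]) (simp add: involution_on_def)
  next
    case False
    then obtain x where x: "x \<in> D" by auto
    have "D \<noteq> {x}" using less.prems by auto
    then obtain y where y: "y \<in> D" "y \<noteq> x" using x by blast
    let ?D = "D - {x, y}"
    have c: "card D = card ?D + 2" using x y less.prems
      by (intro card_remove2) auto
    then obtain b where b: "involution_on ?D b" using less.hyps[of ?D] less.prems by auto
    have "involution_on D (b(x := y, y := x))"
      using b x y by (auto simp: involution_on_def)
    then show ?thesis by blast
  qed
qed

lemma even_card_involution_pair:
  assumes "finite D" "even (card D)" "x \<in> D" "y \<in> D" "x \<noteq> y"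
  shows "\<exists>b. involution_on D b \<and> b x = y"
proof -
  have "even (card (D - {x, y}))" using card_remove2[OF assms(1,3-5)] assms(2) by simp
  then obtain b where b: "involution_on (D - {x, y}) b"
    using even_card_involution assms by (meson finite_Diff)
  have "involution_on D (b(x := y, y := x))"
    using b assms by (auto simp: involution_on_def)
  then show ?thesis using assms(5) by (intro exI[of _ "b(x := y, y := x)"]) simp
qed

lemma fibrewise_involution:
  assumes "\<And>v. v \<in> vt ` D \<Longrightarrow> involution_on {d \<in> D. vt d = v} (B v)"
  shows "involution_on D (\<lambda>d. B (vt d) d)"
    and "\<And>d. d \<in> D \<Longrightarrow> vt (B (vt d) d) = vt d"
  using assms unfolding involution_on_def by force+

section \<open>Cycles of a map as minimal closed sets\<close>

lemma minimal_closed: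
  assumes "finite X" "X \<noteq> {}" "g ` X \<subseteq> X"
  shows "\<exists>Z\<subseteq>X. Z \<noteq> {} \<and> g ` Z \<subseteq> Z \<and> (\<forall>W\<subseteq>Z. W \<noteq> {} \<longrightarrow> g ` W \<subseteq> W \<longrightarrow> W = Z)"
proof -
  let ?P = "\<lambda>Z. Z \<subseteq> X \<and> Z \<noteq> {} \<and> g ` Z \<subseteq> Z"
  obtain Z where Z: "?P Z" "\<And>W. ?P W \<Longrightarrow> card Z \<le> card W"
    using ex_has_least_nat[of ?P X card] assms by blast
  have "W = Z" if "W \<subseteq> Z" "W \<noteq> {}" "g ` W \<subseteq> W" for W
  proof -
    have "finite Z" using Z assms finite_subset by blast
    moreover have "card Z \<le> card W" using Z(1) that by (intro Z(2)) auto
    ultimately show ?thesis using that(1) card_seteq by blast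
  qed
  then show ?thesis using Z(1) by blast
qed

text \<open>\<open>Z\<close> is a cycle of \<open>g\<close>. If a step enters \<open>Y\<close> and
  none leaves it, then \<open>Z \<inter> Y\<close> is closed, against minimality; the complement of
  \<open>Y\<close> gives the other direction.\<close>

lemma minimal_closed_crossing:
  assumes "g ` Z \<subseteq> Z" "\<forall>W\<subseteq>Z. W \<noteq> {} \<longrightarrow> g ` W \<subseteq> W \<longrightarrow> W = Z"
    and v: "v \<in> Z" "(v \<in> Y) \<noteq> (g v \<in> Y)"
  shows "\<exists>u\<in>Z. u \<in> Y \<and> g u \<notin> Y" "\<exists>u\<in>Z. u \<notin> Y \<and> g u \<in> Y"
proof -
  have *: "\<exists>u\<in>Z. u \<in> Y \<and> g u \<notin> Y" if v: "v \<in> Z" "v \<notin> Y" "g v \<in> Y" for Y v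
  proof (rule ccontr)
    assume "\<not> ?thesis"
    then have "g ` (Z \<inter> Y) \<subseteq> Z \<inter> Y" "Z \<inter> Y \<noteq> {}" using assms(1) v by auto
    then have "Z \<inter> Y = Z" using assms(2) by (meson Int_lower1)
    then show False using v by auto
  qed
  show "\<exists>u\<in>Z. u \<in> Y \<and> g u \<notin> Y" using v *[of v Y] by auto
  show "\<exists>u\<in>Z. u \<notin> Y \<and> g u \<in> Y" using v *[of v "- Y"] by auto
qed

section \<open>Cuts and orientations of multigraphs\<close>

definition leaves :: "('v, 'e) multigraph \<Rightarrow> ('e \<Rightarrow> 'v) \<Rightarrow> 'e \<Rightarrow> 'v set \<Rightarrow> bool" where
  "leaves G h e X \<longleftrightarrow> e \<in> cut G X \<and> h e \<notin> X"

text \<open>An orientation is given by the function \<open>h\<close> that selects the head of every edge.\<close>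

definition deletable :: "('v, 'e) multigraph \<Rightarrow> ('e \<Rightarrow> 'v) \<Rightarrow> 'e \<Rightarrow> bool" where
  "deletable G h f \<longleftrightarrow>
     (\<forall>X. X \<noteq> {} \<longrightarrow> X \<subset> vertices G \<longrightarrow> (\<exists>e. e \<noteq> f \<and> leaves G h e X))"

definition opp :: "('v, 'e) multigraph \<Rightarrow> 'e \<Rightarrow> 'v \<Rightarrow> 'v" where
  "opp G e v = (SOME u. u \<in> ends G e \<and> u \<noteq> v)"

context fin_multigraph
begin

lemma cut_subset: "cut G X \<subseteq> edges G"
  by (auto simp: cut_def)

lemma finite_cut [simp]: "finite (cut G X)"
  using cut_subset finite_edges finite_subset by blast

lemma opp:
  assumes "e \<in> edges G" "v \<in> ends G e"
  shows "ends G e = {v, opp G e v}" "opp G e v \<noteq> v" "opp G e v \<in> ends G e" "opp G e (opp G e v) = v"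
    "opp G e v \<in> vertices G"
proof -
  obtain a b where ab: "ends G e = {a, b}" "a \<noteq> b"
    using card_ends[OF assms(1)] by (auto simp: card_2_iff)
  obtain u where u: "ends G e = {v, u}" "u \<noteq> v"
  proof (cases "v = a")
    case True
    then show ?thesis using that[of b] ab by simp
  next
    case False
    then show ?thesis using that[of a] ab assms(2) by auto
  qed
  have o: "opp G e v = u" unfolding opp_def by (rule some_equality) (use u in auto)
  have "opp G e u = v" unfolding opp_def by (rule some_equality) (use u in auto)
  with o u show "ends G e = {v, opp G e v}" "opp G e v \<noteq> v" "opp G e v \<in> ends G e"
    "opp G e (opp G e v) = v" by auto
  show "opp G e v \<in> vertices G" using o u ends_subset[OF assms(1)] by auto
qed

lemma mem_cut_iff:
  assumes "e \<in> edges G" "ends G e = {u, v}"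
  shows "e \<in> cut G X \<longleftrightarrow> (u \<in> X) \<noteq> (v \<in> X)"
proof -
  have "u \<noteq> v" using card_ends[OF assms(1)] assms(2) by auto
  then have "card ({u, v} \<inter> X) = of_bool (u \<in> X) + of_bool (v \<in> X)"
    by (auto simp: Int_insert_left)
  then show ?thesis using assms by (auto simp: cut_def)
qed

lemma mem_cut_opp:
  "e \<in> edges G \<Longrightarrow> v \<in> ends G e \<Longrightarrow> e \<in> cut G X \<longleftrightarrow> (v \<in> X) \<noteq> (opp G e v \<in> X)"
  by (rule mem_cut_iff[OF _ opp(1)])

lemma cut_singleton: "cut G {v} = {e \<in> edges G. v \<in> ends G e}"
proof -
  have "e \<in> cut G {v} \<longleftrightarrow> v \<in> ends G e" if e: "e \<in> edges G" for e
  proof -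
    obtain a b where "ends G e = {a, b}" "a \<noteq> b" using card_ends[OF e] by (auto simp: card_2_iff)
    then show ?thesis using mem_cut_iff[OF e, of a b "{v}"] by auto
  qed
  then show ?thesis using cut_subset by blast
qed

lemma cut_compl:
  assumes "X \<subseteq> vertices G"
  shows "cut G (vertices G - X) = cut G X"
proof -
  have "e \<in> cut G (vertices G - X) \<longleftrightarrow> e \<in> cut G X" if e: "e \<in> edges G" for e
  proof -
    obtain a b where ab: "ends G e = {a, b}" using card_ends[OF e] by (auto simp: card_2_iff)
    then show ?thesis using mem_cut_iff[OF e ab] ends_subset[OF e] by auto
  qed
  then show ?thesis using cut_subset by blast
qed

section \<open>Multigraphs as weights on pairs of vertices\<close>

definition edge_weight :: "('e \<Rightarrow> nat) \<Rightarrow> 'v \<Rightarrow> 'v \<Rightarrow> nat" where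
  "edge_weight c u v = (\<Sum>e\<in>edges G. if ends G e = {u, v} then c e else 0)"

lemma ecut_edge_weight:
  assumes "X \<subseteq> vertices G"
  shows "ecut (edge_weight c) (vertices G) X = sum c (cut G X)"
proof -
  have fin: "finite X" "finite (vertices G - X)" using assms finite_vertices finite_subset by auto
  have inner: "(\<Sum>u\<in>X. \<Sum>v\<in>vertices G - X. if ends G e = {u, v} then c e else 0) =
      (if e \<in> cut G X then c e else 0)" if e: "e \<in> edges G" for e
  proof -
    obtain a b where ab: "ends G e = {a, b}" "a \<noteq> b" using card_ends[OF e] by (auto simp: card_2_iff)
    have V: "a \<in> vertices G" "b \<in> vertices G" using ends_subset[OF e] ab by auto
    have "(\<Sum>u\<in>X. \<Sum>v\<in>vertices G - X. if ends G e = {u, v} then c e else 0) =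
      (\<Sum>x\<in>X \<times> (vertices G - X). if ends G e = {fst x, snd x} then c e else 0)"
      by (simp add: sum.cartesian_product case_prod_unfold)
    also have "\<dots> = (\<Sum>x\<in>{x \<in> X \<times> (vertices G - X). ends G e = {fst x, snd x}}. c e)"
      by (intro sum.inter_filter[symmetric]) (use fin in auto)
    also have "{x \<in> X \<times> (vertices G - X). ends G e = {fst x, snd x}} =
        (if a \<in> X \<and> b \<notin> X then {(a, b)} else if b \<in> X \<and> a \<notin> X then {(b, a)} else {})"
      using ab V by (auto simp: doubleton_eq_iff)
    also have "(\<Sum>x\<in>\<dots>. c e) = (if e \<in> cut G X then c e else 0)"
      using mem_cut_iff[OF e ab(1), of X] by auto
    finally show ?thesis .
  qed
  have "ecut (edge_weight c) (vertices G) X =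
      (\<Sum>u\<in>X. \<Sum>e\<in>edges G. \<Sum>v\<in>vertices G - X. if ends G e = {u, v} then c e else 0)"
    unfolding ecut_def btw_def edge_weight_def by (intro sum.cong refl sum.swap)
  also have "\<dots> = (\<Sum>e\<in>edges G. if e \<in> cut G X then c e else 0)"
    by (subst sum.swap) (simp add: inner)
  also have "\<dots> = sum c (cut G X)"
    using cut_subset finite_edges by (intro sum.mono_neutral_cong_right) auto
  finally show ?thesis .
qed

lemma symw_edge_weight: "symw (edge_weight c)"
  by (simp add: symw_def edge_weight_def insert_commute)

lemma pairing_edges:
  assumes "N \<subseteq> vertices G"
    and "\<And>X. X \<subseteq> vertices G \<Longrightarrow> separates N X \<Longrightarrow> 4 \<le> sum c (cut G X)"
  shows "\<exists>p. involution_on {v \<in> vertices G. odd (sum c (cut G {v}))} p \<and>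
    (\<forall>X\<subseteq>vertices G. separates N X \<longrightarrow>
      card {v \<in> X. odd (sum c (cut G {v})) \<and> p v \<notin> X} + 4 \<le> sum c (cut G X))"
proof -
  note e = ecut_edge_weight[of _ c]
  obtain p where p: "\<forall>v\<in>vertices G. odd (ecut (edge_weight c) (vertices G) {v}) \<longrightarrow> p v \<in> vertices G \<and>
      odd (ecut (edge_weight c) (vertices G) {p v}) \<and> p v \<noteq> v \<and> p (p v) = v"
    "\<forall>X\<subseteq>vertices G. separates N X \<longrightarrow>
      card {v \<in> X. odd (ecut (edge_weight c) (vertices G) {v}) \<and> p v \<notin> X} + 4
      \<le> ecut (edge_weight c) (vertices G) X"
    using pairing_exists[OF finite_vertices symw_edge_weight assms(1), of c] assms(2) e by auto
  have "involution_on {v \<in> vertices G. odd (sum c (cut G {v}))} p"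
    using p(1) e unfolding involution_on_def by auto
  moreover have "card {v \<in> X. odd (sum c (cut G {v})) \<and> p v \<notin> X} + 4 \<le> sum c (cut G X)"
    if X: "X \<subseteq> vertices G" "separates N X" for X
  proof -
    have "{v \<in> X. odd (sum c (cut G {v})) \<and> p v \<notin> X} =
      {v \<in> X. odd (ecut (edge_weight c) (vertices G) {v}) \<and> p v \<notin> X}"
      using X e by auto
    then show ?thesis using p(2) X e by auto
  qed
  ultimately show ?thesis by blast
qed

end

section \<open>From deletable edges to the Frank number\<close>

lemma frank_cover_deletable:
  assumes "fin_multigraph G" "vertices G \<noteq> {}"
    and h: "\<And>i e. i < k \<Longrightarrow> e \<in> edges G \<Longrightarrow> h i e \<in> ends G e"
    and del: "\<And>e. e \<in> edges G \<Longrightarrow> \<exists>i<k. deletable G (h i) e"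
  shows "frank_cover G k"
proof -
  interpret fin_multigraph G by fact
  define D where "D i = \<lparr>verts = vertices G, arcs = edges G, tail = (\<lambda>e. opp G e (h i e)), head = h i\<rparr>"
    for i :: nat
  have o: "orientation (D i) G" if "i < k" for i
    using opp(1) h[OF that] by (auto simp: orientation_def D_def insert_commute)
  have "strongly_connected (pre_digraph.del_arc (D i) f)"
    if i: "i < k" "deletable G (h i) f" for i f
  proof -
    have wf: "wf_digraph (D i)"
    proof
      fix e assume "e \<in> arcs (D i)"
      then have e: "e \<in> edges G" by (simp add: D_def)
      show "tail (D i) e \<in> verts (D i)" using opp(5)[OF e h[OF i(1) e]] by (simp add: D_def)
      show "head (D i) e \<in> verts (D i)" using ends_subset[OF e] h[OF i(1) e] by (auto simp: D_def)
    qed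
    interpret wf_digraph "pre_digraph.del_arc (D i) f"
      using wf by (rule wf_digraph.wf_digraph_del_arc)
    show ?thesis
      unfolding strongly_connected_iff_cuts
    proof (intro conjI allI impI)
      show "verts (pre_digraph.del_arc (D i) f) \<noteq> {}"
        using assms(2) by (simp add: pre_digraph.del_arc_def D_def)
      fix X assume "X \<noteq> {} \<and> X \<subset> verts (pre_digraph.del_arc (D i) f)"
      then have "X \<noteq> {}" "X \<subset> vertices G" by (simp_all add: pre_digraph.del_arc_def D_def)
      then obtain e where e: "e \<noteq> f" "leaves G (h i) e X" using i(2) unfolding deletable_def by blast
      then have eE: "e \<in> edges G" using cut_subset by (auto simp: leaves_def)
      then have "opp G e (h i e) \<in> X"
        using e(2) mem_cut_opp[OF eE h[OF i(1) eE], of X] by (auto simp: leaves_def)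
      then show "\<exists>a\<in>arcs (pre_digraph.del_arc (D i) f).
          tail (pre_digraph.del_arc (D i) f) a \<in> X \<and> head (pre_digraph.del_arc (D i) f) a \<notin> X"
        using e eE by (intro bexI[of _ e]) (auto simp: pre_digraph.del_arc_def D_def leaves_def)
    qed
  qed
  then show ?thesis using o del unfolding frank_cover_def by blast
qed

section \<open>Deleting the edges of a matching\<close>

locale cubic_ess4 = fin_multigraph G for G :: "('v, 'e) multigraph" +
  assumes cubic: "cubic G" and ess4: "essentially_4_edge_connected G"
begin

lemma card_incident: "v \<in> vertices G \<Longrightarrow> card {e \<in> edges G. v \<in> ends G e} = 3"
  using cubic by (simp add: cubic_def degree_def)

lemma card_cut_ge3: "X \<noteq> {} \<Longrightarrow> X \<subset> vertices G \<Longrightarrow> 3 \<le> card (cut G X)"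
  using ess4 by (simp add: essentially_4_edge_connected_def k_edge_connected_def)

lemma card_cut_ge4:
  assumes "X \<subseteq> vertices G" "2 \<le> card X" "2 \<le> card (vertices G - X)"
  shows "4 \<le> card (cut G X)"
proof -
  have "X \<noteq> {}" "X \<subset> vertices G" using assms by auto
  then have "3 \<le> card (cut G X)" by (rule card_cut_ge3)
  moreover have "card (cut G X) \<noteq> 3"
  proof
    assume "card (cut G X) = 3"
    then have "card X = 1 \<or> card (vertices G - X) = 1"
      using ess4 assms(1) unfolding essentially_4_edge_connected_def by blast
    then show False using assms(2,3) by simp
  qed
  ultimately show ?thesis by simp
qed

end

lemma two_le_card: "finite X \<Longrightarrow> x \<in> X \<Longrightarrow> y \<in> X \<Longrightarrow> x \<noteq> y \<Longrightarrow> 2 \<le> card X"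
  using card_mono[of X "{x, y}"] by simp

section \<open>Totally cyclic sets of arcs and their extension\<close>

context fin_multigraph
begin

text \<open>Applied to the complement of \<open>Y\<close>, the condition also yields an arc of
  \<open>A\<close> that enters \<open>Y\<close>, so it says that the arcs of \<open>A\<close> lie on
  directed cycles of \<open>A\<close>. It is phrased by cuts, since that is how deletability is
  tested.\<close>

definition balanced_arcs :: "'e set \<Rightarrow> ('e \<Rightarrow> 'v) \<Rightarrow> bool" where
  "balanced_arcs A h \<longleftrightarrow> (\<forall>e\<in>A. h e \<in> ends G e) \<and>
    (\<forall>Y. A \<inter> cut G Y \<noteq> {} \<longrightarrow> (\<exists>e\<in>A. leaves G h e Y))"

text \<open>\<open>Z\<close> is a cycle of \<open>g\<close> along the edges
  \<open>\<epsilon> v\<close>, directed all forward or all backward, and a cut that it meets is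
  crossed by it in both directions. The coherence of \<open>h\<close> excludes a cycle that runs
  through one edge back and forth.\<close>

lemma balanced_arcs_extend:
  assumes A: "balanced_arcs A h" "A \<subseteq> edges G"
    and Z: "Z \<noteq> {}" "g ` Z \<subseteq> Z" "\<forall>W\<subseteq>Z. W \<noteq> {} \<longrightarrow> g ` W \<subseteq> W \<longrightarrow> W = Z"
    and \<epsilon>: "\<And>v. v \<in> Z \<Longrightarrow> \<epsilon> v \<in> edges G - A" "\<And>v. v \<in> Z \<Longrightarrow> ends G (\<epsilon> v) = {v, g v}"
    and h: "(\<forall>v\<in>Z. h (\<epsilon> v) = g v) \<or> (\<forall>v\<in>Z. h (\<epsilon> v) = v)"
  shows "balanced_arcs (A \<union> \<epsilon> ` Z) h"
  unfolding balanced_arcs_def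
proof (intro conjI allI impI)
  show "\<forall>e\<in>A \<union> \<epsilon> ` Z. h e \<in> ends G e" using A(1) h \<epsilon>(2) by (auto simp: balanced_arcs_def)
  fix Y assume Y: "(A \<union> \<epsilon> ` Z) \<inter> cut G Y \<noteq> {}"
  show "\<exists>e\<in>A \<union> \<epsilon> ` Z. leaves G h e Y"
  proof (cases "A \<inter> cut G Y = {}")
    case False
    then show ?thesis using A(1) by (auto simp: balanced_arcs_def)
  next
    case True
    have c: "\<epsilon> v \<in> cut G Y \<longleftrightarrow> (v \<in> Y) \<noteq> (g v \<in> Y)" if "v \<in> Z" for v
      using mem_cut_iff[of "\<epsilon> v" v "g v"] \<epsilon>[OF that] by simp
    obtain v where v: "v \<in> Z" "(v \<in> Y) \<noteq> (g v \<in> Y)" using Y True c by auto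
    note m = minimal_closed_crossing[OF Z(2,3) v]
    from h show ?thesis
    proof
      assume "\<forall>v\<in>Z. h (\<epsilon> v) = g v"
      then have "leaves G h (\<epsilon> u) Y" if "u \<in> Z" "u \<in> Y" "g u \<notin> Y" for u
        using c that by (simp add: leaves_def)
      then show ?thesis using m(1) by blast
    next
      assume "\<forall>v\<in>Z. h (\<epsilon> v) = v"
      then have "leaves G h (\<epsilon> u) Y" if "u \<in> Z" "u \<notin> Y" "g u \<in> Y" for u
        using c that by (simp add: leaves_def)
      then show ?thesis using m(2) by blast
    qed
  qed
qed

lemma balanced_arcs_cong:
  "(\<And>e. e \<in> A \<Longrightarrow> h e = h' e) \<Longrightarrow> balanced_arcs A h \<longleftrightarrow> balanced_arcs A h'"
  by (simp add: balanced_arcs_def leaves_def)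

end

context cubic_ess4
begin

text \<open>
  The sign lives on the half-edges outside \<open>A\<close> and on the odd vertices. At a vertex off \<open>A\<close> the second
  involution pairs two half-edges outside \<open>F\<close>, so one of them leaves the vertex and the other enters it.
\<close>

lemma light_orientation:
  assumes F: "\<And>v. v \<in> vertices G \<Longrightarrow> card {e \<in> F. v \<in> ends G e} \<le> 1" "F \<subseteq> edges G"
    and A: "balanced_arcs A hA" "A \<subseteq> edges G - F"
  defines "N \<equiv> \<Union> (ends G ` A)"
  shows "\<exists>h. (\<forall>e\<in>edges G. h e \<in> ends G e) \<and> (\<forall>e\<in>A. h e = hA e) \<and>
    (\<forall>v\<in>vertices G - N. (\<exists>e\<in>edges G - A - F. v \<in> ends G e \<and> h e = v) \<and>
      (\<exists>e\<in>edges G - A - F. v \<in> ends G e \<and> h e \<noteq> v)) \<and>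
    (\<forall>X\<subseteq>vertices G. separates N X \<longrightarrow> A \<inter> cut G X = {} \<longrightarrow> 2 \<le> card {e. leaves G h e X})"
proof -
  let ?V = "vertices G" and ?E = "edges G"
  define L where "L = ?E - A"
  \<comment> \<open>Weight 4 alone satisfies the bound at a cut that meets \<open>A\<close>, and
    being even it leaves the parity at each vertex to the edges of \<open>L\<close>.\<close>
  define c where "c e = (if e \<in> A then 4 else 1 :: nat)" for e
  have AE: "A \<subseteq> ?E" using A by auto
  have NV: "N \<subseteq> ?V" unfolding N_def using AE ends_subset by blast
  have finA: "finite A" using AE finite_edges finite_subset by blast
  \<comment> \<open>A terminal has an edge of \<open>A\<close>, whose other end lies on the same
    side of a cut avoiding \<open>A\<close>. If such a cut separates terminals, both sides therefore
    have two vertices, and it has at least 4 edges.\<close>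
  have A2: "\<exists>u. u \<in> X \<and> u \<noteq> v" if X: "v \<in> X" "v \<in> N" "A \<inter> cut G X = {}" for v X
  proof -
    obtain e where e: "e \<in> A" "v \<in> ends G e" using X by (auto simp: N_def)
    have "opp G e v \<in> X" using mem_cut_opp[of e v X] e X AE by auto
    moreover have "opp G e v \<noteq> v" using opp(2) e AE by blast
    ultimately show ?thesis by blast
  qed
  have no_cross: "sum c (cut G X) = card (cut G X)" if "A \<inter> cut G X = {}" for X
  proof -
    have "sum c (cut G X) = (\<Sum>e\<in>cut G X. 1)" using that by (intro sum.cong) (auto simp: c_def)
    then show ?thesis by simp
  qed
  have ge4: "4 \<le> sum c (cut G X)" if X: "X \<subseteq> ?V" "separates N X" for X
  proof (cases "A \<inter> cut G X = {}")
    case True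
    have fin: "finite X" "finite (?V - X)" using X finite_vertices finite_subset by auto
    obtain v where v: "v \<in> X" "v \<in> N" using X by (auto simp: separates_def)
    then have "2 \<le> card X" using A2[OF v True] two_le_card[OF fin(1)] by blast
    moreover obtain u where u: "u \<in> ?V - X" "u \<in> N" using X NV by (auto simp: separates_def)
    moreover have "A \<inter> cut G (?V - X) = {}" using True cut_compl[OF X(1)] by simp
    ultimately have "2 \<le> card X" "2 \<le> card (?V - X)"
      using A2[of u "?V - X"] two_le_card[OF fin(2)] by blast+
    then show ?thesis using card_cut_ge4 X no_cross[OF True] by simp
  next
    case False
    then obtain e where e: "e \<in> A" "e \<in> cut G X" by blast
    then have "c e \<le> sum c (cut G X)" by (intro member_le_sum) auto
    then show ?thesis using e by (simp add: c_def)
  qed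
  define T where "T = {v \<in> ?V. odd (sum c (cut G {v}))}"
  obtain p where p: "involution_on T p"
    and pX: "\<forall>X\<subseteq>?V. separates N X \<longrightarrow>
      card {v \<in> X. odd (sum c (cut G {v})) \<and> p v \<notin> X} + 4 \<le> sum c (cut G X)"
    using pairing_edges[OF NV ge4] unfolding T_def by blast
  define D where "D = Inl ` {(e, v). e \<in> L \<and> v \<in> ends G e} \<union> Inr ` T"
  define vt :: "('e \<times> 'v) + 'v \<Rightarrow> 'v" where "vt = case_sum snd id"
  define \<alpha> :: "('e \<times> 'v) + 'v \<Rightarrow> ('e \<times> 'v) + 'v" where
    "\<alpha> = case_sum (\<lambda>(e, v). Inl (e, opp G e v)) (\<lambda>v. Inr (p v))"
  have LE: "L \<subseteq> ?E" by (auto simp: L_def)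
  have finD: "finite D"
  proof -
    have "finite T" using finite_vertices by (simp add: T_def)
    moreover have "finite {(e, v). e \<in> L \<and> v \<in> ends G e}"
    proof (rule finite_subset)
      show "{(e, v). e \<in> L \<and> v \<in> ends G e} \<subseteq> ?E \<times> ?V" using LE ends_subset by blast
    qed (use finite_vertices finite_edges in auto)
    ultimately show ?thesis by (simp add: D_def)
  qed
  have \<alpha>: "involution_on D \<alpha>"
    unfolding involution_on_def
  proof
    fix d assume d: "d \<in> D"
    show "\<alpha> d \<in> D \<and> \<alpha> d \<noteq> d \<and> \<alpha> (\<alpha> d) = d"
    proof (cases d)
      case (Inl ev)
      obtain e v where ev: "ev = (e, v)" by (cases ev)
      with d Inl have e: "e \<in> L" "v \<in> ends G e" by (auto simp: D_def)
      then have "e \<in> ?E" using LE by auto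
      from opp[OF this e(2)] show ?thesis using e Inl ev by (auto simp: \<alpha>_def D_def)
    next
      case (Inr v)
      then have "v \<in> T" using d by (auto simp: D_def)
      then show ?thesis using p Inr by (auto simp: \<alpha>_def D_def involution_on_def)
    qed
  qed
  let ?fib = "\<lambda>v. {d \<in> D. vt d = v}"
  have fib: "?fib v = (\<lambda>e. Inl (e, v)) ` {e \<in> L. v \<in> ends G e} \<union> (if v \<in> T then {Inr v} else {})" for v
    by (auto simp: D_def vt_def)
  have finL: "finite L" by (rule finite_subset[OF LE finite_edges])
  have LV: "v \<in> ?V" if "e \<in> L" "v \<in> ends G e" for e v
    using that LE ends_subset[of e] by auto
  have vtV: "vt d \<in> ?V" if "d \<in> D" for d
    using that LV by (cases d) (auto simp: D_def vt_def T_def)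
  \<comment> \<open>The point \<open>Inr v\<close> is present exactly if an odd number of edges of
    \<open>L\<close> meets \<open>v\<close>, so that the fibre can be paired up.\<close>
  have even_fib: "even (card (?fib v))" if v: "v \<in> ?V" for v
  proof -
    let ?I = "{e \<in> ?E. v \<in> ends G e}"
    have "sum c ?I = sum c (?I \<inter> A) + sum c (?I - A)"
      using finite_edges by (simp add: sum.Int_Diff[of ?I c A])
    also have "sum c (?I \<inter> A) = 4 * card (?I \<inter> A)" by (simp add: c_def)
    also have "sum c (?I - A) = card (?I - A)" by (simp add: c_def)
    also have "?I - A = {e \<in> L. v \<in> ends G e}" by (auto simp: L_def)
    finally have "v \<in> T \<longleftrightarrow> odd (card {e \<in> L. v \<in> ends G e})"
      using v by (simp add: T_def cut_singleton)
    moreover have "finite {e \<in> L. v \<in> ends G e}" using finL by simp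
    moreover have "card (?fib v) =
        card ((\<lambda>e. Inl (e, v) :: ('e \<times> 'v) + 'v) ` {e \<in> L. v \<in> ends G e}) + card (if v \<in> T then {Inr v :: ('e \<times> 'v) + 'v} else {})"
      unfolding fib using \<open>finite {e \<in> L. v \<in> ends G e}\<close> by (intro card_Un_disjoint) auto
    moreover have "card ((\<lambda>e. Inl (e, v) :: ('e \<times> 'v) + 'v) ` {e \<in> L. v \<in> ends G e}) = card {e \<in> L. v \<in> ends G e}"
      by (intro card_image) (auto simp: inj_on_def)
    ultimately show ?thesis by simp
  qed
  have free2: "\<exists>e1 e2. e1 \<noteq> e2 \<and> {e1, e2} \<subseteq> L - F \<and> v \<in> ends G e1 \<and> v \<in> ends G e2"
    if v: "v \<in> ?V - N" for v
  proof -
    let ?I = "{e \<in> ?E. v \<in> ends G e}"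
    have I: "?I = {e \<in> F. v \<in> ends G e} \<union> {e \<in> L - F. v \<in> ends G e}"
      using v F(2) LE by (auto simp: L_def N_def)
    have "3 = card ?I" using card_incident[of v] v by simp
    also have "\<dots> \<le> card {e \<in> F. v \<in> ends G e} + card {e \<in> L - F. v \<in> ends G e}"
      unfolding I by (rule card_Un_le)
    finally have "2 \<le> card {e \<in> L - F. v \<in> ends G e}" using F(1)[of v] v by simp
    then obtain S where S: "S \<subseteq> {e \<in> L - F. v \<in> ends G e}" "card S = 2"
      by (rule obtain_subset_with_card_n)
    obtain e1 e2 where "S = {e1, e2}" "e1 \<noteq> e2" using S(2) by (auto simp: card_2_iff)
    with S have "{e1, e2} \<subseteq> {e \<in> L - F. v \<in> ends G e}" "e1 \<noteq> e2" by auto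
    then show ?thesis by (intro exI[of _ e1] exI[of _ e2]) auto
  qed
  have "\<forall>v\<in>?V. \<exists>b. involution_on (?fib v) b \<and>
      (v \<notin> N \<longrightarrow> (\<exists>e1 e2. {e1, e2} \<subseteq> L - F \<and> v \<in> ends G e1 \<and> v \<in> ends G e2 \<and> b (Inl (e1, v)) = Inl (e2, v)))"
  proof
    fix v assume v: "v \<in> ?V"
    have fin: "finite (?fib v)" using finD by simp
    show "\<exists>b. involution_on (?fib v) b \<and>
      (v \<notin> N \<longrightarrow> (\<exists>e1 e2. {e1, e2} \<subseteq> L - F \<and> v \<in> ends G e1 \<and> v \<in> ends G e2 \<and> b (Inl (e1, v)) = Inl (e2, v)))"
    proof (cases "v \<in> N")
      case True
      then show ?thesis using even_card_involution[OF fin even_fib[OF v]] by simp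
    next
      case False
      then obtain e1 e2 where e: "e1 \<noteq> e2" "{e1, e2} \<subseteq> L - F" "v \<in> ends G e1" "v \<in> ends G e2"
        using free2[of v] v by blast
      have "Inl (e1, v) \<in> ?fib v" "Inl (e2, v) \<in> ?fib v" using e unfolding fib by auto
      then obtain b where "involution_on (?fib v) b" "b (Inl (e1, v)) = Inl (e2, v)"
        using even_card_involution_pair[OF fin even_fib[OF v]] e(1) by blast
      then show ?thesis using e by blast
    qed
  qed
  from bchoice[OF this] obtain B where B: "\<forall>v\<in>?V. involution_on (?fib v) (B v) \<and>
      (v \<notin> N \<longrightarrow> (\<exists>e1 e2. {e1, e2} \<subseteq> L - F \<and> v \<in> ends G e1 \<and> v \<in> ends G e2 \<and> B v (Inl (e1, v)) = Inl (e2, v)))"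
    by (elim exE)
  define \<beta> where "\<beta> d = B (vt d) d" for d
  have "involution_on (?fib v) (B v)" if "v \<in> vt ` D" for v using B that vtV by auto
  note \<beta> = fibrewise_involution[OF this, folded \<beta>_def]
  obtain s :: "('e \<times> 'v) + 'v \<Rightarrow> bool" where
    s: "\<And>d. d \<in> D \<Longrightarrow> s (\<alpha> d) \<noteq> s d \<and> s (\<beta> d) \<noteq> s d"
    using two_involutions[OF finD \<alpha> \<beta>(1)] by blast
  \<comment> \<open>Of the two half-edges of an edge in \<open>L\<close>, which have opposite signs,
    the negative one becomes the head.\<close>
  define h where "h e = (if e \<in> A then hA e else SOME v. v \<in> ends G e \<and> \<not> s (Inl (e, v)))" for e
  have hL: "h e \<in> ends G e" "\<not> s (Inl (e, h e))" "s (Inl (e, opp G e (h e)))" if e: "e \<in> L" for e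
  proof -
    have eE: "e \<in> ?E" and eA: "e \<notin> A" using e by (auto simp: L_def)
    obtain a where a: "a \<in> ends G e" using card_ends[OF eE] by fastforce
    have "s (Inl (e, opp G e a)) \<noteq> s (Inl (e, a))"
      using s[of "Inl (e, a)"] e a by (auto simp: D_def \<alpha>_def)
    then have "\<exists>v. v \<in> ends G e \<and> \<not> s (Inl (e, v))" using a opp(3)[OF eE a] by blast
    then have 1: "h e \<in> ends G e \<and> \<not> s (Inl (e, h e))"
      unfolding h_def using eA someI_ex[of "\<lambda>v. v \<in> ends G e \<and> \<not> s (Inl (e, v))"] by simp
    then show "h e \<in> ends G e" "\<not> s (Inl (e, h e))" by auto
    show "s (Inl (e, opp G e (h e)))"
      using s[of "Inl (e, h e)"] e 1 by (auto simp: D_def \<alpha>_def)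
  qed
  have hiff: "h e = v \<longleftrightarrow> \<not> s (Inl (e, v))" if "e \<in> L" "v \<in> ends G e" for e v
  proof -
    have "e \<in> ?E" using that LE by auto
    then have "v = h e \<or> v = opp G e (h e)" using opp(1) hL(1)[OF that(1)] that(2) by blast
    then show ?thesis using hL[OF that(1)] opp(2)[OF \<open>e \<in> ?E\<close> hL(1)[OF that(1)]] by auto
  qed
  have "h e \<in> ends G e" if "e \<in> ?E" for e
    using that hL[of e] A(1) by (cases "e \<in> A") (auto simp: L_def h_def balanced_arcs_def)
  moreover have "(\<exists>e\<in>?E - A - F. v \<in> ends G e \<and> h e = v) \<and>
      (\<exists>e\<in>?E - A - F. v \<in> ends G e \<and> h e \<noteq> v)" if v: "v \<in> ?V - N" for v
  proof -
    obtain e1 e2 where e: "{e1, e2} \<subseteq> L - F" "v \<in> ends G e1" "v \<in> ends G e2"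
      "B v (Inl (e1, v)) = Inl (e2, v)" using B v by blast
    have "Inl (e1, v) \<in> D" using e by (auto simp: D_def)
    from s[OF this] have "s (Inl (e2, v)) \<noteq> s (Inl (e1, v))" using e(4) by (simp add: \<beta>_def vt_def)
    moreover have "e1 \<in> ?E - A - F" "e2 \<in> ?E - A - F" using e by (auto simp: L_def)
    ultimately show ?thesis using e hiff[of e1 v] hiff[of e2 v] by blast
  qed
  moreover have "2 \<le> card {e. leaves G h e X}"
    if X: "X \<subseteq> ?V" "separates N X" "A \<inter> cut G X = {}" for X
  proof -
    let ?Y = "{d \<in> D. vt d \<in> X}" and ?C = "cut G X"
    let ?O = "{e \<in> ?C. h e \<notin> X}" and ?I = "{e \<in> ?C. h e \<in> X}"
    let ?P = "{v \<in> X. odd (sum c (cut G {v})) \<and> p v \<notin> X}"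
    have CL: "?C \<subseteq> L" using X cut_subset by (auto simp: L_def)
    have finX: "finite X" using X finite_vertices finite_subset by blast
    \<comment> \<open>\<open>\<beta>\<close> stays within the fibres and hence within
      \<open>?Y\<close>. So the number of entering edges is at most that of leaving edges plus that
      of pairs across \<open>X\<close>. The pairs number at most all crossing edges minus 4, which
      forces 2 leaving edges.\<close>
    have bal: "card {d \<in> ?Y. \<alpha> d \<notin> ?Y \<and> s d} = card {d \<in> ?Y. \<alpha> d \<notin> ?Y \<and> \<not> s d}"
    proof -
      have "\<beta> d \<in> ?Y" if "d \<in> ?Y" for d using that \<beta> by (auto simp: involution_on_def)
      then have "{d \<in> ?Y. \<beta> d \<notin> ?Y \<and> Q d} = {}" for Q by blast
      then show ?thesis using signed_balance[OF finD \<alpha> \<beta>(1) s, of ?Y] by (simp only: card.empty) simp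
    qed
    have "card ?I \<le> card {d \<in> ?Y. \<alpha> d \<notin> ?Y \<and> \<not> s d}"
    proof (rule card_inj_on_le[of "\<lambda>e. Inl (e, h e)"])
      show "(\<lambda>e. Inl (e, h e) :: ('e \<times> 'v) + 'v) ` ?I \<subseteq> {d \<in> ?Y. \<alpha> d \<notin> ?Y \<and> \<not> s d}"
      proof
        fix d :: "('e \<times> 'v) + 'v" assume "d \<in> (\<lambda>e. Inl (e, h e)) ` ?I"
        then obtain e where e: "d = Inl (e, h e)" "e \<in> ?C" "h e \<in> X" by auto
        have eL: "e \<in> L" "e \<in> ?E" using e CL LE by auto
        have "opp G e (h e) \<notin> X" using mem_cut_opp[OF eL(2) hL(1)[OF eL(1)]] e by auto
        then show "d \<in> {d \<in> ?Y. \<alpha> d \<notin> ?Y \<and> \<not> s d}"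
          using e hL[OF eL(1)] eL by (auto simp: D_def vt_def \<alpha>_def)
      qed
    qed (use finD in \<open>auto simp: inj_on_def\<close>)
    moreover have "card {d \<in> ?Y. \<alpha> d \<notin> ?Y \<and> s d} \<le> card ?O + card ?P"
    proof -
      have "{d \<in> ?Y. \<alpha> d \<notin> ?Y \<and> s d} \<subseteq> (\<lambda>e. Inl (e, opp G e (h e))) ` ?O \<union> Inr ` ?P"
      proof
        fix d assume d: "d \<in> {d \<in> ?Y. \<alpha> d \<notin> ?Y \<and> s d}"
        then have aD: "\<alpha> d \<in> D" using \<alpha> by (auto simp: involution_on_def)
        show "d \<in> (\<lambda>e. Inl (e, opp G e (h e))) ` ?O \<union> Inr ` ?P"
        proof (cases d)
          case (Inl ev)
          obtain e v where ev: "ev = (e, v)" by (cases ev)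
          with d Inl have e: "e \<in> L" "v \<in> ends G e" "v \<in> X" "s (Inl (e, v))"
            by (auto simp: D_def vt_def)
          have "opp G e v \<notin> X" using d aD Inl ev by (auto simp: \<alpha>_def vt_def)
          moreover have "e \<in> ?E" using e LE by auto
          moreover have "h e = opp G e v"
            using hiff[OF e(1,2)] hL(1)[OF e(1)] opp(1)[OF \<open>e \<in> ?E\<close> e(2)] e(4) by blast
          ultimately have "e \<in> ?O" "opp G e (h e) = v"
            using mem_cut_opp[of e v X] e opp(4)[of e v] by auto
          then show ?thesis using Inl ev by blast
        next
          case (Inr v)
          then have "v \<in> ?P" using d aD by (auto simp: D_def vt_def \<alpha>_def T_def)
          then show ?thesis using Inr by blast
        qed
      qed
      then have "card {d \<in> ?Y. \<alpha> d \<notin> ?Y \<and> s d} \<le>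
          card ((\<lambda>e. Inl (e, opp G e (h e)) :: ('e \<times> 'v) + 'v) ` ?O \<union> Inr ` ?P)"
        using finX by (intro card_mono) auto
      also have "\<dots> \<le> card ((\<lambda>e. Inl (e, opp G e (h e)) :: ('e \<times> 'v) + 'v) ` ?O) + card (Inr ` ?P :: (('e \<times> 'v) + 'v) set)"
        by (rule card_Un_le)
      also have "\<dots> \<le> card ?O + card ?P"
        using finX by (intro add_mono card_image_le) auto
      finally show ?thesis .
    qed
    moreover have "card ?P + 4 \<le> card ?C" using pX X no_cross by auto
    moreover have "card ?C = card ?O + card ?I"
      by (subst card_Un_disjoint[symmetric]) (auto intro: arg_cong[where f = card])
    ultimately have "2 \<le> card ?O" using bal by linarith
    moreover have "?O = {e. leaves G h e X}" by (auto simp: leaves_def)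
    ultimately show ?thesis by simp
  qed
  moreover have "\<forall>e\<in>A. h e = hA e" by (simp add: h_def)
  ultimately show ?thesis by blast
qed

theorem matching_deletable:
  assumes F: "\<And>v. v \<in> vertices G \<Longrightarrow> card {e \<in> F. v \<in> ends G e} \<le> 1" "F \<subseteq> edges G"
  shows "\<exists>h. (\<forall>e\<in>edges G. h e \<in> ends G e) \<and> (\<forall>f\<in>F. deletable G h f)"
proof -
  let ?V = "vertices G" and ?E = "edges G"
  define \<A> where "\<A> = {A. A \<subseteq> ?E - F \<and> (\<exists>h. balanced_arcs A h)}"
  have fin\<A>: "finite \<A>"
    by (rule finite_subset[of _ "Pow ?E"]) (use finite_edges in \<open>auto simp: \<A>_def\<close>)
  have "{} \<in> \<A>" by (simp add: \<A>_def balanced_arcs_def)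
  then have "Max (card ` \<A>) \<in> card ` \<A>" using fin\<A> by (intro Max_in) auto
  then obtain A where "A \<in> \<A>" and mA: "card A = Max (card ` \<A>)" by auto
  then obtain hA where A: "A \<subseteq> ?E - F" "balanced_arcs A hA" by (auto simp: \<A>_def)
  have mx: "card A' \<le> card A" if "A' \<subseteq> ?E - F" "balanced_arcs A' h" for A' h
    unfolding mA using that fin\<A> by (intro Max_ge) (auto simp: \<A>_def)
  define N where "N = \<Union> (ends G ` A)"
  obtain h where h: "\<forall>e\<in>?E. h e \<in> ends G e" "\<forall>e\<in>A. h e = hA e"
    and loc: "\<And>v. v \<in> ?V - N \<Longrightarrow> (\<exists>e\<in>?E - A - F. v \<in> ends G e \<and> h e = v)"
       "\<And>v. v \<in> ?V - N \<Longrightarrow> (\<exists>e\<in>?E - A - F. v \<in> ends G e \<and> h e \<noteq> v)"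
    and sepN: "\<And>X. X \<subseteq> ?V \<Longrightarrow> separates N X \<Longrightarrow> A \<inter> cut G X = {} \<Longrightarrow> 2 \<le> card {e. leaves G h e X}"
    using light_orientation[OF F A(2,1)] unfolding N_def by blast
  have Ah: "balanced_arcs A h" using A(2) h(2) balanced_arcs_cong[of A h hA] by simp
  have finA: "finite A" using A finite_edges finite_subset by blast
  \<comment> \<open>Following the edges \<open>\<epsilon>\<close> inside \<open>X\<close> closes a
    cycle outside \<open>A\<close> and \<open>F\<close> that \<open>h\<close> directs coherently, in
    contradiction to the maximality of \<open>A\<close>.\<close>
  have ext: False
    if X: "X \<noteq> {}" "X \<subseteq> ?V"
      and \<epsilon>: "\<And>v. v \<in> X \<Longrightarrow> \<epsilon> v \<in> ?E - A - F" "\<And>v. v \<in> X \<Longrightarrow> v \<in> ends G (\<epsilon> v)"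
        "\<And>v. v \<in> X \<Longrightarrow> opp G (\<epsilon> v) v \<in> X"
      and hd: "(\<forall>v\<in>X. h (\<epsilon> v) = opp G (\<epsilon> v) v) \<or> (\<forall>v\<in>X. h (\<epsilon> v) = v)"
    for X \<epsilon>
  proof -
    let ?g = "\<lambda>v. opp G (\<epsilon> v) v"
    have "finite X" using X finite_vertices finite_subset by blast
    then obtain Z where Z: "Z \<subseteq> X" "Z \<noteq> {}" "?g ` Z \<subseteq> Z"
      "\<forall>W\<subseteq>Z. W \<noteq> {} \<longrightarrow> ?g ` W \<subseteq> W \<longrightarrow> W = Z"
      using minimal_closed[of X ?g] X \<epsilon>(3) by blast
    have AE: "A \<subseteq> ?E" using A by blast
    have "balanced_arcs (A \<union> \<epsilon> ` Z) h"
    proof (rule balanced_arcs_extend[OF Ah AE Z(2-4)])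
      fix v assume "v \<in> Z"
      then have v: "v \<in> X" using Z by blast
      show "\<epsilon> v \<in> ?E - A" using \<epsilon>(1)[OF v] by blast
      show "ends G (\<epsilon> v) = {v, ?g v}" using opp(1) \<epsilon>(1,2)[OF v] by blast
    qed (use hd Z in blast)
    moreover have "A \<union> \<epsilon> ` Z \<subseteq> ?E - F" using A \<epsilon>(1) Z by blast
    ultimately have le: "card (A \<union> \<epsilon> ` Z) \<le> card A" by (intro mx)
    obtain v where v: "v \<in> Z" using Z by blast
    then have "\<epsilon> v \<notin> A" using \<epsilon>(1) Z by blast
    then have "A \<subset> A \<union> \<epsilon> ` Z" using v by blast
    moreover have "finite (A \<union> \<epsilon> ` Z)"
      using finA finite_subset[OF Z(1) \<open>finite X\<close>] by simp
    ultimately show False using psubset_card_mono[of "A \<union> \<epsilon> ` Z" A] le by simp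
  qed
  have "deletable G h f" if f: "f \<in> F" for f
    unfolding deletable_def
  proof (intro allI impI)
    fix X assume X: "X \<noteq> {}" "X \<subset> ?V"
    show "\<exists>e. e \<noteq> f \<and> leaves G h e X"
    proof (rule ccontr)
      assume "\<not> ?thesis"
      then have only: "e = f" if "leaves G h e X" for e using that by blast
      have fA: "f \<notin> A" using A f by blast
      have nc: "A \<inter> cut G X = {}" using Ah only fA unfolding balanced_arcs_def by blast
      have "\<not> separates N X"
      proof
        assume "separates N X"
        then have "2 \<le> card {e. leaves G h e X}" using sepN X nc by blast
        moreover have "card {e. leaves G h e X} \<le> card {f}"
          by (rule card_mono) (use only in auto)
        ultimately show False by simp
      qed
      then consider "X \<inter> N = {}" | "(?V - X) \<inter> N = {}" by (auto simp: separates_def)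
      then show False
      proof cases
        case 1
        \<comment> \<open>Each vertex of \<open>X\<close> is the tail of an edge outside
          \<open>A\<close> and \<open>F\<close>. Its head stays in \<open>X\<close>, since only
          \<open>f\<close> may leave \<open>X\<close>, so these edges can be followed without
          end.\<close>
        have "\<forall>v\<in>X. \<exists>e. e \<in> ?E - A - F \<and> v \<in> ends G e \<and> h e \<noteq> v"
          using loc(2) 1 X by blast
        then obtain \<epsilon> where \<epsilon>: "\<And>v. v \<in> X \<Longrightarrow> \<epsilon> v \<in> ?E - A - F \<and> v \<in> ends G (\<epsilon> v) \<and> h (\<epsilon> v) \<noteq> v"
          by metis
        have ho: "h (\<epsilon> v) = opp G (\<epsilon> v) v" if v: "v \<in> X" for v
          using \<epsilon>[OF v] h(1) opp(1)[of "\<epsilon> v" v] by blast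
        have "opp G (\<epsilon> v) v \<in> X" if v: "v \<in> X" for v
        proof (rule ccontr)
          assume "opp G (\<epsilon> v) v \<notin> X"
          then have "leaves G h (\<epsilon> v) X"
            using ho[OF v] \<epsilon>[OF v] v mem_cut_opp[of "\<epsilon> v" v X] by (simp add: leaves_def)
          then show False using only f \<epsilon>[OF v] by blast
        qed
        then show False using ext[of X \<epsilon>] X \<epsilon> ho by blast
      next
        case 2
        let ?X = "?V - X"
        \<comment> \<open>On the complement, entering edges are followed backwards: a tail in
          \<open>X\<close> would give an edge outside \<open>F\<close> that leaves
          \<open>X\<close>.\<close>
        have "\<forall>v\<in>?X. \<exists>e. e \<in> ?E - A - F \<and> v \<in> ends G e \<and> h e = v"
          using loc(1) 2 X by blast
        then obtain \<epsilon> where \<epsilon>: "\<And>v. v \<in> ?X \<Longrightarrow> \<epsilon> v \<in> ?E - A - F \<and> v \<in> ends G (\<epsilon> v) \<and> h (\<epsilon> v) = v"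
          by metis
        have "opp G (\<epsilon> v) v \<in> ?X" if v: "v \<in> ?X" for v
        proof (rule ccontr)
          assume "opp G (\<epsilon> v) v \<notin> ?X"
          then have "opp G (\<epsilon> v) v \<in> X" using opp(5) \<epsilon>[OF v] by blast
          then have "leaves G h (\<epsilon> v) X"
            using \<epsilon>[OF v] v mem_cut_opp[of "\<epsilon> v" v X] by (simp add: leaves_def)
          then show False using only f \<epsilon>[OF v] by blast
        qed
        then show False using ext[of ?X \<epsilon>] X \<epsilon> by blast
      qed
    qed
  qed
  then show ?thesis using h(1) by blast
qed

end

section \<open>Deleting the edges of a perfect matching\<close>

context fin_multigraph
begin

definition graph_matching :: "'e set \<Rightarrow> bool" where
  "graph_matching K \<longleftrightarrow> K \<subseteq> edges G \<and> (\<forall>e\<in>K. \<forall>e'\<in>K. e \<noteq> e' \<longrightarrow> ends G e \<inter> ends G e' = {})"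

text \<open>A leaving edge of \<open>K\<close> is counted by its tail in \<open>X\<close>, which has
  positive sign, an entering one by its head in \<open>X\<close>, which has negative sign. This
  translates the counts of \<open>signed_balance\<close> into edges.\<close>

lemma matching_crossing_count:
  assumes K: "graph_matching K" and X: "X \<subseteq> vertices G"
    and r: "\<And>e v. e \<in> K \<Longrightarrow> v \<in> ends G e \<Longrightarrow> r v = opp G e v"
    and h: "\<And>e. e \<in> K \<Longrightarrow> h e \<in> ends G e"
    and s: "\<And>e. e \<in> K \<Longrightarrow> \<not> s (h e) \<and> s (opp G e (h e))"
  shows "card {v \<in> X. v \<in> \<Union> (ends G ` K) \<and> r v \<notin> X \<and> s v} = card {e \<in> K. leaves G h e X}"
    and "card {v \<in> X. v \<in> \<Union> (ends G ` K) \<and> r v \<notin> X \<and> \<not> s v} = card {e \<in> K. e \<in> cut G X \<and> h e \<in> X}"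
proof -
  have KE: "e \<in> edges G" if "e \<in> K" for e using K that by (auto simp: graph_matching_def)
  have eq: "e = e'" if "e \<in> K" "e' \<in> K" "v \<in> ends G e" "v \<in> ends G e'" for e e' v
    using K that unfolding graph_matching_def by blast
  note o = opp[OF KE h]
  have cutK: "e \<in> cut G X \<longleftrightarrow> (h e \<in> X) \<noteq> (opp G e (h e) \<in> X)" if "e \<in> K" for e
    using mem_cut_opp[OF KE h] that by blast
  have hv: "v = h e \<or> v = opp G e (h e)" if "e \<in> K" "v \<in> ends G e" for e v
    using o(1)[OF that(1) that(1)] that(2) by blast
  have ends_in: "h e \<in> \<Union> (ends G ` K)" "opp G e (h e) \<in> \<Union> (ends G ` K)" if "e \<in> K" for e
    using h o(3) that by blast+
  have rh: "r (h e) = opp G e (h e)" "r (opp G e (h e)) = h e" if "e \<in> K" for e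
    using r[OF that h[OF that]] r[OF that o(3)[OF that that]] o(4)[OF that that] by simp_all
  have "bij_betw (\<lambda>e. opp G e (h e)) {e \<in> K. leaves G h e X} {v \<in> X. v \<in> \<Union> (ends G ` K) \<and> r v \<notin> X \<and> s v}"
    unfolding bij_betw_def
  proof (intro conjI inj_onI set_eqI iffI)
    fix e e' assume "e \<in> {e \<in> K. leaves G h e X}" "e' \<in> {e \<in> K. leaves G h e X}"
      "opp G e (h e) = opp G e' (h e')"
    then show "e = e'" using eq[of e e' "opp G e (h e)"] o(3)[of e] o(3)[of e'] by auto
  next
    fix v assume "v \<in> (\<lambda>e. opp G e (h e)) ` {e \<in> K. leaves G h e X}"
    then obtain e where e: "e \<in> K" "leaves G h e X" "v = opp G e (h e)" by blast
    then show "v \<in> {v \<in> X. v \<in> \<Union> (ends G ` K) \<and> r v \<notin> X \<and> s v}"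
      using rh(2)[OF e(1)] s[OF e(1)] ends_in[OF e(1)] cutK[OF e(1), THEN iffD1] by (auto simp: leaves_def)
  next
    fix v assume v: "v \<in> {v \<in> X. v \<in> \<Union> (ends G ` K) \<and> r v \<notin> X \<and> s v}"
    then obtain e where e: "e \<in> K" "v \<in> ends G e" by blast
    have "v = opp G e (h e)" using hv[OF e] s[OF e(1)] v by auto
    moreover have "leaves G h e X"
      using v rh(2)[OF e(1)] cutK[OF e(1)] calculation by (simp add: leaves_def)
    ultimately show "v \<in> (\<lambda>e. opp G e (h e)) ` {e \<in> K. leaves G h e X}" using e by blast
  qed
  from bij_betw_same_card[OF this]
  show "card {v \<in> X. v \<in> \<Union> (ends G ` K) \<and> r v \<notin> X \<and> s v} = card {e \<in> K. leaves G h e X}" by simp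
  have "bij_betw h {e \<in> K. e \<in> cut G X \<and> h e \<in> X} {v \<in> X. v \<in> \<Union> (ends G ` K) \<and> r v \<notin> X \<and> \<not> s v}"
    unfolding bij_betw_def
  proof (intro conjI inj_onI set_eqI iffI)
    fix e e' assume "e \<in> {e \<in> K. e \<in> cut G X \<and> h e \<in> X}" "e' \<in> {e \<in> K. e \<in> cut G X \<and> h e \<in> X}"
      "h e = h e'"
    then show "e = e'" using eq[of e e' "h e"] h[of e] h[of e'] by auto
  next
    fix v assume "v \<in> h ` {e \<in> K. e \<in> cut G X \<and> h e \<in> X}"
    then obtain e where e: "e \<in> K" "e \<in> cut G X" "h e \<in> X" "v = h e" by blast
    then show "v \<in> {v \<in> X. v \<in> \<Union> (ends G ` K) \<and> r v \<notin> X \<and> \<not> s v}"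
      using rh(1)[OF e(1)] s[OF e(1)] ends_in[OF e(1)] cutK[OF e(1)] by simp
  next
    fix v assume v: "v \<in> {v \<in> X. v \<in> \<Union> (ends G ` K) \<and> r v \<notin> X \<and> \<not> s v}"
    then obtain e where e: "e \<in> K" "v \<in> ends G e" by blast
    have "v = h e" using hv[OF e] s[OF e(1)] v by auto
    moreover have "e \<in> cut G X"
      using v rh(1)[OF e(1)] cutK[OF e(1)] calculation by simp
    ultimately show "v \<in> h ` {e \<in> K. e \<in> cut G X \<and> h e \<in> X}" using e v by blast
  qed
  from bij_betw_same_card[OF this]
  show "card {v \<in> X. v \<in> \<Union> (ends G ` K) \<and> r v \<notin> X \<and> \<not> s v} = card {e \<in> K. e \<in> cut G X \<and> h e \<in> X}" by simp
qed

text \<open>In-degrees and out-degrees are summed over \<open>X\<close>; an edge inside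
  \<open>X\<close> contributes once to either sum.\<close>

lemma balanced_cut:
  assumes C: "C \<subseteq> edges G" and h: "\<And>e. e \<in> C \<Longrightarrow> h e \<in> ends G e"
    and bal: "\<And>v. v \<in> vertices G \<Longrightarrow> card {e \<in> C. v \<in> ends G e \<and> h e = v} = card {e \<in> C. v \<in> ends G e \<and> h e \<noteq> v}"
    and X: "X \<subseteq> vertices G"
  shows "card {e \<in> C. leaves G h e X} = card {e \<in> C. e \<in> cut G X \<and> h e \<in> X}"
proof -
  have finC: "finite C" using finite_subset[OF C finite_edges] .
  have finX: "finite X" using finite_subset[OF X finite_vertices] .
  have CE: "e \<in> edges G" if "e \<in> C" for e using C that by auto
  note o = opp[OF CE h]
  have cutC: "e \<in> cut G X \<longleftrightarrow> (h e \<in> X) \<noteq> (opp G e (h e) \<in> X)" if "e \<in> C" for e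
    using mem_cut_opp[OF CE h] that by blast
  have "{e \<in> C. h e \<in> X} = (\<Union>v\<in>X. {e \<in> C. v \<in> ends G e \<and> h e = v})" using h by auto
  then have 1: "card {e \<in> C. h e \<in> X} = (\<Sum>v\<in>X. card {e \<in> C. v \<in> ends G e \<and> h e = v})"
    by (simp only:) (rule card_UN_disjoint, use finX finC in auto)
  have ne: "v \<in> ends G e \<and> h e \<noteq> v \<longleftrightarrow> v = opp G e (h e)" if "e \<in> C" for e v
    using o(1-3)[OF that that] by auto
  have ne': "{e \<in> C. v \<in> ends G e \<and> h e \<noteq> v} = {e \<in> C. v = opp G e (h e)}" for v
    using ne[of _ v] by blast
  have "{e \<in> C. opp G e (h e) \<in> X} = (\<Union>v\<in>X. {e \<in> C. v = opp G e (h e)})" by auto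
  then have 2: "card {e \<in> C. opp G e (h e) \<in> X} = (\<Sum>v\<in>X. card {e \<in> C. v \<in> ends G e \<and> h e \<noteq> v})"
    unfolding ne' by (simp only:) (rule card_UN_disjoint, use finX finC in auto)
  have "card {e \<in> C. h e \<in> X} = card {e \<in> C. opp G e (h e) \<in> X}"
    unfolding 1 2 using bal X by (intro sum.cong) auto
  moreover have "card {e \<in> C. h e \<in> X} =
      card {e \<in> C. h e \<in> X \<and> opp G e (h e) \<in> X} + card {e \<in> C. e \<in> cut G X \<and> h e \<in> X}"
    by (subst card_Un_disjoint[symmetric]) (use finC cutC in \<open>auto intro: arg_cong[where f = card]\<close>)
  moreover have "card {e \<in> C. opp G e (h e) \<in> X} =
      card {e \<in> C. h e \<in> X \<and> opp G e (h e) \<in> X} + card {e \<in> C. leaves G h e X}"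
    by (subst card_Un_disjoint[symmetric]) (use finC cutC in \<open>auto simp: leaves_def intro: arg_cong[where f = card]\<close>)
  ultimately show ?thesis by linarith
qed

end

context cubic_ess4
begin

text \<open>\<open>h0\<close> directs the cycles of the 2-factor and \<open>cc\<close> is constant
  on each of them. By injectivity every class of \<open>cc\<close> has at most one edge of
  \<open>\<Delta>\<close>, whose direction can be prescribed by reversing the class.\<close>

theorem perfect_matching_deletable:
  assumes M: "graph_matching M" "\<Union> (ends G ` M) = vertices G"
    and C: "C = edges G - M"
    and h0: "\<And>e. e \<in> C \<Longrightarrow> h0 e \<in> ends G e"
    and io: "\<And>v. v \<in> vertices G \<Longrightarrow> card {e \<in> C. v \<in> ends G e \<and> h0 e = v} = 1 \<and>
        card {e \<in> C. v \<in> ends G e \<and> h0 e \<noteq> v} = 1"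
    and cc: "\<And>e e' v. e \<in> C \<Longrightarrow> e' \<in> C \<Longrightarrow> v \<in> ends G e \<Longrightarrow> v \<in> ends G e' \<Longrightarrow> cc e = cc e'"
    and \<Delta>: "graph_matching \<Delta>" "\<Delta> \<subseteq> C" "inj_on cc \<Delta>"
  shows "\<exists>h. (\<forall>e\<in>edges G. h e \<in> ends G e) \<and> (\<forall>f\<in>M \<union> \<Delta>. deletable G h f)"
proof -
  let ?V = "vertices G" and ?E = "edges G"
  \<comment> \<open>One edge of \<open>M\<close> and two of the 2-factor meet at a vertex, so its
    star has weight 1 + 2 + 2 = 5, or 1 + 1 + 2 = 4 at an end of \<open>\<Delta>\<close>. Both
    satisfy the bound, and the odd vertices are exactly those that \<open>\<Delta>\<close>
    misses.\<close>
  define c where "c e = (if e \<in> M \<union> \<Delta> then 1 else 2 :: nat)" for e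
  have ME: "M \<subseteq> ?E" and DE: "\<Delta> \<subseteq> ?E" and CE: "C \<subseteq> ?E" and MC: "M \<inter> C = {}" "?E = M \<union> C"
    using M(1) C \<Delta> by (auto simp: graph_matching_def)
  have fin: "finite M" "finite \<Delta>" "finite C"
    using ME[THEN finite_subset] DE[THEN finite_subset] CE[THEN finite_subset] finite_edges by auto
  have endsV: "v \<in> ?V" if "e \<in> ?E" "v \<in> ends G e" for e v using ends_subset that by blast
  have one: "card {e \<in> K. v \<in> ends G e} = of_bool (v \<in> \<Union> (ends G ` K))" if K: "graph_matching K" for K v
  proof (cases "v \<in> \<Union> (ends G ` K)")
    case True
    then obtain e where e: "e \<in> K" "v \<in> ends G e" by blast
    have "{e \<in> K. v \<in> ends G e} = {e}" using e K unfolding graph_matching_def by blast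
    then show ?thesis using True by simp
  next
    case False
    then have "{e \<in> K. v \<in> ends G e} = {}" by blast
    then have "card {e \<in> K. v \<in> ends G e} = 0" by (simp only: card.empty)
    then show ?thesis using False by (simp only: of_bool_eq(1) not_False_eq_True)
  qed
  have csum: "sum c (cut G X) + card {e \<in> \<Delta>. e \<in> cut G X} =
      card {e \<in> M. e \<in> cut G X} + 2 * card {e \<in> C. e \<in> cut G X}" for X
  proof -
    have "cut G X = {e \<in> M. e \<in> cut G X} \<union> {e \<in> C. e \<in> cut G X}" using MC(2) cut_subset by blast
    then have "sum c (cut G X) = sum c ({e \<in> M. e \<in> cut G X} \<union> {e \<in> C. e \<in> cut G X})" by simp
    also have s1: "\<dots> = sum c {e \<in> M. e \<in> cut G X} + sum c {e \<in> C. e \<in> cut G X}"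
      by (rule sum.union_disjoint) (use fin MC in auto)
    also have "sum c {e \<in> M. e \<in> cut G X} = card {e \<in> M. e \<in> cut G X}" by (simp add: c_def)
    finally have s2: "sum c (cut G X) = card {e \<in> M. e \<in> cut G X} + sum c {e \<in> C. e \<in> cut G X}" .
    have "sum c {e \<in> C. e \<in> cut G X} + card {e \<in> \<Delta>. e \<in> cut G X} = 2 * card {e \<in> C. e \<in> cut G X}"
    proof -
      have "{e \<in> C. e \<in> cut G X} = {e \<in> \<Delta>. e \<in> cut G X} \<union> {e \<in> C - \<Delta>. e \<in> cut G X}" using \<Delta> by blast
      moreover have "sum c ({e \<in> \<Delta>. e \<in> cut G X} \<union> {e \<in> C - \<Delta>. e \<in> cut G X}) =
        sum c {e \<in> \<Delta>. e \<in> cut G X} + sum c {e \<in> C - \<Delta>. e \<in> cut G X}"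
        by (rule sum.union_disjoint) (use fin in auto)
      moreover have "card ({e \<in> \<Delta>. e \<in> cut G X} \<union> {e \<in> C - \<Delta>. e \<in> cut G X}) =
        card {e \<in> \<Delta>. e \<in> cut G X} + card {e \<in> C - \<Delta>. e \<in> cut G X}"
        by (rule card_Un_disjoint) (use fin in auto)
      moreover have "sum c {e \<in> \<Delta>. e \<in> cut G X} = card {e \<in> \<Delta>. e \<in> cut G X}" by (simp add: c_def)
      moreover have "sum c {e \<in> C - \<Delta>. e \<in> cut G X} = 2 * card {e \<in> C - \<Delta>. e \<in> cut G X}"
      proof -
        have "sum c {e \<in> C - \<Delta>. e \<in> cut G X} = (\<Sum>e\<in>{e \<in> C - \<Delta>. e \<in> cut G X}. 2)"
          by (rule sum.cong) (use MC in \<open>auto simp: c_def\<close>)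
        then show ?thesis by simp
      qed
      ultimately show ?thesis by simp
    qed
    with s2 show ?thesis by simp
  qed
  have C2: "card {e \<in> C. v \<in> ends G e} = 2" if v: "v \<in> ?V" for v
  proof -
    have "card {e \<in> C. v \<in> ends G e} = card ({e \<in> C. v \<in> ends G e \<and> h0 e = v} \<union> {e \<in> C. v \<in> ends G e \<and> h0 e \<noteq> v})"
      by (rule arg_cong[where f = card]) auto
    also have "\<dots> = 2" by (subst card_Un_disjoint) (use io[OF v] fin in auto)
    finally show ?thesis .
  qed
  have degc: "sum c (cut G {v}) + of_bool (v \<in> \<Union> (ends G ` \<Delta>)) = 5" if v: "v \<in> ?V" for v
  proof -
    have r: "{e \<in> K. e \<in> cut G {v}} = {e \<in> K. v \<in> ends G e}" if "K \<subseteq> ?E" for K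
      using that by (auto simp: cut_singleton)
    show ?thesis
      using csum[of "{v}"] one[OF M(1), of v] one[OF \<Delta>(1), of v] C2[OF v] v M(2)
      unfolding r[OF ME] r[OF DE] r[OF CE] by simp
  qed
  have ge4: "4 \<le> sum c (cut G X)" if X: "X \<subseteq> ?V" "separates ?V X" for X
  proof -
    have finX: "finite X" "finite (?V - X)" using X finite_vertices finite_subset by auto
    have single: "4 \<le> sum c (cut G {v})" if "v \<in> ?V" for v
      using degc[OF that] by (cases "v \<in> \<Union> (ends G ` \<Delta>)") auto
    have "card X \<noteq> 0" "card (?V - X) \<noteq> 0" using X finX by (auto simp: separates_def)
    then consider "card X = 1" | "card (?V - X) = 1" | "2 \<le> card X" "2 \<le> card (?V - X)" by linarith
    then show ?thesis
    proof cases
      case 1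
      then obtain v where "X = {v}" by (auto simp: card_1_singleton_iff)
      then show ?thesis using single X by simp
    next
      case 2
      then obtain v where v: "?V - X = {v}" by (auto simp: card_1_singleton_iff)
      then have "v \<in> ?V" by blast
      then show ?thesis using single[of v] v cut_compl[OF X(1)] by simp
    next
      case 3
      have "4 \<le> card (cut G X)" using card_cut_ge4[OF X(1) 3] .
      also have "card (cut G X) = (\<Sum>e\<in>cut G X. 1)" by simp
      also have "\<dots> \<le> sum c (cut G X)" by (rule sum_mono) (simp add: c_def)
      finally show ?thesis .
    qed
  qed
  define T where "T = {v \<in> ?V. odd (sum c (cut G {v}))}"
  have T: "T = ?V - \<Union> (ends G ` \<Delta>)"
  proof -
    have "odd (sum c (cut G {v})) \<longleftrightarrow> v \<notin> \<Union> (ends G ` \<Delta>)" if "v \<in> ?V" for v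
    proof (cases "v \<in> \<Union> (ends G ` \<Delta>)")
      case True
      then have "sum c (cut G {v}) = 4" using degc[OF that] by simp
      then show ?thesis using True by simp
    next
      case False
      then have "sum c (cut G {v}) = 5" using degc[OF that] by simp
      then show ?thesis using False by simp
    qed
    then show ?thesis unfolding T_def by blast
  qed
  obtain p where p: "involution_on T p"
    and pX: "\<forall>X\<subseteq>?V. separates ?V X \<longrightarrow>
      card {v \<in> X. odd (sum c (cut G {v})) \<and> p v \<notin> X} + 4 \<le> sum c (cut G X)"
    using pairing_edges[OF subset_refl ge4] unfolding T_def by blast
  define partner where "partner K v = opp G (SOME e. e \<in> K \<and> v \<in> ends G e) v" for K v
  have partner: "partner K v = opp G e v" if "graph_matching K" "e \<in> K" "v \<in> ends G e" for K e v
  proof -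
    have "(SOME e. e \<in> K \<and> v \<in> ends G e) = e"
      by (rule some_equality) (use that in \<open>unfold graph_matching_def, blast+\<close>)
    then show ?thesis by (simp add: partner_def)
  qed
  have partner_inv: "involution_on (\<Union> (ends G ` K)) (partner K)" if K: "graph_matching K" for K
    unfolding involution_on_def
  proof
    fix v assume "v \<in> \<Union> (ends G ` K)"
    then obtain e where e: "e \<in> K" "v \<in> ends G e" by blast
    then have eE: "e \<in> ?E" using K by (auto simp: graph_matching_def)
    note o = opp[OF eE e(2)]
    show "partner K v \<in> \<Union> (ends G ` K) \<and> partner K v \<noteq> v \<and> partner K (partner K v) = v"
      using o e partner[OF K e] partner[OF K e(1) o(3)] by auto
  qed
  \<comment> \<open>The pairing lives on the vertices that \<open>\<Delta>\<close> misses;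
    \<open>\<Delta>\<close> itself completes it to an involution of all vertices, to be played off
    against the one given by \<open>M\<close>.\<close>
  define R where "R v = (if v \<in> T then p v else partner \<Delta> v)" for v
  have DV: "\<Union> (ends G ` \<Delta>) \<subseteq> ?V" using DE ends_subset by blast
  have R: "involution_on ?V R"
    unfolding involution_on_def
  proof
    fix v assume v: "v \<in> ?V"
    show "R v \<in> ?V \<and> R v \<noteq> v \<and> R (R v) = v"
    proof (cases "v \<in> T")
      case True
      then show ?thesis using p T by (auto simp: R_def involution_on_def)
    next
      case False
      then have "v \<in> \<Union> (ends G ` \<Delta>)" using T v by blast
      then have "partner \<Delta> v \<in> \<Union> (ends G ` \<Delta>) \<and> partner \<Delta> v \<noteq> v \<and> partner \<Delta> (partner \<Delta> v) = v"
        using partner_inv[OF \<Delta>(1)] unfolding involution_on_def by blast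
      moreover from this have "partner \<Delta> v \<notin> T" using T by blast
      ultimately show ?thesis using False DV by (auto simp: R_def)
    qed
  qed
  define \<mu> where "\<mu> = partner M"
  have \<mu>: "involution_on ?V \<mu>" using partner_inv[OF M(1)] M(2) by (simp add: \<mu>_def)
  obtain s :: "'v \<Rightarrow> bool" where s: "\<And>v. v \<in> ?V \<Longrightarrow> s (\<mu> v) \<noteq> s v \<and> s (R v) \<noteq> s v"
    using two_involutions[OF finite_vertices \<mu> R] by blast
  have sM: "s (opp G e v) \<noteq> s v" if "e \<in> M" "v \<in> ends G e" for e v
    using s[of v] partner[OF M(1) that] that ME endsV[of e v] by (auto simp: \<mu>_def)
  have R\<Delta>: "R v = opp G e v" if "e \<in> \<Delta>" "v \<in> ends G e" for e v
    using partner[OF \<Delta>(1) that] that T by (auto simp: R_def)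
  have s\<Delta>: "s (opp G e v) \<noteq> s v" if "e \<in> \<Delta>" "v \<in> ends G e" for e v
    using s[of v] R\<Delta>[OF that] that DE endsV[of e v] by auto
  \<comment> \<open>Heads of edges in \<open>M \<union> \<Delta>\<close> are to have negative sign.
    For \<open>M\<close> this is a choice per edge; a class of \<open>cc\<close> is reversed as a
    whole if its edge of \<open>\<Delta>\<close> has a positive head under
    \<open>h0\<close>.\<close>
  define h where "h e = (if e \<in> M then (SOME v. v \<in> ends G e \<and> \<not> s v)
    else if \<exists>\<delta>\<in>\<Delta>. cc \<delta> = cc e \<and> s (h0 \<delta>) then opp G e (h0 e) else h0 e)" for e
  have hM: "h e \<in> ends G e \<and> \<not> s (h e)" if e: "e \<in> M" for e
  proof -
    have eE: "e \<in> ?E" using e ME by auto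
    obtain a where a: "a \<in> ends G e" using card_ends[OF eE] by fastforce
    have "\<exists>v. v \<in> ends G e \<and> \<not> s v" using sM[OF e a] a opp(3)[OF eE a] by blast
    then show ?thesis unfolding h_def using e someI_ex[of "\<lambda>v. v \<in> ends G e \<and> \<not> s v"] by simp
  qed
  have hC: "h e = h0 e \<or> h e = opp G e (h0 e)" if "e \<in> C" for e
    using that MC by (auto simp: h_def)
  have hCe: "h e \<in> ends G e" if "e \<in> C" for e
    using hC[OF that] h0[OF that] opp(3)[of e "h0 e"] that CE by auto
  have h\<Delta>: "\<not> s (h e)" if e: "e \<in> \<Delta>" for e
  proof -
    have eC: "e \<in> C" "e \<notin> M" using e \<Delta> MC by auto
    have "(\<exists>\<delta>\<in>\<Delta>. cc \<delta> = cc e \<and> s (h0 \<delta>)) \<longleftrightarrow> s (h0 e)"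
      using e \<Delta>(3) by (auto simp: inj_on_def)
    then show ?thesis using s\<Delta>[OF e h0[OF eC(1)]] eC by (auto simp: h_def)
  qed
  have hE: "h e \<in> ends G e" if "e \<in> ?E" for e using that MC(2) hM hCe by auto
  have bal: "card {e \<in> C. v \<in> ends G e \<and> h e = v} = card {e \<in> C. v \<in> ends G e \<and> h e \<noteq> v}"
    if v: "v \<in> ?V" for v
  proof -
    have flip: "h e = v \<longleftrightarrow> h0 e \<noteq> v" if "e \<in> C" "v \<in> ends G e" "h e \<noteq> h0 e" for e
    proof -
      have "h e = opp G e (h0 e)" using hC that by blast
      then show ?thesis using opp(1,2)[of e "h0 e"] h0[OF that(1)] that CE by auto
    qed
    have same: "h e = h0 e \<longleftrightarrow> h e' = h0 e'"
      if e: "e \<in> C" "e' \<in> C" "v \<in> ends G e" "v \<in> ends G e'" for e e'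
    proof -
      have "opp G e (h0 e) \<noteq> h0 e" "opp G e' (h0 e') \<noteq> h0 e'"
        using opp(2) h0 e CE by blast+
      then show ?thesis using cc[OF e] e MC by (auto simp: h_def)
    qed
    show ?thesis
    proof (cases "\<exists>e\<in>C. v \<in> ends G e \<and> h e \<noteq> h0 e")
      case True
      then have "h e = v \<longleftrightarrow> h0 e \<noteq> v" if "e \<in> C" "v \<in> ends G e" for e
        using flip[OF that] same that by blast
      then have "{e \<in> C. v \<in> ends G e \<and> h e = v} = {e \<in> C. v \<in> ends G e \<and> h0 e \<noteq> v}"
        "{e \<in> C. v \<in> ends G e \<and> h e \<noteq> v} = {e \<in> C. v \<in> ends G e \<and> h0 e = v}" by blast+
      then show ?thesis using io[OF v] by simp
    next
      case False
      then have "{e \<in> C. v \<in> ends G e \<and> h e = v} = {e \<in> C. v \<in> ends G e \<and> h0 e = v}"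
        "{e \<in> C. v \<in> ends G e \<and> h e \<noteq> v} = {e \<in> C. v \<in> ends G e \<and> h0 e \<noteq> v}" by auto
      then show ?thesis using io[OF v] by simp
    qed
  qed
  have "deletable G h f" if f: "f \<in> M \<union> \<Delta>" for f
    unfolding deletable_def
  proof (intro allI impI)
    fix X assume X: "X \<noteq> {}" "X \<subset> ?V"
    show "\<exists>e. e \<noteq> f \<and> leaves G h e X"
    proof (rule ccontr)
      assume "\<not> ?thesis"
      then have only: "e = f" if "leaves G h e X" for e using that by blast
      have XV: "X \<subseteq> ?V" and sepX: "separates ?V X" using X by (auto simp: separates_def)
      have finX: "finite X" using finite_subset[OF XV finite_vertices] .
      let ?out = "\<lambda>K. card {e \<in> K. leaves G h e X}"
      let ?in = "\<lambda>K. card {e \<in> K. e \<in> cut G X \<and> h e \<in> X}"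
      have crossing: "card {e \<in> K. e \<in> cut G X} = ?out K + ?in K" if "finite K" for K
        by (subst card_Un_disjoint[symmetric])
           (use that in \<open>auto simp: leaves_def intro: arg_cong[where f = card]\<close>)
      have Cio: "?out C = ?in C" by (rule balanced_cut[OF CE hCe bal XV])
      let ?Pp = "card {v \<in> X. v \<in> T \<and> p v \<notin> X \<and> s v}"
      let ?Pm = "card {v \<in> X. v \<in> T \<and> p v \<notin> X \<and> \<not> s v}"
      have P: "?Pp + ?Pm + 4 \<le> sum c (cut G X)"
      proof -
        have "?Pp + ?Pm = card {v \<in> X. odd (sum c (cut G {v})) \<and> p v \<notin> X}"
          by (subst card_Un_disjoint[symmetric])
             (use finX XV in \<open>auto simp: T_def intro: arg_cong[where f = card]\<close>)
        then show ?thesis using pX XV sepX by auto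
      qed
      have XM: "{v \<in> X. v \<in> \<Union> (ends G ` M) \<and> Q v} = {v \<in> X. Q v}" for Q
        using M(2) XV by auto
      have mM: "card {v \<in> X. \<mu> v \<notin> X \<and> s v} = ?out M" "card {v \<in> X. \<mu> v \<notin> X \<and> \<not> s v} = ?in M"
        using matching_crossing_count[OF M(1) XV, of \<mu> h s] partner[OF M(1)] hM sM
        unfolding XM \<mu>_def by blast+
      have h\<Delta>e: "h e \<in> ends G e" if "e \<in> \<Delta>" for e using hCe that \<Delta> by blast
      have m\<Delta>: "card {v \<in> X. v \<in> \<Union> (ends G ` \<Delta>) \<and> R v \<notin> X \<and> s v} = ?out \<Delta>"
        "card {v \<in> X. v \<in> \<Union> (ends G ` \<Delta>) \<and> R v \<notin> X \<and> \<not> s v} = ?in \<Delta>"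
        using matching_crossing_count[OF \<Delta>(1) XV, of R h s] R\<Delta> h\<Delta>e h\<Delta> s\<Delta> by blast+
      have Rsplit: "card {v \<in> X. R v \<notin> X \<and> Q v} = card {v \<in> X. v \<in> T \<and> p v \<notin> X \<and> Q v} +
          card {v \<in> X. v \<in> \<Union> (ends G ` \<Delta>) \<and> R v \<notin> X \<and> Q v}" for Q
      proof -
        have "v \<in> T \<longleftrightarrow> v \<notin> \<Union> (ends G ` \<Delta>)" if "v \<in> X" for v using T XV that by blast
        then have "{v \<in> X. R v \<notin> X \<and> Q v} = {v \<in> X. v \<in> T \<and> p v \<notin> X \<and> Q v} \<union>
          {v \<in> X. v \<in> \<Union> (ends G ` \<Delta>) \<and> R v \<notin> X \<and> Q v}"
          "{v \<in> X. v \<in> T \<and> p v \<notin> X \<and> Q v} \<inter> {v \<in> X. v \<in> \<Union> (ends G ` \<Delta>) \<and> R v \<notin> X \<and> Q v} = {}"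
          by (auto simp: R_def)
        then show ?thesis using finX by (simp add: card_Un_disjoint)
      qed
      have eqn: "?out M + (?Pm + ?in \<Delta>) = ?in M + (?Pp + ?out \<Delta>)"
        using signed_balance[OF finite_vertices \<mu> R s XV] unfolding mM Rsplit m\<Delta> .
      have w: "sum c (cut G X) + (?out \<Delta> + ?in \<Delta>) = (?out M + ?in M) + 2 * (?out C + ?in C)"
        using csum[of X] crossing fin by simp
      have le1: "card {e \<in> K. leaves G h e X} \<le> of_bool (f \<in> K)" for K
      proof (cases "f \<in> K")
        case True
        have "card {e \<in> K. leaves G h e X} \<le> card {f}" by (rule card_mono) (use only in auto)
        then show ?thesis using True by simp
      next
        case False
        then have "{e \<in> K. leaves G h e X} = {}" using only by blast
        then show ?thesis by (simp only: card.empty)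
      qed
      \<comment> \<open>Only \<open>f\<close> can leave \<open>X\<close>, and \<open>f\<close> is in
        \<open>M\<close> or in \<open>\<Delta>\<close>, so no edge of \<open>C - \<Delta>\<close>
        leaves \<open>X\<close>.\<close>
      have outD: "?out \<Delta> = ?out C"
      proof -
        have "{e \<in> \<Delta>. leaves G h e X} = {e \<in> C. leaves G h e X}" using only f \<Delta>(2) MC(1) by blast
        then show ?thesis by simp
      qed
      have out1: "?out M + ?out C \<le> 1"
      proof -
        have "\<not> (f \<in> M \<and> f \<in> C)" using MC(1) by blast
        then show ?thesis using le1[of M] le1[of C] by (cases "f \<in> M"; cases "f \<in> C") simp_all
      qed
      \<comment> \<open>Eliminating \<open>w\<close> and \<open>Pm\<close> yields
        \<open>2 * Pp + 4 \<le> 2 * (oM + cO)\<close>, contrary to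
        \<open>oM + cO \<le> 1\<close>.\<close>
      have "False" if e: "oM + (Pm + dI) = iM + (Pp + dO)" and w: "w + (dO + dI) = (oM + iM) + 2 * (cO + cI)"
        and P: "Pp + Pm + 4 \<le> w" and c: "cO = cI" "dO = cO" "oM + cO \<le> 1"
        for oM iM Pm Pp dI dO w cO cI :: nat
      proof -
        have w': "w + (cI + dI) = oM + iM + 4 * cI" using w c by simp
        have e': "oM + (Pm + dI) = iM + (Pp + cI)" using e c by simp
        have "Pp + Pm + 4 + cI + dI \<le> oM + iM + 4 * cI" using w' P by simp
        then have "Pp + (iM + (Pp + cI)) + 4 + cI \<le> oM + oM + iM + 4 * cI" using e' by linarith
        then show False using c by linarith
      qed
      from this[OF eqn w P Cio outD out1] show False .
    qed
  qed
  then show ?thesis using hE by blast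
qed

end

section \<open>From a perfect matching to three orientations\<close>

text \<open>A vertex \<open>v\<close> stands for the arc from \<open>v\<close> to
  \<open>\<sigma> v\<close>; \<open>c v\<close> is the base point of its orbit and
  \<open>k v\<close> its position counted from there. Odd and even positions form two classes,
  except that the last position of an orbit of odd length goes to \<open>\<Delta>\<close>: it is
  even, as is the position of its successor, the base point.\<close>

lemma permutation_classes:
  assumes fin: "finite V" and \<sigma>: "\<sigma> permutes V" and nofix: "\<forall>v\<in>V. \<sigma> v \<noteq> v"
  shows "\<exists>A B \<Delta> (c :: 'a \<Rightarrow> 'a). V = A \<union> B \<union> \<Delta> \<and> (\<forall>v. c (\<sigma> v) = c v) \<and> inj_on c \<Delta> \<and>
    (\<forall>v. (v \<in> A \<longrightarrow> \<sigma> v \<notin> A) \<and> (v \<in> B \<longrightarrow> \<sigma> v \<notin> B) \<and> (v \<in> \<Delta> \<longrightarrow> \<sigma> v \<notin> \<Delta>))"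
proof -
  have perm: "permutation \<sigma>" using fin \<sigma> permutation_permutes by blast
  have inj: "\<sigma> x = \<sigma> y \<longleftrightarrow> x = y" for x y using permutes_inj[OF \<sigma>] by (auto simp: inj_def)
  define c where "c v = (SOME x. x \<in> orbit \<sigma> v)" for v
  have c\<sigma>: "c (\<sigma> v) = c v" for v
    using permutation_orbit_step[OF perm] by (simp add: c_def)
  have cin: "c v \<in> orbit \<sigma> v" for v
    unfolding c_def using permutation_self_in_orbit[OF perm, of v] by (rule someI)
  have vin: "v \<in> orbit \<sigma> (c v)" for v
    by (rule orbit_swap[OF permutation_self_in_orbit[OF perm] cin])
  define k where "k v = (LEAST n. (\<sigma> ^^ n) (c v) = v)" for v
  have k: "(\<sigma> ^^ k v) (c v) = v" for v
  proof -
    obtain n where "v = (\<sigma> ^^ n) (c v)"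
      using vin[of v] unfolding orbit_altdef by blast
    from this[symmetric] show ?thesis unfolding k_def by (rule LeastI)
  qed
  have kle: "k v \<le> n" if "(\<sigma> ^^ n) (c v) = v" for v n
    unfolding k_def using that by (rule Least_le)
  have k0: "k (\<sigma> v) = 0" if "\<sigma> v = c v" for v
    using kle[of 0 "\<sigma> v"] c\<sigma>[of v] that[symmetric] by simp
  have kS: "k (\<sigma> v) = Suc (k v)" if "\<sigma> v \<noteq> c v" for v
  proof -
    have "k (\<sigma> v) \<le> Suc (k v)" by (rule kle) (simp add: c\<sigma> k)
    moreover have "Suc (k v) \<le> k (\<sigma> v)"
    proof (cases "k (\<sigma> v)")
      case 0
      then show ?thesis using k[of "\<sigma> v"] that c\<sigma> by simp
    next
      case (Suc m)
      then have "\<sigma> ((\<sigma> ^^ m) (c v)) = \<sigma> v" using k[of "\<sigma> v"] c\<sigma> by simp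
      then have "(\<sigma> ^^ m) (c v) = v" using inj by simp
      then show ?thesis using kle Suc by simp
    qed
    ultimately show ?thesis by simp
  qed
  let ?A = "{v \<in> V. odd (k v)}"
  let ?B = "{v \<in> V. even (k v) \<and> \<sigma> v \<noteq> c v}"
  let ?D = "{v \<in> V. even (k v) \<and> \<sigma> v = c v}"
  have V: "V = ?A \<union> ?B \<union> ?D" by auto
  have A: "\<sigma> v \<notin> ?A" if "v \<in> ?A" for v
    using that k0[of v] kS[of v] by (cases "\<sigma> v = c v") auto
  have B: "\<sigma> v \<notin> ?B" if "v \<in> ?B" for v
    using that kS[of v] by auto
  have D: "\<sigma> v \<notin> ?D" if "v \<in> ?D" for v
  proof
    assume "\<sigma> v \<in> ?D"
    then have "\<sigma> (\<sigma> v) = \<sigma> v" using that c\<sigma>[of v] by simp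
    then show False using inj nofix that by blast
  qed
  have injc: "inj_on c ?D"
  proof (rule inj_onI)
    fix u v assume "u \<in> ?D" "v \<in> ?D" "c u = c v"
    then have "\<sigma> u = \<sigma> v" by simp
    then show "u = v" using inj by blast
  qed
  show ?thesis
    by (intro exI[of _ ?A] exI[of _ ?B] exI[of _ ?D] exI[of _ c] conjI allI impI V c\<sigma> injc A B D)
qed

context fin_multigraph
begin

lemma graph_matching_card_le1:
  assumes "graph_matching K"
  shows "card {e \<in> K. v \<in> ends G e} \<le> 1"
proof -
  have "{e \<in> K. v \<in> ends G e} \<subseteq> {SOME e. e \<in> K \<and> v \<in> ends G e}"
  proof
    fix e assume e: "e \<in> {e \<in> K. v \<in> ends G e}"
    have "(SOME e. e \<in> K \<and> v \<in> ends G e) = e"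
      by (rule some_equality) (use e assms in \<open>unfold graph_matching_def, blast+\<close>)
    then show "e \<in> {SOME e. e \<in> K \<and> v \<in> ends G e}" by simp
  qed
  then have "card {e \<in> K. v \<in> ends G e} \<le> card {SOME e. e \<in> K \<and> v \<in> ends G e}"
    by (rule card_mono[rotated]) simp
  then show ?thesis by simp
qed

text \<open>Half-edges carry two involutions: exchanging the ends of an edge, and exchanging the two
  edges at a vertex. A sign reversed by both directs every edge and lets one edge enter and one
  leave each vertex, without a decomposition into cycles.\<close>

lemma two_regular_orientation:
  assumes C: "C \<subseteq> edges G" and deg: "\<And>v. v \<in> vertices G \<Longrightarrow> card {e \<in> C. v \<in> ends G e} = 2"
  shows "\<exists>h. (\<forall>e\<in>C. h e \<in> ends G e) \<and>
    (\<forall>v\<in>vertices G. card {e \<in> C. v \<in> ends G e \<and> h e = v} = 1 \<and>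
      card {e \<in> C. v \<in> ends G e \<and> h e \<noteq> v} = 1)"
proof -
  let ?V = "vertices G"
  define D where "D = {(e, v). e \<in> C \<and> v \<in> ends G e}"
  define \<alpha> where "\<alpha> = (\<lambda>(e, v). (e, opp G e v))"
  have CE: "e \<in> edges G" if "e \<in> C" for e using C that by blast
  have endsV: "v \<in> ?V" if "e \<in> C" "v \<in> ends G e" for e v using ends_subset[OF CE] that by blast
  have finD: "finite D"
    by (rule finite_subset[of _ "edges G \<times> ?V"])
       (use C endsV finite_edges finite_vertices in \<open>auto simp: D_def\<close>)
  have \<alpha>: "involution_on D \<alpha>"
    unfolding involution_on_def
  proof
    fix d assume "d \<in> D"
    then obtain e v where d: "d = (e, v)" "e \<in> C" "v \<in> ends G e" by (auto simp: D_def)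
    show "\<alpha> d \<in> D \<and> \<alpha> d \<noteq> d \<and> \<alpha> (\<alpha> d) = d"
      using opp[OF CE[OF d(2)] d(3)] d by (auto simp: \<alpha>_def D_def)
  qed
  let ?fib = "\<lambda>v. {d \<in> D. snd d = v}"
  have fib: "?fib v = (\<lambda>e. (e, v)) ` {e \<in> C. v \<in> ends G e}" for v by (auto simp: D_def)
  have inj: "inj_on (\<lambda>e. (e, v)) A" for v :: 'v and A :: "'e set" by (auto simp: inj_on_def)
  have "\<forall>v\<in>?V. \<exists>b. involution_on (?fib v) b"
  proof
    fix v assume v: "v \<in> ?V"
    have "even (card (?fib v))" unfolding fib using deg[OF v] card_image[OF inj] by simp
    then show "\<exists>b. involution_on (?fib v) b" using finD by (intro even_card_involution) simp_all
  qed
  from bchoice[OF this] obtain B where B: "\<forall>v\<in>?V. involution_on (?fib v) (B v)" by (elim exE)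
  have "involution_on (?fib v) (B v)" if "v \<in> snd ` D" for v using B that endsV by (auto simp: D_def)
  note \<beta> = fibrewise_involution[OF this]
  obtain s :: "'e \<times> 'v \<Rightarrow> bool" where
    s: "\<And>d. d \<in> D \<Longrightarrow> s (\<alpha> d) \<noteq> s d \<and> s (B (snd d) d) \<noteq> s d"
    using two_involutions[OF finD \<alpha> \<beta>(1)] by blast
  define h where "h e = (SOME v. v \<in> ends G e \<and> \<not> s (e, v))" for e
  have flip: "s (e, opp G e v) \<noteq> s (e, v)" if "e \<in> C" "v \<in> ends G e" for e v
    using s[of "(e, v)"] that by (auto simp: D_def \<alpha>_def)
  have h: "h e \<in> ends G e \<and> \<not> s (e, h e)" if e: "e \<in> C" for e
  proof -
    obtain a where a: "a \<in> ends G e" using card_ends[OF CE[OF e]] by fastforce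
    have "\<exists>v. v \<in> ends G e \<and> \<not> s (e, v)"
      using flip[OF e a] a opp(3)[OF CE[OF e] a] by blast
    then show ?thesis unfolding h_def by (rule someI_ex)
  qed
  have hiff: "h e = v \<longleftrightarrow> \<not> s (e, v)" if e: "e \<in> C" "v \<in> ends G e" for e v
  proof -
    have hv: "h e \<in> ends G e" "\<not> s (e, h e)" using h[OF e(1)] by auto
    have "v = h e \<or> v = opp G e (h e)" using opp(1)[OF CE[OF e(1)] hv(1)] e(2) by blast
    then show ?thesis using hv flip[OF e(1) hv(1)] opp(2)[OF CE[OF e(1)] hv(1)] by auto
  qed
  have "card {e \<in> C. v \<in> ends G e \<and> h e = v} = 1 \<and> card {e \<in> C. v \<in> ends G e \<and> h e \<noteq> v} = 1"
    if v: "v \<in> ?V" for v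
  proof -
    have c: "card {d \<in> ?fib v. s d} = card {d \<in> ?fib v. \<not> s d}"
      by (rule involution_card_eq[where a = "B v"])
         (use finD s \<beta> B v in \<open>auto simp: involution_on_def\<close>)
    have "{d \<in> ?fib v. \<not> s d} = (\<lambda>e. (e, v)) ` {e \<in> C. v \<in> ends G e \<and> h e = v}"
      "{d \<in> ?fib v. s d} = (\<lambda>e. (e, v)) ` {e \<in> C. v \<in> ends G e \<and> h e \<noteq> v}"
      using hiff by (auto simp: D_def)
    then have eq: "card {e \<in> C. v \<in> ends G e \<and> h e = v} = card {e \<in> C. v \<in> ends G e \<and> h e \<noteq> v}"
      using c card_image[OF inj] by simp
    have "{e \<in> C. v \<in> ends G e} = {e \<in> C. v \<in> ends G e \<and> h e = v} \<union> {e \<in> C. v \<in> ends G e \<and> h e \<noteq> v}"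
      by blast
    moreover have "finite C" using finite_subset[OF C finite_edges] .
    ultimately have "card {e \<in> C. v \<in> ends G e} =
        card {e \<in> C. v \<in> ends G e \<and> h e = v} + card {e \<in> C. v \<in> ends G e \<and> h e \<noteq> v}"
      by (simp only:) (rule card_Un_disjoint, auto)
    then show ?thesis using eq deg[OF v] by linarith
  qed
  then show ?thesis using h by blast
qed

end

context cubic_ess4
begin

text \<open>Each edge of the 2-factor is identified with its tail through \<open>out\<close>, so
  that the cycles become the orbits of \<open>\<sigma>\<close>. Two different edges share an end
  only if one tail is the \<open>\<sigma>\<close>-image of the other, so the classes of
  \<open>permutation_classes\<close> are matchings.\<close>

theorem frank_cover_of_perfect_matching:
  assumes M: "graph_matching M" "\<Union> (ends G ` M) = vertices G" and ne: "vertices G \<noteq> {}"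
  shows "frank_cover G 3"
proof -
  let ?V = "vertices G"
  define C where "C = edges G - M"
  have CE: "C \<subseteq> edges G" by (auto simp: C_def)
  have deg: "card {e \<in> C. v \<in> ends G e} = 2" if v: "v \<in> ?V" for v
  proof -
    have ME: "M \<subseteq> edges G" using M(1) by (simp add: graph_matching_def)
    obtain e0 where e0: "e0 \<in> M" "v \<in> ends G e0" using M(2) v by blast
    have "{e \<in> M. v \<in> ends G e} = {e0}" using e0 M(1) unfolding graph_matching_def by blast
    then have "{e \<in> edges G. v \<in> ends G e} = insert e0 {e \<in> C. v \<in> ends G e}"
      using ME e0 by (auto simp: C_def)
    moreover have "e0 \<notin> {e \<in> C. v \<in> ends G e}" "finite {e \<in> C. v \<in> ends G e}"
      using e0 finite_edges by (auto simp: C_def)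
    ultimately show ?thesis using card_incident[OF v] by simp
  qed
  obtain h0 where h0: "\<forall>e\<in>C. h0 e \<in> ends G e"
    and io: "\<forall>v\<in>?V. card {e \<in> C. v \<in> ends G e \<and> h0 e = v} = 1 \<and> card {e \<in> C. v \<in> ends G e \<and> h0 e \<noteq> v} = 1"
    using two_regular_orientation[OF CE deg] by blast
  have CE': "e \<in> edges G" if "e \<in> C" for e using CE that by blast
  note o = opp[OF CE' h0[rule_format]]
  have "\<forall>v\<in>?V. \<exists>e. {e \<in> C. v \<in> ends G e \<and> h0 e \<noteq> v} = {e}"
    using io by (auto simp: card_1_singleton_iff)
  from bchoice[OF this] obtain out where
    out: "\<forall>v\<in>?V. {e \<in> C. v \<in> ends G e \<and> h0 e \<noteq> v} = {out v}" by (elim exE)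
  have outC: "out v \<in> C" "v \<in> ends G (out v)" "h0 (out v) \<noteq> v" if "v \<in> ?V" for v
  proof -
    have "out v \<in> {e \<in> C. v \<in> ends G e \<and> h0 e \<noteq> v}" unfolding out[rule_format, OF that] by simp
    then show "out v \<in> C" "v \<in> ends G (out v)" "h0 (out v) \<noteq> v" by auto
  qed
  have out_tail: "opp G (out v) (h0 (out v)) = v" "ends G (out v) = {v, h0 (out v)}" if v: "v \<in> ?V" for v
    using outC[OF v] o(1)[OF outC(1)[OF v] outC(1)[OF v]] by auto
  have out_eq: "out (opp G e (h0 e)) = e" if e: "e \<in> C" for e
  proof -
    have t: "opp G e (h0 e) \<in> ?V" using o(5)[OF e e] .
    have "e \<in> {e' \<in> C. opp G e (h0 e) \<in> ends G e' \<and> h0 e' \<noteq> opp G e (h0 e)}"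
      using o(2,3)[OF e e] e by auto
    then have "e \<in> {out (opp G e (h0 e))}" unfolding out[rule_format, OF t] .
    then show ?thesis by simp
  qed
  have in_unique: "e = e'" if "e \<in> C" "e' \<in> C" "h0 e = h0 e'" for e e'
  proof -
    have v: "h0 e \<in> ?V" using ends_subset[OF CE'[OF that(1)]] h0 that(1) by blast
    then obtain a where a: "{x \<in> C. h0 e \<in> ends G x \<and> h0 x = h0 e} = {a}"
      using io by (auto simp: card_1_singleton_iff)
    have "e \<in> {x \<in> C. h0 e \<in> ends G x \<and> h0 x = h0 e}" "e' \<in> {x \<in> C. h0 e \<in> ends G x \<and> h0 x = h0 e}"
      using that h0 by auto
    then show ?thesis unfolding a by simp
  qed
  define \<sigma> where "\<sigma> v = (if v \<in> ?V then h0 (out v) else v)" for v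
  have \<sigma>V: "\<sigma> v \<in> ?V" if "v \<in> ?V" for v
    using that ends_subset[OF CE'[OF outC(1)[OF that]]] h0 outC(1)[OF that] by (auto simp: \<sigma>_def)
  have inj\<sigma>: "inj_on \<sigma> ?V"
  proof (rule inj_onI)
    fix u v assume uv: "u \<in> ?V" "v \<in> ?V" "\<sigma> u = \<sigma> v"
    then have e: "out u = out v" using in_unique outC(1) by (simp add: \<sigma>_def)
    show "u = v" using out_tail(1)[OF uv(1), symmetric] out_tail(1)[OF uv(2)] unfolding e by (rule trans)
  qed
  have perm: "\<sigma> permutes ?V"
  proof (rule bij_imp_permutes)
    show "bij_betw \<sigma> ?V ?V"
      using inj\<sigma> \<sigma>V endo_inj_surj[OF finite_vertices _ inj\<sigma>] by (auto simp: bij_betw_def)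
  qed (simp add: \<sigma>_def)
  have "\<forall>v\<in>?V. \<sigma> v \<noteq> v" using outC(3) by (simp add: \<sigma>_def)
  from permutation_classes[OF finite_vertices perm this] obtain A B \<Delta> and c :: "'v \<Rightarrow> 'v" where
    cls: "?V = A \<union> B \<union> \<Delta>" "\<forall>v. c (\<sigma> v) = c v" "inj_on c \<Delta>"
      "\<forall>v. (v \<in> A \<longrightarrow> \<sigma> v \<notin> A) \<and> (v \<in> B \<longrightarrow> \<sigma> v \<notin> B) \<and> (v \<in> \<Delta> \<longrightarrow> \<sigma> v \<notin> \<Delta>)"
    by (elim exE conjE)
  have match: "graph_matching (out ` S)" if S: "S \<subseteq> ?V" "\<And>v. v \<in> S \<Longrightarrow> \<sigma> v \<notin> S" for S
    unfolding graph_matching_def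
  proof (intro conjI ballI impI)
    show "out ` S \<subseteq> edges G" using outC(1) CE S(1) by blast
    fix e e' assume "e \<in> out ` S" "e' \<in> out ` S" "e \<noteq> e'"
    then obtain u v where uv: "u \<in> S" "v \<in> S" "e = out u" "e' = out v" "u \<noteq> v" by blast
    have V: "u \<in> ?V" "v \<in> ?V" using uv S by auto
    have "ends G e = {u, \<sigma> u}" "ends G e' = {v, \<sigma> v}"
      using out_tail(2) V uv by (simp_all add: \<sigma>_def)
    moreover have "\<sigma> u \<noteq> \<sigma> v" using inj\<sigma> V uv(5) by (auto simp: inj_on_def)
    moreover have "\<sigma> u \<noteq> v" "\<sigma> v \<noteq> u" using S(2) uv by auto
    ultimately show "ends G e \<inter> ends G e' = {}" using uv(5) by auto
  qed
  have mA: "graph_matching (out ` A)" and mB: "graph_matching (out ` B)" and mD: "graph_matching (out ` \<Delta>)"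
    using cls by (auto intro!: match)
  define cc where "cc e = c (opp G e (h0 e))" for e
  have ccv: "c v = cc e" if e: "e \<in> C" "v \<in> ends G e" for e v
  proof -
    let ?t = "opp G e (h0 e)"
    have "\<sigma> ?t = h0 e" using out_eq[OF e(1)] o(5)[OF e(1) e(1)] by (simp add: \<sigma>_def)
    then have "c (h0 e) = c ?t" using cls(2)[rule_format, of ?t] by simp
    then show ?thesis using o(1)[OF e(1) e(1)] e(2) by (auto simp: cc_def)
  qed
  have DC: "out ` \<Delta> \<subseteq> C" using outC(1) cls(1) by blast
  have "cc (out v) = c v" if "v \<in> ?V" for v using out_tail(1)[OF that] by (simp add: cc_def)
  then have injD: "inj_on cc (out ` \<Delta>)"
    using cls(1,3) by (auto simp: inj_on_def)
  have share: "cc e = cc e'" if "e \<in> C" "e' \<in> C" "v \<in> ends G e" "v \<in> ends G e'" for e e' v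
    using ccv[OF that(1,3)] ccv[OF that(2,4)] by simp
  have "\<exists>h. (\<forall>e\<in>edges G. h e \<in> ends G e) \<and> (\<forall>f\<in>M \<union> out ` \<Delta>. deletable G h f)"
    by (rule perfect_matching_deletable[OF M C_def _ _ _ mD DC injD, of h0])
       (fact h0[rule_format], fact io[rule_format], fact share)
  then obtain h1 where h1: "\<forall>e\<in>edges G. h1 e \<in> ends G e" "\<forall>f\<in>M \<union> out ` \<Delta>. deletable G h1 f"
    by blast
  have "out ` A \<subseteq> edges G" "out ` B \<subseteq> edges G"
    using mA mB by (simp_all add: graph_matching_def)
  note sub = this
  obtain h2 where h2: "\<forall>e\<in>edges G. h2 e \<in> ends G e" "\<forall>f\<in>out ` A. deletable G h2 f"
    using matching_deletable[OF graph_matching_card_le1[OF mA] sub(1)] by blast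
  obtain h3 where h3: "\<forall>e\<in>edges G. h3 e \<in> ends G e" "\<forall>f\<in>out ` B. deletable G h3 f"
    using matching_deletable[OF graph_matching_card_le1[OF mB] sub(2)] by blast
  have cover: "edges G = (M \<union> out ` \<Delta>) \<union> out ` A \<union> out ` B"
  proof -
    have "C \<subseteq> out ` ?V" 
    proof
      fix e assume e: "e \<in> C"
      show "e \<in> out ` ?V" 
        by (rule image_eqI[where x = "opp G e (h0 e)"]) (simp_all add: out_eq[OF e] o(5)[OF e e])
    qed
    then have "C = out ` ?V" using outC(1) by blast
    moreover have "M \<subseteq> edges G" using M(1) by (simp add: graph_matching_def)
    then have "edges G = M \<union> C" by (auto simp: C_def)
    ultimately show ?thesis using cls(1) by (simp add: image_Un Un_ac)
  qed
  define H where "H i = (if i = 0 then h1 else if i = Suc 0 then h2 else h3)" for i :: nat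
  show ?thesis
  proof (rule frank_cover_deletable[OF fin_multigraph_axioms ne])
    show "H i e \<in> ends G e" if "e \<in> edges G" for i e
      using that h1(1) h2(1) h3(1) by (simp add: H_def)
    fix e assume "e \<in> edges G"
    then consider "e \<in> M \<union> out ` \<Delta>" | "e \<in> out ` A" | "e \<in> out ` B" using cover by blast
    then show "\<exists>i<3. deletable G (H i) e"
    proof cases
      case 1
      then show ?thesis using h1(2) by (intro exI[of _ 0]) (auto simp: H_def)
    next
      case 2
      then show ?thesis using h2(2) by (intro exI[of _ 1]) (auto simp: H_def)
    next
      case 3
      then show ?thesis using h3(2) by (intro exI[of _ 2]) (auto simp: H_def)
    qed
  qed
qed

end

section \<open>Petersen's theorem\<close>

text \<open>A matching is encoded as an involution whose fixpoints are the vertices it misses.\<close>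

definition gmatching :: "('a \<Rightarrow> 'a \<Rightarrow> bool) \<Rightarrow> 'a set \<Rightarrow> ('a \<Rightarrow> 'a) \<Rightarrow> bool" where
  "gmatching adj V m \<longleftrightarrow> (\<forall>v\<in>V. m v \<in> V \<and> m (m v) = v \<and> (m v \<noteq> v \<longrightarrow> adj v (m v)))"

definition missed :: "'a set \<Rightarrow> ('a \<Rightarrow> 'a) \<Rightarrow> 'a set" where
  "missed V m = {v \<in> V. m v = v}"

section \<open>Maximum matchings and Gallai's lemma\<close>

definition max_gmatching :: "('a \<Rightarrow> 'a \<Rightarrow> bool) \<Rightarrow> 'a set \<Rightarrow> ('a \<Rightarrow> 'a) \<Rightarrow> bool" where
  "max_gmatching adj V m \<longleftrightarrow> gmatching adj V m \<and>
    (\<forall>m'. gmatching adj V m' \<longrightarrow> card (missed V m) \<le> card (missed V m'))"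

lemma gmatching_id: "gmatching adj V (\<lambda>v. v)"
  by (simp add: gmatching_def)

lemma max_gmatching_exists: "\<exists>m. max_gmatching adj V m"
  using ex_has_least_nat[of "gmatching adj V" "\<lambda>v. v" "\<lambda>m. card (missed V m)"] gmatching_id[of adj V]
  unfolding max_gmatching_def by blast

lemma even_card_of_involution:
  assumes "finite D" "involution_on D a"
  shows "even (card D)"
proof -
  obtain s :: "'a \<Rightarrow> bool" where s: "\<forall>x\<in>D. s (a x) \<noteq> s x"
    using two_involutions[OF assms assms(2)] by blast
  have "card {x \<in> D. s x} = card {x \<in> D. \<not> s x}"
    by (rule involution_card_eq[where a = a]) (use assms s in \<open>auto simp: involution_on_def\<close>)
  moreover have "card D = card {x \<in> D. s x} + card {x \<in> D. \<not> s x}"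
    by (subst card_Un_disjoint[symmetric]) (use assms in \<open>auto intro: arg_cong[where f = card]\<close>)
  ultimately show ?thesis by simp
qed

lemma even_card_missed:
  assumes "finite V" "gmatching adj V m"
  shows "even (card (missed V m)) \<longleftrightarrow> even (card V)"
proof -
  have "card V = card (missed V m) + card (V - missed V m)"
    by (subst card_Un_disjoint[symmetric]) (use assms in \<open>auto simp: missed_def intro: arg_cong[where f = card]\<close>)
  moreover have "involution_on (V - missed V m) m"
    using assms(2) by (auto simp: involution_on_def gmatching_def missed_def)
  then have "even (card (V - missed V m))" using assms(1) by (intro even_card_of_involution) simp_all
  ultimately show ?thesis by simp
qed

lemma not_adj_missed:
  assumes fin: "finite V" and sym: "\<And>x y. adj x y \<Longrightarrow> adj y x"
    and m: "max_gmatching adj V m" and x: "x \<in> missed V m" and y: "y \<in> missed V m" and "x \<noteq> y"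
  shows "\<not> adj x y"
proof
  assume a: "adj x y"
  let ?m = "m(x := y, y := x)"
  have g: "gmatching adj V m" using m by (simp add: max_gmatching_def)
  have xy: "x \<in> V" "y \<in> V" "m x = x" "m y = y" using x y by (auto simp: missed_def)
  have "gmatching adj V ?m"
    unfolding gmatching_def
  proof
    fix v assume v: "v \<in> V"
    have mv: "m v \<in> V" "m (m v) = v" "m v \<noteq> v \<longrightarrow> adj v (m v)" using g v by (auto simp: gmatching_def)
    show "?m v \<in> V \<and> ?m (?m v) = v \<and> (?m v \<noteq> v \<longrightarrow> adj v (?m v))"
    proof (cases "v = x \<or> v = y")
      case True
      then show ?thesis using xy a sym[OF a] assms(6) by auto
    next
      case False
      then have "m v \<noteq> x" "m v \<noteq> y" using mv(2) xy by auto
      then show ?thesis using False mv by simp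
    qed
  qed
  then have "card (missed V m) \<le> card (missed V ?m)" using m by (simp add: max_gmatching_def)
  moreover have "missed V ?m \<subset> missed V m"
    using x assms(6) by (auto simp: missed_def)
  moreover have "finite (missed V m)" using fin by (simp add: missed_def)
  ultimately show False using psubset_card_mono by (metis not_less)
qed

text \<open>
  The step of Gallai's lemma: if \<open>N\<close> misses \<open>u\<close> and \<open>w\<close> while \<open>N'\<close> misses \<open>v\<close>, exchanging one edge of
  \<open>N'\<close> increases its overlap with \<open>N\<close>.
\<close>

lemma gallai_step:
  assumes fin: "finite V" and sym: "\<And>x y. adj x y \<Longrightarrow> adj y x"
    and N: "max_gmatching adj V N" and N': "max_gmatching adj V N'"
    and v: "v \<in> missed V N'" "v \<notin> missed V N"
    and u: "u \<in> missed V N" "u \<notin> missed V N'" and w: "w \<in> missed V N" "w \<notin> missed V N'" and "u \<noteq> w"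
  shows "\<exists>N''. max_gmatching adj V N'' \<and> v \<in> missed V N'' \<and>
    card {x \<in> V. N x = N' x \<and> N x \<noteq> x} < card {x \<in> V. N x = N'' x \<and> N x \<noteq> x}"
proof -
  have g: "gmatching adj V N" and g': "gmatching adj V N'" using N N' by (auto simp: max_gmatching_def)
  have finm: "finite (missed V m)" for m using fin by (simp add: missed_def)
  have ceq: "card (missed V N) = card (missed V N')"
    using N N' by (auto simp: max_gmatching_def intro: antisym)
  \<comment> \<open>Both matchings miss equally many vertices, and \<open>u\<close> and
    \<open>w\<close> are missed by \<open>N\<close> only, so at least two vertices are missed by
    \<open>N'\<close> only.\<close>
  have "\<exists>x\<in>missed V N' - missed V N. x \<noteq> v"
  proof (rule ccontr)
    assume "\<not> ?thesis"
    then have s: "missed V N' - missed V N \<subseteq> {v}" by blast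
    have "card (missed V N') = card (missed V N' - missed V N) + card (missed V N' \<inter> missed V N)"
      by (subst card_Un_disjoint[symmetric]) (use finm in \<open>auto intro: arg_cong[where f = card]\<close>)
    moreover have "card (missed V N) = card (missed V N - missed V N') + card (missed V N' \<inter> missed V N)"
      by (subst card_Un_disjoint[symmetric]) (use finm in \<open>auto intro: arg_cong[where f = card]\<close>)
    moreover have "card (missed V N' - missed V N) \<le> 1" using card_mono[OF _ s] by simp
    moreover have "2 \<le> card (missed V N - missed V N')"
      by (rule two_le_card[of _ u w]) (use u w \<open>u \<noteq> w\<close> finm in auto)
    ultimately show False using ceq by linarith
  qed
  then obtain x where x: "x \<in> missed V N'" "x \<notin> missed V N" "x \<noteq> v" by blast
  have xV: "x \<in> V" "N' x = x" "N x \<noteq> x" using x by (auto simp: missed_def)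
  define y where "y = N x"
  have y: "y \<in> V" "N y = x" "y \<noteq> x" "adj x y" using g xV by (auto simp: gmatching_def y_def)
  have "y \<notin> missed V N'"
  proof
    assume "y \<in> missed V N'"
    from not_adj_missed[OF fin sym N' x(1) this] y(3,4) show False by simp
  qed
  then have y': "N' y \<noteq> y" using y by (simp add: missed_def)
  define z where "z = N' y"
  have z: "z \<in> V" "N' z = y" "z \<noteq> y" using g' y y' by (auto simp: gmatching_def z_def)
  have zx: "z \<noteq> x" using z xV y by auto
  \<comment> \<open>The edge \<open>yz\<close> of \<open>N'\<close> is exchanged for the edge
    \<open>xy\<close> of \<open>N\<close>: \<open>z\<close> is missed instead of \<open>x\<close>,
    and no common edge is lost, because \<open>N\<close> matches \<open>y\<close> with
    \<open>x\<close>.\<close>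
  let ?N = "N'(z := z, y := x, x := y)"
  have gN: "gmatching adj V ?N"
    unfolding gmatching_def
  proof
    fix a assume a: "a \<in> V"
    have Na: "N' a \<in> V" "N' (N' a) = a" "N' a \<noteq> a \<longrightarrow> adj a (N' a)" using g' a by (auto simp: gmatching_def)
    show "?N a \<in> V \<and> ?N (?N a) = a \<and> (?N a \<noteq> a \<longrightarrow> adj a (?N a))"
    proof (cases "a = x \<or> a = y \<or> a = z")
      case True
      then show ?thesis using xV y z zx sym[OF y(4)] by auto
    next
      case False
      then have "N' a \<noteq> x" "N' a \<noteq> y" "N' a \<noteq> z"
        using Na(2) xV z by (auto simp: z_def)
      then show ?thesis using False Na by simp
    qed
  qed
  have "missed V ?N = insert z (missed V N' - {x})"
    using xV y z zx y' by (auto simp: missed_def)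
  moreover have "z \<notin> missed V N'" using z by (simp add: missed_def)
  ultimately have "card (missed V ?N) = card (missed V N')"
    using card.remove[OF finm x(1)] finm[of N'] by simp
  then have mN: "max_gmatching adj V ?N" using gN N' by (simp add: max_gmatching_def)
  have vN: "v \<in> missed V ?N"
  proof -
    have "v \<noteq> y" "v \<noteq> z" using v(1) y' z by (auto simp: missed_def)
    then show ?thesis using v(1) x(3) by (auto simp: missed_def)
  qed
  have "{a \<in> V. N a = N' a \<and> N a \<noteq> a} \<subset> {a \<in> V. N a = ?N a \<and> N a \<noteq> a}"
  proof (rule psubsetI)
    show "{a \<in> V. N a = N' a \<and> N a \<noteq> a} \<subseteq> {a \<in> V. N a = ?N a \<and> N a \<noteq> a}"
    proof
      fix a assume a: "a \<in> {a \<in> V. N a = N' a \<and> N a \<noteq> a}"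
      have "a \<noteq> x" using a xV by auto
      moreover have "a \<noteq> y" using a y(2) zx by (auto simp: z_def)
      moreover have "a \<noteq> z"
      proof
        assume "a = z"
        then have "N z = y" using a z by simp
        then have "N y = z" using g z(1) by (auto simp: gmatching_def)
        then show False using y(2) zx by simp
      qed
      ultimately show "a \<in> {a \<in> V. N a = ?N a \<and> N a \<noteq> a}" using a by auto
    qed
    have "x \<in> {a \<in> V. N a = ?N a \<and> N a \<noteq> a}" using xV by (simp add: y_def)
    moreover have "x \<notin> {a \<in> V. N a = N' a \<and> N a \<noteq> a}" using xV by simp
    ultimately show "{a \<in> V. N a = N' a \<and> N a \<noteq> a} \<noteq> {a \<in> V. N a = ?N a \<and> N a \<noteq> a}" by blast
  qed
  then have "card {a \<in> V. N a = N' a \<and> N a \<noteq> a} < card {a \<in> V. N a = ?N a \<and> N a \<noteq> a}"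
    using fin by (intro psubset_card_mono) auto
  then show ?thesis using mN vN by (intro exI[of _ ?N] conjI)
qed

text \<open>Among the maximum matchings that miss \<open>v\<close>, one with the largest overlap
  with \<open>m\<close> is taken. It covers \<open>u\<close> and \<open>w\<close>; if
  \<open>m\<close> missed both of them, \<open>gallai_step\<close> would enlarge the
  overlap.\<close>

lemma gallai_transitive:
  assumes fin: "finite V" and sym: "\<And>x y. adj x y \<Longrightarrow> adj y x"
    and v: "\<exists>m. max_gmatching adj V m \<and> v \<in> missed V m"
    and uv: "\<And>m. max_gmatching adj V m \<Longrightarrow> \<not> (u \<in> missed V m \<and> v \<in> missed V m)"
    and vw: "\<And>m. max_gmatching adj V m \<Longrightarrow> \<not> (v \<in> missed V m \<and> w \<in> missed V m)"
    and "u \<noteq> w" and m: "max_gmatching adj V m"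
  shows "\<not> (u \<in> missed V m \<and> w \<in> missed V m)"
proof
  assume uw: "u \<in> missed V m \<and> w \<in> missed V m"
  let ?P = "\<lambda>k. \<exists>m'. max_gmatching adj V m' \<and> v \<in> missed V m' \<and> k = card {x \<in> V. m x = m' x \<and> m x \<noteq> x}"
  have b: "k \<le> card V" if P: "?P k" for k
  proof -
    obtain m' where "k = card {x \<in> V. m x = m' x \<and> m x \<noteq> x}" using P by blast
    then show ?thesis using fin card_mono[of V "{x \<in> V. m x = m' x \<and> m x \<noteq> x}"] by auto
  qed
  have "\<exists>k. ?P k" using v by blast
  then obtain k where k: "?P k" "\<And>j. ?P j \<Longrightarrow> j \<le> k"
    using Nat.ex_has_greatest_nat[of ?P _ "card V"] b by blast
  then obtain m' where m': "max_gmatching adj V m'" "v \<in> missed V m'"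
    "k = card {x \<in> V. m x = m' x \<and> m x \<noteq> x}" by blast
  have "v \<notin> missed V m" "u \<notin> missed V m'" "w \<notin> missed V m'" using uv vw m uw m' by blast+
  from gallai_step[OF fin sym m m'(1,2) this(1) _ this(2) _ this(3) \<open>u \<noteq> w\<close>] uw
  obtain N'' where "max_gmatching adj V N''" "v \<in> missed V N''"
    "k < card {x \<in> V. m x = N'' x \<and> m x \<noteq> x}" unfolding m'(3) by blast
  then have "?P (card {x \<in> V. m x = N'' x \<and> m x \<noteq> x})" "k < card {x \<in> V. m x = N'' x \<and> m x \<noteq> x}"
    by blast+
  then show False using k(2) by (simp add: leD)
qed

text \<open>The inequality of the Tutte-Berge formula that matters for the existence of large
  matchings, with its witnesses. The odd sets are closed under adjacency outside \<open>U\<close>,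
  that is, unions of components of the graph without \<open>U\<close>.\<close>

definition berge_certificate where
  "berge_certificate adj V m U \<O> \<longleftrightarrow> gmatching adj V m \<and> U \<subseteq> V \<and> disjoint \<O> \<and> \<O> \<subseteq> Pow (V - U) \<and>
    (\<forall>Q\<in>\<O>. odd (card Q) \<and> (\<forall>x\<in>Q. \<forall>y\<in>V - U. adj x y \<longrightarrow> y \<in> Q)) \<and>
    card (missed V m) + card U \<le> card \<O>"

text \<open>A disconnected graph combines the certificates of two parts. A vertex covered by every
  maximum matching is removed and joins \<open>U\<close>. Otherwise Gallai's lemma shows that a
  maximum matching misses at most one vertex, and if it misses one, \<open>V\<close> itself is the
  odd set.\<close>

theorem tutte_berge:
  assumes "finite V" and sym: "\<And>x y. adj x y \<Longrightarrow> adj y x"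
  shows "\<exists>m U \<O>. berge_certificate adj V m U \<O>"
  using assms(1)
proof (induct "card V" arbitrary: V rule: less_induct)
  case (less V)
  note fin = less.prems
  have finm: "finite (missed V m)" for m using fin by (simp add: missed_def)
  consider (split) A where "A \<subseteq> V" "A \<noteq> {}" "A \<noteq> V" "\<forall>x\<in>A. \<forall>y\<in>V - A. \<not> adj x y"
    | (essential) v where "v \<in> V" "\<forall>m. max_gmatching adj V m \<longrightarrow> v \<notin> missed V m"
    | (critical) "\<forall>A\<subseteq>V. A \<noteq> {} \<longrightarrow> A \<noteq> V \<longrightarrow> (\<exists>x\<in>A. \<exists>y\<in>V - A. adj x y)"
        "\<forall>v\<in>V. \<exists>m. max_gmatching adj V m \<and> v \<in> missed V m"
    by meson
  then show ?case
  proof cases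
    case split
    let ?B = "V - A"
    have finAB: "finite A" "finite ?B" using split(1) fin finite_subset by auto
    have "card A < card V" "card ?B < card V"
      using split fin by (auto intro!: psubset_card_mono)
    then obtain mA UA \<O>A mB UB \<O>B where
      cA: "berge_certificate adj A mA UA \<O>A" and cB: "berge_certificate adj ?B mB UB \<O>B"
      using less.hyps finAB by meson
    have a: "gmatching adj A mA" "UA \<subseteq> A" "disjoint \<O>A" "\<O>A \<subseteq> Pow (A - UA)"
      "\<forall>Q\<in>\<O>A. odd (card Q) \<and> (\<forall>x\<in>Q. \<forall>y\<in>A - UA. adj x y \<longrightarrow> y \<in> Q)"
      "card (missed A mA) + card UA \<le> card \<O>A"
      using cA unfolding berge_certificate_def by blast+
    have b: "gmatching adj ?B mB" "UB \<subseteq> ?B" "disjoint \<O>B" "\<O>B \<subseteq> Pow (?B - UB)"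
      "\<forall>Q\<in>\<O>B. odd (card Q) \<and> (\<forall>x\<in>Q. \<forall>y\<in>?B - UB. adj x y \<longrightarrow> y \<in> Q)"
      "card (missed ?B mB) + card UB \<le> card \<O>B"
      using cB unfolding berge_certificate_def by blast+
    let ?m = "\<lambda>v. if v \<in> A then mA v else mB v"
    have "gmatching adj V ?m"
      unfolding gmatching_def
    proof
      fix v assume v: "v \<in> V"
      show "?m v \<in> V \<and> ?m (?m v) = v \<and> (?m v \<noteq> v \<longrightarrow> adj v (?m v))"
      proof (cases "v \<in> A")
        case True
        then have "mA v \<in> A \<and> mA (mA v) = v \<and> (mA v \<noteq> v \<longrightarrow> adj v (mA v))"
          using a(1) unfolding gmatching_def by blast
        then show ?thesis using True split(1) by auto
      next
        case False
        then have "mB v \<in> ?B \<and> mB (mB v) = v \<and> (mB v \<noteq> v \<longrightarrow> adj v (mB v))"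
          using b(1) v unfolding gmatching_def by blast
        then show ?thesis using False by auto
      qed
    qed
    moreover have "disjoint (\<O>A \<union> \<O>B)"
    proof (rule disjoint_union)
      have "\<Union>\<O>A \<subseteq> A" "\<Union>\<O>B \<subseteq> ?B" using a(4) b(4) by blast+
      then show "\<Union>\<O>A \<inter> \<Union>\<O>B = {}" by blast
      show "disjoint \<O>A" "disjoint \<O>B" using a b by simp_all
    qed
    moreover have "card (missed V ?m) + card (UA \<union> UB) \<le> card (\<O>A \<union> \<O>B)"
    proof -
      have f: "finite \<O>A" "finite \<O>B"
        using finite_subset[OF a(4)] finite_subset[OF b(4)] finAB by simp_all
      have "missed V ?m = missed A mA \<union> missed ?B mB" using split(1) by (auto simp: missed_def)
      then have "card (missed V ?m) \<le> card (missed A mA) + card (missed ?B mB)"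
        using card_Un_le by simp
      moreover have "card (UA \<union> UB) \<le> card UA + card UB" by (rule card_Un_le)
      moreover have "\<O>A \<inter> \<O>B = {}"
      proof (rule ccontr)
        assume "\<O>A \<inter> \<O>B \<noteq> {}"
        then obtain Q where Q: "Q \<in> \<O>A" "Q \<in> \<O>B" by blast
        then have "Q \<subseteq> A" "Q \<subseteq> ?B" using a(4) b(4) by blast+
        then have "Q = {}" by blast
        moreover have "odd (card Q)" using a(5) Q(1) by blast
        ultimately show False by simp
      qed
      then have "card (\<O>A \<union> \<O>B) = card \<O>A + card \<O>B" using f by (rule card_Un_disjoint[rotated 2])
      ultimately show ?thesis using a(6) b(6) by linarith
    qed
    moreover have "odd (card Q) \<and> (\<forall>x\<in>Q. \<forall>y\<in>V - (UA \<union> UB). adj x y \<longrightarrow> y \<in> Q)"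
      if Q: "Q \<in> \<O>A \<union> \<O>B" for Q
    proof -
      from Q show ?thesis
      proof
        assume "Q \<in> \<O>A"
        then have "odd (card Q)" "Q \<subseteq> A" "\<forall>x\<in>Q. \<forall>y\<in>A - UA. adj x y \<longrightarrow> y \<in> Q" using a(4,5) by blast+
        then show ?thesis using split(4) by blast
      next
        assume "Q \<in> \<O>B"
        then have "odd (card Q)" "Q \<subseteq> ?B" "\<forall>x\<in>Q. \<forall>y\<in>?B - UB. adj x y \<longrightarrow> y \<in> Q" using b(4,5) by blast+
        then show ?thesis using split(4) sym by blast
      qed
    qed
    moreover have "UA \<union> UB \<subseteq> V" "\<O>A \<union> \<O>B \<subseteq> Pow (V - (UA \<union> UB))"
      using a(2,4) b(2,4) split(1) by blast+
    ultimately have "berge_certificate adj V ?m (UA \<union> UB) (\<O>A \<union> \<O>B)"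
      unfolding berge_certificate_def by blast
    then show ?thesis by blast
  next
    case essential
    let ?W = "V - {v}"
    have "card ?W < card V" using essential(1) fin by (intro psubset_card_mono) auto
    then obtain m' U \<O> where c: "berge_certificate adj ?W m' U \<O>" using less.hyps fin by blast
    have c': "gmatching adj ?W m'" "U \<subseteq> ?W" "disjoint \<O>" "\<O> \<subseteq> Pow (?W - U)"
      "\<forall>Q\<in>\<O>. odd (card Q) \<and> (\<forall>x\<in>Q. \<forall>y\<in>?W - U. adj x y \<longrightarrow> y \<in> Q)"
      "card (missed ?W m') + card U \<le> card \<O>"
      using c unfolding berge_certificate_def by blast+
    obtain m where m: "max_gmatching adj V m" using max_gmatching_exists by blast
    then have gm: "gmatching adj V m" by (simp add: max_gmatching_def)
    let ?m = "m'(v := v)"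
    have g: "gmatching adj V ?m" using c'(1) unfolding gmatching_def by auto
    have ms: "missed V ?m = insert v (missed ?W m')" using essential(1) by (auto simp: missed_def)
    have "v \<in> missed V ?m" by (simp add: ms)
    then have nmax: "\<not> max_gmatching adj V ?m" using essential(2) by blast
    have "card (missed V m) < card (missed V ?m)"
    proof (rule ccontr)
      assume "\<not> card (missed V m) < card (missed V ?m)"
      then have "max_gmatching adj V ?m"
        using g m unfolding max_gmatching_def by (meson le_trans not_less)
      then show False using nmax by simp
    qed
    moreover have "card (missed V ?m) = Suc (card (missed ?W m'))"
      unfolding ms using finite_subset[OF _ fin, of "missed ?W m'"] by (auto simp: missed_def)
    moreover have "even (card (missed V m) + card (missed V ?m))"
      using even_card_missed[OF fin gm] even_card_missed[OF fin g] by (simp add: even_add)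
    \<comment> \<open>By parity \<open>?m\<close> misses at least two vertices more than
      \<open>m\<close>. One of the two may be \<open>v\<close> itself; the other pays for the
      insertion of \<open>v\<close> into \<open>U\<close>.\<close>
    moreover have "Suc i \<le> j" if "i < l" "l = Suc j" "even (i + l)" for i j l :: nat
      using that by presburger
    ultimately have "Suc (card (missed V m)) \<le> card (missed ?W m')" by blast
    moreover have "card (insert v U) \<le> Suc (card U)" by (rule card_insert_le_m1) simp_all
    ultimately have "card (missed V m) + card (insert v U) \<le> card \<O>" using c'(6) by linarith
    moreover have W: "V - insert v U = ?W - U" by blast
    moreover have "insert v U \<subseteq> V" using c'(2) essential(1) by blast
    ultimately have "berge_certificate adj V m (insert v U) \<O>"
      unfolding berge_certificate_def W using c'(3-5) gm by blast
    then show ?thesis by blast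
  next
    case critical
    have pair: "\<not> (u \<in> missed V m \<and> w \<in> missed V m)"
      if "u \<in> V" "w \<in> V" "u \<noteq> w" "max_gmatching adj V m" for u w m
    proof -
      \<comment> \<open>\<open>A\<close> consists of \<open>u\<close> and the vertices never missed
        together with it. Adjacent vertices are never missed together, so by
        \<open>gallai_transitive\<close> the set is closed under adjacency, and connectivity makes
        it all of \<open>V\<close>.\<close>
      define A where "A = {x \<in> V. x = u \<or> (\<forall>m. max_gmatching adj V m \<longrightarrow> \<not> (u \<in> missed V m \<and> x \<in> missed V m))}"
      have "A = V"
      proof (rule ccontr)
        assume "A \<noteq> V"
        moreover have "A \<subseteq> V" "A \<noteq> {}" using that by (auto simp: A_def)
        ultimately obtain x y where xy: "x \<in> A" "y \<in> V - A" "adj x y" using critical(1) by blast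
        have yu: "y \<noteq> u" using xy by (auto simp: A_def)
        have xne: "x \<noteq> y" using xy by auto
        have adjxy: "\<not> (x \<in> missed V m \<and> y \<in> missed V m)" if "max_gmatching adj V m" for m
          using not_adj_missed[OF fin sym that] xy(3) xne by blast
        have "\<not> (u \<in> missed V m \<and> y \<in> missed V m)" if m: "max_gmatching adj V m" for m
        proof (cases "x = u")
          case True
          then show ?thesis using adjxy[OF m] by simp
        next
          case False
          have "x \<in> V" using xy by (simp add: A_def)
          show ?thesis
          proof (rule gallai_transitive[OF fin sym _ _ adjxy yu[symmetric] m])
            show "\<exists>m. max_gmatching adj V m \<and> x \<in> missed V m" using critical(2) \<open>x \<in> V\<close> by blast
            show "\<not> (u \<in> missed V m \<and> x \<in> missed V m)" if "max_gmatching adj V m" for m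
              using xy(1) False that by (auto simp: A_def)
          qed
        qed
        then have "y \<in> A" using xy by (simp add: A_def)
        then show False using xy by simp
      qed
      then have "w \<in> A" using that by simp
      then show ?thesis using that by (auto simp: A_def)
    qed
    obtain m where m: "max_gmatching adj V m" using max_gmatching_exists by blast
    then have gm: "gmatching adj V m" by (simp add: max_gmatching_def)
    have le1: "card (missed V m) \<le> 1"
    proof (rule ccontr)
      assume "\<not> ?thesis"
      then have "2 \<le> card (missed V m)" by simp
      then obtain S where S: "S \<subseteq> missed V m" "card S = 2" by (rule obtain_subset_with_card_n)
      then obtain u w where "S = {u, w}" "u \<noteq> w" by (auto simp: card_2_iff)
      then have "u \<in> missed V m" "w \<in> missed V m" "u \<noteq> w" using S by auto
      then show False using pair[of u w m] m by (auto simp: missed_def)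
    qed
    show ?thesis
    proof (cases "missed V m = {}")
      case True
      then have "berge_certificate adj V m {} {}" using gm by (simp add: berge_certificate_def)
      then show ?thesis by blast
    next
      case False
      then have "card (missed V m) = 1" using le1 finm[of m] by (simp add: le_Suc_eq)
      moreover from this have "odd (card V)" using even_card_missed[OF fin gm] by simp
      ultimately have "berge_certificate adj V m {} {V}" using gm by (simp add: berge_certificate_def)
      then show ?thesis by blast
    qed
  qed
qed

section \<open>Perfect matchings of cubic graphs\<close>

context cubic_ess4
begin

lemma even_card_vertices: "even (card (vertices G))"
proof -
  have "(\<Sum>v\<in>vertices G. card {e \<in> edges G. v \<in> ends G e}) =
      (\<Sum>e\<in>edges G. card {v \<in> vertices G. v \<in> ends G e})"
    using sum.swap_restrict[OF finite_vertices finite_edges, of "\<lambda>_ _. 1 :: nat" "\<lambda>v e. v \<in> ends G e"]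
    by simp
  also have "\<dots> = (\<Sum>e\<in>edges G. 2)"
  proof (rule sum.cong)
    fix e assume e: "e \<in> edges G"
    have "{v \<in> vertices G. v \<in> ends G e} = ends G e" using ends_subset[OF e] by blast
    then show "card {v \<in> vertices G. v \<in> ends G e} = 2" using card_ends[OF e] by simp
  qed simp
  finally have "3 * card (vertices G) = 2 * card (edges G)" using card_incident by simp
  then show ?thesis by presburger
qed

text \<open>Every odd set of a Tutte-Berge certificate sends at least three edges to \<open>U\<close>.\<close>

theorem perfect_matching_exists: "\<exists>M. graph_matching M \<and> \<Union> (ends G ` M) = vertices G"
proof -
  let ?V = "vertices G"
  define adj where "adj u v \<longleftrightarrow> (\<exists>e\<in>edges G. ends G e = {u, v})" for u v
  have "adj y x" if "adj x y" for x y using that by (simp add: adj_def insert_commute)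
  then obtain m U \<O> where "berge_certificate adj ?V m U \<O>"
    using tutte_berge[OF finite_vertices] by blast
  then have m: "gmatching adj ?V m" and U: "U \<subseteq> ?V" and disj: "disjoint \<O>" and sub: "\<O> \<subseteq> Pow (?V - U)"
    and odd: "\<And>Q. Q \<in> \<O> \<Longrightarrow> odd (card Q)"
    and closed: "\<And>Q x y. Q \<in> \<O> \<Longrightarrow> x \<in> Q \<Longrightarrow> y \<in> ?V - U \<Longrightarrow> adj x y \<Longrightarrow> y \<in> Q"
    and le: "card (missed ?V m) + card U \<le> card \<O>"
    unfolding berge_certificate_def by blast+
  have finU: "finite U" using finite_subset[OF U finite_vertices] .
  have finO: "finite \<O>" using finite_subset[OF sub] finite_vertices by simp
  have cut3: "3 \<le> card (cut G Q)" if Q: "Q \<in> \<O>" for Q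
  proof (rule card_cut_ge3)
    show "Q \<noteq> {}" using odd[OF Q] by auto
    have "Q \<noteq> ?V" using odd[OF Q] even_card_vertices by auto
    then show "Q \<subset> ?V" using sub Q by blast
  qed
  have cut_end: "\<exists>u x. ends G e = {u, x} \<and> u \<in> U \<and> x \<in> Q" if Q: "Q \<in> \<O>" and e: "e \<in> cut G Q" for Q e
  proof -
    have eE: "e \<in> edges G" using e cut_subset by blast
    obtain a b where ab: "ends G e = {a, b}" using card_ends[OF eE] by (auto simp: card_2_iff)
    have V: "a \<in> ?V" "b \<in> ?V" using ends_subset[OF eE] ab by auto
    have adj: "adj a b" "adj b a" using ab eE by (auto simp: adj_def insert_commute)
    have "(a \<in> Q) \<noteq> (b \<in> Q)" using mem_cut_iff[OF eE ab] e by blast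
    then consider "a \<in> Q" "b \<notin> Q" | "b \<in> Q" "a \<notin> Q" by blast
    then show ?thesis
    proof cases
      case 1
      then have "b \<in> U" using closed[OF Q 1(1)] V(2) adj(1) by blast
      then show ?thesis using ab 1 by (intro exI[of _ b] exI[of _ a]) auto
    next
      case 2
      then have "a \<in> U" using closed[OF Q 2(1)] V(1) adj(2) by blast
      then show ?thesis using ab 2 by blast
    qed
  qed
  \<comment> \<open>Different odd sets have disjoint cuts, and all these edges end in
    \<open>U\<close>, where each vertex absorbs at most three of them.\<close>
  have "3 * card \<O> \<le> (\<Sum>Q\<in>\<O>. card (cut G Q))"
    using sum_mono[of \<O> "\<lambda>_. 3" "\<lambda>Q. card (cut G Q)"] cut3 by simp
  also have "\<dots> = card (\<Union>Q\<in>\<O>. cut G Q)"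
  proof (rule card_UN_disjoint[symmetric, OF finO])
    show "\<forall>Q\<in>\<O>. finite (cut G Q)" by simp
    show "\<forall>Q\<in>\<O>. \<forall>R\<in>\<O>. Q \<noteq> R \<longrightarrow> cut G Q \<inter> cut G R = {}"
    proof (intro ballI impI)
      fix Q R assume QR: "Q \<in> \<O>" "R \<in> \<O>" "Q \<noteq> R"
      have dQR: "Q \<inter> R = {}" using disj QR by (auto simp: disjoint_def)
      have QU: "Q \<inter> U = {}" "R \<inter> U = {}" using sub QR by blast+
      show "cut G Q \<inter> cut G R = {}"
      proof (rule ccontr)
        assume "cut G Q \<inter> cut G R \<noteq> {}"
        then obtain e where e: "e \<in> cut G Q" "e \<in> cut G R" by blast
        obtain u x where ux: "ends G e = {u, x}" "u \<in> U" "x \<in> Q" using cut_end[OF QR(1) e(1)] by blast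
        obtain u' x' where ux': "ends G e = {u', x'}" "u' \<in> U" "x' \<in> R" using cut_end[OF QR(2) e(2)] by blast
        have "x' = u \<or> x' = x" using ux(1) ux'(1) by blast
        then show False using ux(2,3) ux'(3) QU dQR by blast
      qed
    qed
  qed
  also have "\<dots> \<le> card (\<Union>u\<in>U. {e \<in> edges G. u \<in> ends G e})"
  proof (rule card_mono)
    show "finite (\<Union>u\<in>U. {e \<in> edges G. u \<in> ends G e})" using finU finite_edges by simp
    show "(\<Union>Q\<in>\<O>. cut G Q) \<subseteq> (\<Union>u\<in>U. {e \<in> edges G. u \<in> ends G e})"
    proof
      fix e assume "e \<in> (\<Union>Q\<in>\<O>. cut G Q)"
      then obtain Q where Q: "Q \<in> \<O>" "e \<in> cut G Q" by blast
      then obtain u x where "ends G e = {u, x}" "u \<in> U" using cut_end[OF Q] by blast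
      moreover have "e \<in> edges G" using Q(2) cut_subset by blast
      ultimately show "e \<in> (\<Union>u\<in>U. {e \<in> edges G. u \<in> ends G e})" by blast
    qed
  qed
  also have "\<dots> \<le> (\<Sum>u\<in>U. card {e \<in> edges G. u \<in> ends G e})" by (rule card_UN_le[OF finU])
  also have "\<dots> = (\<Sum>u\<in>U. 3)"
    by (rule sum.cong) (use card_incident U in blast)+
  finally have "card \<O> \<le> card U" by simp
  then have "card (missed ?V m) = 0" using le by simp
  moreover have "finite (missed ?V m)" using finite_vertices by (simp add: missed_def)
  ultimately have "missed ?V m = {}" by simp
  then have nofix: "m v \<noteq> v" if "v \<in> ?V" for v using that by (auto simp: missed_def)
  have mv: "m v \<in> ?V" "m (m v) = v" if "v \<in> ?V" for v
    using m that by (auto simp: gmatching_def)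
  \<comment> \<open>Choosing by the set \<open>{v, m v}\<close> makes \<open>v\<close> and
    \<open>m v\<close> select the same one among parallel edges.\<close>
  define \<epsilon> where "\<epsilon> S = (SOME e. e \<in> edges G \<and> ends G e = S)" for S
  have \<epsilon>: "\<epsilon> {v, m v} \<in> edges G \<and> ends G (\<epsilon> {v, m v}) = {v, m v}" if v: "v \<in> ?V" for v
  proof -
    have "adj v (m v)" using m v nofix[OF v] by (auto simp: gmatching_def)
    then have "\<exists>e. e \<in> edges G \<and> ends G e = {v, m v}" by (auto simp: adj_def)
    then show ?thesis unfolding \<epsilon>_def by (rule someI_ex)
  qed
  let ?M = "(\<lambda>v. \<epsilon> {v, m v}) ` ?V"
  have "graph_matching ?M"
    unfolding graph_matching_def
  proof (intro conjI ballI impI)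
    show "?M \<subseteq> edges G" using \<epsilon> by blast
    fix e e' assume "e \<in> ?M" "e' \<in> ?M" and ne: "e \<noteq> e'"
    then obtain u v where uv: "u \<in> ?V" "v \<in> ?V" "e = \<epsilon> {u, m u}" "e' = \<epsilon> {v, m v}" by blast
    have "{u, m u} \<noteq> {v, m v}" using ne uv by auto
    then have "v \<noteq> u" "v \<noteq> m u" "m v \<noteq> u" using mv(2) uv(1,2) by auto
    moreover from this have "m v \<noteq> m u" using mv(2)[OF uv(1)] mv(2)[OF uv(2)] by auto
    ultimately show "ends G e \<inter> ends G e' = {}" using \<epsilon>[OF uv(1)] \<epsilon>[OF uv(2)] uv by auto
  qed
  moreover have "\<Union> (ends G ` ?M) = ?V"
  proof
    show "\<Union> (ends G ` ?M) \<subseteq> ?V" using \<epsilon> mv(1) by auto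
    show "?V \<subseteq> \<Union> (ends G ` ?M)" using \<epsilon> by blast
  qed
  ultimately show ?thesis by blast
qed

end

theorem theorem16:
  fixes G :: "('v, 'e) multigraph"
  assumes "fin_multigraph G"
    and "cubic G"
    and "essentially_4_edge_connected G"
  shows "frank_number G \<le> 3"
proof -
  interpret cubic_ess4 G
    using assms by (intro cubic_ess4.intro cubic_ess4_axioms.intro)
  have "frank_cover G 3"
  \<comment> \<open>Strong connectivity demands a vertex, so the empty graph is treated apart; it
    has no edges to delete.\<close>
  proof (cases "vertices G = {}")
    case True
    then have "edges G = {}" using card_ends ends_subset by fastforce
    then show ?thesis using True
      by (auto simp: frank_cover_def orientation_def
          intro!: exI[of _ "\<lambda>_. \<lparr>verts = {}, arcs = {}, tail = undefined, head = undefined\<rparr>"])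
  next
    case False
    then show ?thesis using perfect_matching_exists frank_cover_of_perfect_matching by blast
  qed
  then have "frank_number G \<le> enat 3" using frank_number_le_iff by blast
  then show ?thesis by (simp add: numeral_eq_enat)
qed

end
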